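(* Let $r\ge 2$ and $t\ge 1$ be integers. Then: (1) if $r=3$ and $t=1$, then for every $n\ge 3$, $\mathrm{ex}^{\mathrm{col}}(n,(S_3,M_1),C_4)=\mathcal N(S_3,F_n)$; (2) if $r\ge 4$ and $t<2(r-1)/3$, then for $n$ large enough, $\mathrm{ex}^{\mathrm{col}}(n,(S_r,M_t),C_4)=\mathcal N^{\mathrm{col}}(S_r,M_t;F_n^* )$; (3) if $r=4$ and $t=2$, then for $n$ large enough, $\mathrm{ex}^{\mathrm{col}}(n,(S_4,M_2),C_4)=\mathcal N^{\mathrm{col}}(S_4,M_2;F_n^* )$; (4) for all other pairs $(r,t)$ (i.e. $t\ge 2(r-1)/3$ and $(r,t)\notin\{(3,1),(4,2)\}$), for $n$ large enough, $\mathrm{ex}^{\mathrm{col}}(n,(S_r,M_t),C_4)=\mathrm{ex}(n,M_t,C_4)$.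
   Context: $S_r$ is the star with $r$ vertices, $M_t$ is the matching with $t$ edges, $C_4$ is the 4-cycle. $F_n$ is the graph obtained from the star $S_n$ by adding a matching of size $\lfloor (n-1)/2\rfloor$ on its leaves; $F_n^*$ is $F_n$ with the star edges colored 1 (blue) and the matching edges colored 2 (red). $\mathcal N(H,G)$ is the number of subgraphs of $G$ isomorphic to $H$, and $\mathrm{ex}(n,H,F)$ is its maximum over $F$-free $n$-vertex $G$. For a graph $G$ with edges colored $1,2$, $G_i$ is the subgraph of edges of color $i$, and $\mathcal N^{\mathrm{col}}(H_1,H_2;G)=\mathcal N(H_1,G_1)+\mathcal N(H_2,G_2)$; $\mathrm{ex}^{\mathrm{col}}(n,(H_1,H_2),F)$ is the maximum of $\mathcal N^{\mathrm{col}}(H_1,H_2;G)$ over all $F$-free $n$-vertex graphs $G$ and all 2-colorings of their edges. *)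

theory Defs
  imports Main
begin

definition graph_on :: "nat \<Rightarrow> nat set set \<Rightarrow> bool" where
  "graph_on n E \<longleftrightarrow> E \<subseteq> {e. \<exists>u v. e = {u, v} \<and> u \<noteq> v \<and> u < n \<and> v < n}"

definition graph_iso :: "('a set \<times> 'a set set) \<Rightarrow> ('b set \<times> 'b set set) \<Rightarrow> bool" where
  "graph_iso G H \<longleftrightarrow> (\<exists>f. bij_betw f (fst G) (fst H) \<and> (image f) ` (snd G) = snd H)"

(* number of subgraphs of the graph with edge set E isomorphic to H,
   for pattern graphs H without isolated vertices: a copy is determined by its edge set F *)
definition copies :: "(nat set \<times> nat set set) \<Rightarrow> nat set set \<Rightarrow> nat" where
  "copies H E = card {F. F \<subseteq> E \<and> graph_iso (\<Union>F, F) H}"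

definition star :: "nat \<Rightarrow> nat set \<times> nat set set" where
  "star r = ({0..<r}, {{0, i} | i. 1 \<le> i \<and> i < r})"

definition matching :: "nat \<Rightarrow> nat set \<times> nat set set" where
  "matching t = ({0..<2*t}, {{2*i, 2*i+1} | i. i < t})"

definition C4 :: "nat set \<times> nat set set" where
  "C4 = ({0..<4}, {{0,1},{1,2},{2,3},{3,0}})"

definition free_of :: "(nat set \<times> nat set set) \<Rightarrow> nat set set \<Rightarrow> bool" where
  "free_of H E \<longleftrightarrow> \<not> (\<exists>F. F \<subseteq> E \<and> graph_iso (\<Union>F, F) H)"

definition ex :: "nat \<Rightarrow> (nat set \<times> nat set set) \<Rightarrow> (nat set \<times> nat set set) \<Rightarrow> nat" where
  "ex n H Fb = Max {copies H E | E. graph_on n E \<and> free_of Fb E}"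

(* ex^col(n,(H1,H2),F): E1 = edges of colour 1, E - E1 = edges of colour 2 *)
definition ex_col :: "nat \<Rightarrow> (nat set \<times> nat set set) \<Rightarrow> (nat set \<times> nat set set)
                       \<Rightarrow> (nat set \<times> nat set set) \<Rightarrow> nat" where
  "ex_col n H1 H2 Fb = Max {copies H1 E1 + copies H2 (E - E1) | E E1.
                             graph_on n E \<and> free_of Fb E \<and> E1 \<subseteq> E}"

definition Fn_blue :: "nat \<Rightarrow> nat set set" where
  "Fn_blue n = {{0, i} | i. 1 \<le> i \<and> i < n}"

definition Fn_red :: "nat \<Rightarrow> nat set set" where
  "Fn_red n = {{2*i - 1, 2*i} | i. 1 \<le> i \<and> i \<le> (n - 1) div 2}"

definition Fn :: "nat \<Rightarrow> nat set set" where
  "Fn n = Fn_blue n \<union> Fn_red n"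

definition Fn_star_col :: "(nat set \<times> nat set set) \<Rightarrow> (nat set \<times> nat set set) \<Rightarrow> nat \<Rightarrow> nat" where
  "Fn_star_col H1 H2 n = copies H1 (Fn_blue n) + copies H2 (Fn_red n)"

end

theory Submission
  imports Defs "HOL-Number_Theory.Prime_Powers" "HOL-Real_Asymp.Real_Asymp" "HOL-Analysis.Analysis"
begin

text \<open>
  In a \<open>C4\<close>-free graph any two vertices have at most one common neighbour. Hence the sum of
  \<open>d(v) choose 2\<close> is at most \<open>n choose 2\<close>, there are at most \<open>n^(3/2)\<close> edges, and the
  neighbourhood of a vertex is a matching that sends at most one edge to any other vertex.

  For (1), blue cherries are charged to their pair of end vertices and red edges to pairs whose
  common neighbour, if there is one, gives no blue cherry; if every pair is charged, then the graph
  is a friendship graph and \<open>n\<close> is odd.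

  For (2) and (3), the count forces a vertex \<open>v\<close> of blue degree \<open>n - 1 - s\<close> with \<open>s\<close> small compared
  with \<open>n\<close>. If \<open>s = 0\<close>, the red edges form a matching on the leaves of \<open>v\<close>; if \<open>s \<ge> 1\<close>, the loss in
  stars centred at \<open>v\<close>, of order \<open>s n^(r-2)\<close>, exceeds everything else.

  For (4), the all-red colouring of a dense \<open>C4\<close>-free graph beats a colouring with few red matchings.
  Otherwise, if all blue degrees are at most \<open>n^(7/8)\<close>, recolouring all edges red pays off. If not,
  only \<open>O(n^(5/4))\<close> edges meet the union \<open>W\<close> of the large blue neighbourhoods, and replacing them by a
  dense \<open>C4\<close>-free graph on \<open>W\<close> compensates for the lost stars and matchings.
  When \<open>3 t = 2 (r - 1)\<close> both counts have order \<open>n^(r-1)\<close>, and the constants only work out, for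
  \<open>(r, t) = (7, 4)\<close>, if \<open>C4\<close>-free graphs with at least \<open>0.4273 n^(3/2)\<close> edges exist for every large \<open>n\<close>.
  They come from polarity graphs over prime fields, since by Chebyshev's argument there is a
  prime in \<open>[x, 1.21 x]\<close> for all large \<open>x\<close>.
\<close>

section \<open>Primes in short intervals\<close>

text \<open>On the line \<open>3 t = 2 (r - 1)\<close> write \<open>t = 2 k\<close>,
  \<open>r = 3 k + 1\<close>. A C4-free graph with c n^(3/2) edges has about c^t n^(r-1) / t!
  matchings and a spanning star about n^(r-1) / (r-1)! stars, so red wins iff c^(2k) > (2k)! /
  (3k)!. For k = 1 this asks for c > 0.577, while C4-free graphs stop at c = 1/2; hence the
  exception (4, 2). For k = 2 it asks for c > 30^(-1/4), which is the 0.4273 above, and for larger k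
  for less. A polarity graph over p elements has about p^2 vertices and p^3 / 2 edges. Used whole
  inside n vertices it would need p \<ge> 0.949 sqrt n, hence primes in intervals of ratio 1.054,
  which Chebyshev's argument does not give. For p > sqrt n, keeping only as many first coordinates
  as fit costs merely the factor sqrt n / p and admits p up to 1.17 sqrt n. The admissible ratio
  1.17 / 0.949 = 1.23 then exceeds Chebyshev's 6/5, which leaves room for the 1.21.\<close>

definition psi :: "nat \<Rightarrow> real" where
  "psi n = (\<Sum>d=1..n. mangoldt d)"

text \<open>Going from \<open>n\<close> to \<open>Suc n\<close> raises \<open>n div d\<close>
  exactly for the divisors \<open>d\<close> of \<open>Suc n\<close>, and their
  \<open>mangoldt\<close> values add up to \<open>ln (Suc n)\<close>.\<close>

lemma ln_fact_eq_sum_mangoldt: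
  "ln (fact n :: real) = (\<Sum>d=1..n. mangoldt d * real (n div d))"
proof (induction n)
  case 0
  then show ?case by simp
next
  case (Suc n)
  have divs: "{d \<in> {1..Suc n}. d dvd Suc n} = {d. d dvd Suc n}"
    by (auto dest: dvd_imp_le dvd_pos_nat[rotated] simp: Suc_le_eq)
  have step: "real (Suc n div d) = real (n div d) + (if d dvd Suc n then 1 else 0)" for d
    by (auto simp: div_Suc mod_0_imp_dvd dvd_imp_mod_0)
  have "(\<Sum>d=1..Suc n. mangoldt d * real (Suc n div d))
      = (\<Sum>d=1..Suc n. mangoldt d * real (n div d)) + (\<Sum>d=1..Suc n. if d dvd Suc n then mangoldt d else 0)"
    unfolding step sum.distrib[symmetric] by (intro sum.cong) (auto simp: algebra_simps)
  also have "(\<Sum>d=1..Suc n. if d dvd Suc n then mangoldt d else 0) = (\<Sum>d | d dvd Suc n. (mangoldt d :: real))"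
    unfolding divs[symmetric] by (rule sum.inter_filter[symmetric]) simp
  also have "\<dots> = ln (real (Suc n))"
    by (subst mangoldt_sum) auto
  also have "(\<Sum>d=1..Suc n. mangoldt d * real (n div d)) = ln (fact n)"
    using Suc by simp
  finally show ?case by (simp add: ln_mult)
qed

lemma ln_fact_div_eq_sum_mangoldt:
  assumes "k > 0"
  shows "ln (fact (n div k) :: real) = (\<Sum>d=1..n. mangoldt d * real (n div d div k))"
proof -
  have "(\<Sum>d=1..n. mangoldt d * real (n div d div k)) = (\<Sum>d=1..n. mangoldt d * real (n div k div d))"
    by (simp add: div_mult2_eq[symmetric] mult.commute)
  also have "\<dots> = (\<Sum>d=1..n div k. mangoldt d * real (n div k div d))"
    by (rule sum.mono_neutral_right) (auto simp: not_le)
  finally show ?thesis by (simp add: ln_fact_eq_sum_mangoldt)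
qed

text \<open>The logarithm of Chebyshev's quotient n! (n/30)! / ((n/2)! (n/3)! (n/5)!), chosen
  because its coefficients with respect to \<open>mangoldt\<close> are 0 or 1 and equal 1 for the
  quotients 1 to 5.\<close>

definition chebyshev_sum :: "nat \<Rightarrow> real" where
  "chebyshev_sum n = ln (fact n) - ln (fact (n div 2)) - ln (fact (n div 3)) - ln (fact (n div 5))
     + ln (fact (n div 30))"

definition chebyshev_coeff :: "nat \<Rightarrow> real" where
  "chebyshev_coeff m = real m - real (m div 2) - real (m div 3) - real (m div 5) + real (m div 30)"

lemma chebyshev_sum_eq: "chebyshev_sum n = (\<Sum>d=1..n. mangoldt d * chebyshev_coeff (n div d))"
  unfolding chebyshev_sum_def chebyshev_coeff_def
  by (simp add: ln_fact_eq_sum_mangoldt[of n] ln_fact_div_eq_sum_mangoldt sum.distrib sum_subtractf algebra_simps)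

text \<open>The coefficient depends only on \<open>m mod 30\<close>, because \<open>1 - 1/2 - 1/3 - 1/5 + 1/30 = 0\<close>.\<close>

lemma chebyshev_coeff_bounds:
  "0 \<le> chebyshev_coeff m" "chebyshev_coeff m \<le> 1" "1 \<le> m \<Longrightarrow> m < 6 \<Longrightarrow> chebyshev_coeff m = 1"
proof -
  define q s where "q = m div 30" and "s = m mod 30"
  have m: "m = 30 * q + s" and s: "s < 30" by (auto simp: q_def s_def)
  have d: "m div 2 = 15 * q + s div 2" "m div 3 = 10 * q + s div 3" "m div 5 = 6 * q + s div 5" "m div 30 = q"
    using s by (auto simp: m)
  have c: "chebyshev_coeff m = real s - real (s div 2) - real (s div 3) - real (s div 5)"
    unfolding chebyshev_coeff_def d by (simp add: m)
  have "s \<in> {0..<30}" using s by simp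
  hence "s \<in> set [0..<30]" by simp
  moreover have "\<forall>s\<in>set [0..<30]. s div 2 + s div 3 + s div 5 \<le> s \<and> s \<le> s div 2 + s div 3 + s div 5 + (1::nat)"
    by code_simp
  ultimately have "s div 2 + s div 3 + s div 5 \<le> s \<and> s \<le> s div 2 + s div 3 + s div 5 + 1"
    by blast
  hence "real (s div 2 + s div 3 + s div 5) \<le> real s \<and> real s \<le> real (s div 2 + s div 3 + s div 5 + 1)"
    by (simp only: of_nat_le_iff)
  thus "0 \<le> chebyshev_coeff m" "chebyshev_coeff m \<le> 1" unfolding c by simp_all
  assume "1 \<le> m" "m < 6"
  hence "m \<in> set [1..<6]" by simp
  thus "chebyshev_coeff m = 1"
    by (simp add: upt_rec) (elim disjE; simp add: chebyshev_coeff_def)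
qed

lemma chebyshev_sum_le_psi: "chebyshev_sum n \<le> psi n"
  unfolding chebyshev_sum_eq psi_def
  by (intro sum_mono) (use mult_left_mono[OF chebyshev_coeff_bounds(2) mangoldt_nonneg] in auto)

text \<open>For \<open>n div 6 < d \<le> n\<close> the quotient \<open>n div d\<close> lies between
  1 and 5, where the coefficient is 1; all other terms of the sum are nonnegative.\<close>

lemma psi_diff_le_chebyshev_sum: "psi n - psi (n div 6) \<le> chebyshev_sum n"
proof -
  have "psi n = psi (n div 6) + (\<Sum>d\<in>{n div 6<..n}. mangoldt d)"
    unfolding psi_def by (subst sum.union_disjoint[symmetric]) (auto intro!: sum.cong)
  moreover have "(\<Sum>d\<in>{n div 6<..n}. mangoldt d) \<le> (\<Sum>d\<in>{n div 6<..n}. mangoldt d * chebyshev_coeff (n div d))"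
  proof (intro sum_mono)
    fix d assume d: "d \<in> {n div 6<..n}"
    hence "n < d * 6" by (simp add: div_less_iff_less_mult)
    hence "n div d < 6" by (intro less_mult_imp_div_less) (simp add: mult.commute)
    moreover have "1 \<le> n div d" using d by (simp add: Suc_le_eq div_greater_zero_iff)
    ultimately have "n div d < 6" "1 \<le> n div d" by blast+
    thus "mangoldt d \<le> mangoldt d * chebyshev_coeff (n div d)"
      using chebyshev_coeff_bounds(3) by simp
  qed
  moreover have "\<dots> \<le> chebyshev_sum n"
    unfolding chebyshev_sum_eq
    by (intro sum_mono2) (auto simp: mangoldt_nonneg chebyshev_coeff_bounds)
  ultimately show ?thesis by linarith
qed

section \<open>Stirling's estimate and the asymptotics of Chebyshev's sum\<close>

lemma ln_fact_bounds:
  assumes "n \<ge> 1"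
  shows "n * ln n - n \<le> ln (fact n :: real)" "ln (fact n :: real) \<le> n * ln n - n + ln n + 1"
proof -
  have "n * ln n - n \<le> ln (fact n :: real) \<and> ln (fact n :: real) \<le> n * ln n - n + ln n + 1"
    using assms
  proof (induction n rule: dec_induct)
    case base
    then show ?case by simp
  next
    case (step n)
    define x where "x = real n"
    have x: "x \<ge> 1" using step by (simp add: x_def)
    have a: "ln (x + 1) - ln x \<le> 1 / x"
    proof -
      have "ln (x + 1) - ln x = ln (1 + 1 / x)" using x by (subst ln_divide_pos[symmetric]) (auto simp: field_simps)
      also have "\<dots> \<le> 1 / x" using x by (intro ln_add_one_self_le_self) auto
      finally show ?thesis .
    qed
    have b: "ln (x + 1) - ln x \<ge> 1 / (x + 1)"
    proof -
      have "ln (x / (x + 1)) \<le> x / (x + 1) - 1" using x by (intro ln_le_minus_one) auto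
      moreover have "x / (x + 1) - 1 = - (1 / (x + 1))" using x by (simp add: field_simps)
      moreover have "ln (x / (x + 1)) = ln x - ln (x + 1)" using x by (simp add: ln_div)
      ultimately show ?thesis by linarith
    qed
    have a': "x * (ln (x + 1) - ln x) \<le> 1" using a x by (simp add: field_simps)
    have b': "(x + 1) * (ln (x + 1) - ln x) \<ge> 1" using b x by (simp add: field_simps)
    have f: "ln (fact (Suc n) :: real) = ln (x + 1) + ln (fact n)"
      by (simp add: ln_mult x_def add.commute)
    show ?case using step.IH a' b' unfolding f x_def[symmetric]
      by (simp add: x_def[symmetric] algebra_simps)
  qed
  thus "n * ln n - n \<le> ln (fact n :: real)" "ln (fact n :: real) \<le> n * ln n - n + ln n + 1" by auto
qed

lemma mult_ln_minus_mono:
  assumes "1 \<le> x" "x \<le> (y :: real)"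
  shows "x * ln x - x \<le> y * ln y - y"
proof (rule DERIV_nonneg_imp_nondecreasing[OF assms(2)])
  fix z assume z: "x \<le> z" "z \<le> y"
  have "((\<lambda>x. x * ln x - x) has_real_derivative ln z) (at z)"
    using z assms by (auto intro!: derivative_eq_intros)
  thus "\<exists>l. ((\<lambda>x. x * ln x - x) has_real_derivative l) (at z) \<and> 0 \<le> l" using z assms by auto
qed

lemma ln_fact_div_approx:
  assumes "k > 0" "n \<ge> k"
  shows "\<bar>ln (fact (n div k)) - (n / k * ln (n / k) - n / k)\<bar> \<le> ln (real n + 1) + 1"
proof -
  define m where "m = n div k"
  define x where "x = real n / real k"
  have m1: "m \<ge> 1" unfolding m_def using assms by (simp add: Suc_le_eq div_greater_zero_iff)
  have mx: "real m \<le> x" unfolding m_def x_def by (rule of_nat_div_le_of_nat)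
  have xm: "x \<le> real m + 1"
  proof -
    have "n < k * (m + 1)" unfolding m_def using assms(1) by (simp add: dividend_less_times_div)
    hence "real n \<le> real (k * (m + 1))" using of_nat_le_iff less_imp_le by blast
    thus ?thesis unfolding x_def using assms by (simp add: field_simps)
  qed
  have x1: "x \<ge> 1" using m1 mx by linarith
  have xn: "x \<le> real n" unfolding x_def using assms by (simp add: field_simps)
  have mn: "real m \<le> real n" using mx xn by linarith
  have "ln (fact m) \<le> m * ln m - m + ln m + 1" using ln_fact_bounds(2)[OF m1] .
  also have "\<dots> \<le> x * ln x - x + ln (real n + 1) + 1"
    using mult_ln_minus_mono[of "real m" x] m1 mx ln_mono[of "real m" "real n + 1"] mn by linarith
  finally have u: "ln (fact m) \<le> x * ln x - x + ln (real n + 1) + 1" .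
  \<comment> \<open>The lower bound goes through \<open>(m + 1)!\<close>: rounding may leave
    \<open>x\<close> above \<open>m\<close>, but not above \<open>m + 1\<close>.\<close>
  have "ln (fact (Suc m) :: real) \<ge> Suc m * ln (Suc m) - Suc m" by (rule ln_fact_bounds(1)) simp
  hence "ln (fact m) \<ge> (real m + 1) * ln (real m + 1) - (real m + 1) - ln (real m + 1)"
    by (simp add: ln_mult add.commute del: of_nat_Suc flip: of_nat_Suc)
  moreover have "(real m + 1) * ln (real m + 1) - (real m + 1) \<ge> x * ln x - x"
    using mult_ln_minus_mono[of x "real m + 1"] x1 xm by simp
  moreover have "ln (real m + 1) \<le> ln (real n + 1)" using mn by (intro ln_mono) auto
  ultimately show ?thesis using u unfolding m_def[symmetric] x_def[symmetric] abs_le_iff by linarith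
qed

text \<open>Chebyshev's constant, about 0.9213. It cancels when the upper bound for
  \<open>psi\<close> is compared with the lower one.\<close>

definition chebyshev_const :: real where
  "chebyshev_const = ln 2 / 2 + ln 3 / 3 + ln 5 / 5 - ln 30 / 30"

lemma chebyshev_const_pos: "chebyshev_const > 0"
proof -
  have "ln (30 :: real) = ln (2 * 3 * 5)" by simp
  also have "\<dots> = ln 2 + ln 3 + ln 5" by (subst ln_mult_pos, simp, simp, subst ln_mult_pos) auto
  finally have "ln (30 :: real) = ln 2 + ln 3 + ln 5" .
  moreover have "ln (2 :: real) > 0" "ln (3 :: real) > 0" "ln (5 :: real) > 0" by auto
  ultimately show ?thesis unfolding chebyshev_const_def by linarith
qed

lemma chebyshev_sum_approx:
  assumes "n \<ge> 30"
  shows "\<bar>chebyshev_sum n - chebyshev_const * n\<bar> \<le> 5 * (ln (real n + 1) + 1)"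
proof -
  define g where "g k = real n / k * ln (real n / k) - real n / k" for k :: real
  have n0: "real n > 0" using assms by simp
  have g: "g k = real n * ln n / k - real n * ln k / k - real n / k" if "k > 0" for k
    using n0 that unfolding g_def by (simp add: ln_div right_diff_distrib)
  \<comment> \<open>The terms in \<open>n ln n\<close> and in \<open>n\<close> both carry the factor
    1 - 1/2 - 1/3 - 1/5 + 1/30 = 0; only the terms \<open>n ln k / k\<close> survive.\<close>
  have id: "g 1 - g 2 - g 3 - g 5 + g 30 = chebyshev_const * n"
    by (simp add: g chebyshev_const_def field_simps)
  have "\<bar>ln (fact (n div k)) - g k\<bar> \<le> ln (real n + 1) + 1" if "k > 0" "k \<le> 30" for k
    using ln_fact_div_approx[of k n] that assms unfolding g_def by simp
  from this[of 1] this[of 2] this[of 3] this[of 5] this[of 30] id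
  show ?thesis unfolding chebyshev_sum_def by (simp add: abs_le_iff)
qed

section \<open>Bounds for psi, and primes deduced from them\<close>

lemma psi_mono: "m \<le> n \<Longrightarrow> psi m \<le> psi n"
  unfolding psi_def by (intro sum_mono2) (auto simp: mangoldt_nonneg)

text \<open>Iterating \<open>psi n \<le> c n + psi (n div 6)\<close> gives the geometric series c n
  (1 + 1/6 + 1/36 + ...), which is where 6/5 comes from. The constant \<open>K\<close> stands for
  the small arguments at which the iteration stops.\<close>

lemma psi_upper:
  assumes "\<epsilon> > 0"
  obtains K where "\<And>n. psi n \<le> 6 / 5 * (chebyshev_const + \<epsilon>) * n + K"
proof -
  have "eventually (\<lambda>n. 5 * (ln (real n + 1) + 1) \<le> \<epsilon> * n) sequentially"
    using assms by real_asymp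
  then obtain N where N: "\<And>n. n \<ge> N \<Longrightarrow> 5 * (ln (real n + 1) + 1) \<le> \<epsilon> * n"
    unfolding eventually_sequentially by blast
  define M where "M = max N 30"
  define c where "c = chebyshev_const + \<epsilon>"
  have c0: "c > 0" using assms chebyshev_const_pos by (simp add: c_def)
  have "psi n \<le> 6 / 5 * c * n + psi M" for n
  proof (induction n rule: less_induct)
    case (less n)
    show ?case
    proof (cases "n \<ge> M")
      case False
      hence "psi n \<le> psi M" by (intro psi_mono) auto
      moreover have "0 \<le> 6 / 5 * c * n" using c0 by simp
      ultimately show ?thesis by linarith
    next
      case True
      hence n: "n \<ge> 30" "n \<ge> N" by (auto simp: M_def)
      have "chebyshev_sum n \<le> c * n"
        using chebyshev_sum_approx[OF n(1)] N[OF n(2)] by (simp add: c_def abs_le_iff algebra_simps)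
      hence "psi n \<le> c * n + psi (n div 6)" using psi_diff_le_chebyshev_sum[of n] by linarith
      also have "psi (n div 6) \<le> 6 / 5 * c * real (n div 6) + psi M" using n by (intro less) simp
      also have "6 / 5 * c * real (n div 6) \<le> 6 / 5 * c * (real n / 6)"
        using c0 of_nat_div_le_of_nat[of n 6, where ?'a = real] by (intro mult_left_mono) auto
      also have "c * n + (6 / 5 * c * (real n / 6) + psi M) = 6 / 5 * c * n + psi M" by simp
      finally show ?thesis by simp
    qed
  qed
  thus ?thesis using that unfolding c_def by blast
qed

text \<open>In \<open>q ^ k \<le> N\<close> with \<open>k \<ge> 2\<close>, the base is at most
  \<open>sqrt N\<close> and the exponent at most \<open>log 2 N\<close>. Proper prime powers are
  therefore too rare to account for linear growth of \<open>psi\<close>.\<close>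

lemma card_primepow_not_prime:
  fixes N :: nat
  assumes "N > 0"
  shows "real (card {d \<in> {1..N}. primepow d \<and> \<not> prime d}) \<le> (sqrt N + 1) * (log 2 N + 1)"
proof -
  define A where "A = {d \<in> {1..N}. primepow d \<and> \<not> prime d}"
  have sub: "A \<subseteq> (\<lambda>(q, k). q ^ k) ` ({..nat \<lfloor>sqrt N\<rfloor>} \<times> {..nat \<lfloor>log 2 N\<rfloor>})"
  proof
    fix d assume d: "d \<in> A"
    then obtain q k where qk: "prime q" "k > 0" "d = q ^ k"
      unfolding A_def primepow_def by auto
    have dN: "d \<le> N" using d by (simp add: A_def)
    have "k \<noteq> 1" using d qk unfolding A_def by auto
    hence k: "k \<ge> 2" using qk by linarith
    have q2: "q \<ge> 2" using prime_ge_2_nat[OF qk(1)] .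
    have "q ^ 2 \<le> q ^ k" using q2 k by (intro power_increasing) auto
    hence "real q ^ 2 \<le> real N" using qk dN by (metis le_trans of_nat_le_iff of_nat_power)
    hence "real q \<le> sqrt N" by (rule real_le_rsqrt)
    hence q': "q \<le> nat \<lfloor>sqrt N\<rfloor>" by (simp add: le_nat_floor)
    have "2 ^ k \<le> q ^ k" using q2 by (intro power_mono) auto
    hence "2 ^ k \<le> N" using qk(3) dN by linarith
    hence "real (2 ^ k) \<le> real N" by (rule of_nat_mono)
    hence "(2::real) ^ k \<le> real N" by simp
    hence "real k \<le> log 2 N" using assms by (simp add: le_log_iff powr_realpow)
    hence "k \<le> nat \<lfloor>log 2 N\<rfloor>" by (simp add: le_nat_floor)
    with q' qk show "d \<in> (\<lambda>(q, k). q ^ k) ` ({..nat \<lfloor>sqrt N\<rfloor>} \<times> {..nat \<lfloor>log 2 N\<rfloor>})"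
      by (intro image_eqI[of _ _ "(q, k)"]) auto
  qed
  have "card A \<le> card ({..nat \<lfloor>sqrt N\<rfloor>} \<times> {..nat \<lfloor>log 2 N\<rfloor>})"
    by (rule surj_card_le[OF _ sub]) auto
  also have "\<dots> = (nat \<lfloor>sqrt N\<rfloor> + 1) * (nat \<lfloor>log 2 N\<rfloor> + 1)" by (simp add: card_cartesian_product)
  finally have "real (card A) \<le> real ((nat \<lfloor>sqrt N\<rfloor> + 1) * (nat \<lfloor>log 2 N\<rfloor> + 1))"
    by (rule of_nat_mono)
  also have "\<dots> = (real (nat \<lfloor>sqrt N\<rfloor>) + 1) * (real (nat \<lfloor>log 2 N\<rfloor>) + 1)"
    by (simp only: of_nat_mult of_nat_add of_nat_1)
  also have "\<dots> \<le> (sqrt N + 1) * (log 2 N + 1)"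
    using assms by (intro mult_mono add_mono of_nat_floor) (auto simp: zero_le_log_cancel_iff)
  finally show ?thesis unfolding A_def .
qed

lemma psi_diff_le_if_no_prime:
  assumes "\<And>p. prime p \<Longrightarrow> n < p \<Longrightarrow> p \<le> N \<Longrightarrow> False" and "n \<le> N" "N > 0"
  shows "psi N - psi n \<le> (sqrt N + 1) * (log 2 N + 1) * ln N"
proof -
  define A where "A = {d \<in> {1..N}. primepow d \<and> \<not> prime d}"
  have "psi N = psi n + (\<Sum>d\<in>{n<..N}. mangoldt d)"
    unfolding psi_def using assms(2) by (subst sum.union_disjoint[symmetric]) (auto intro!: sum.cong)
  also have "(\<Sum>d\<in>{n<..N}. mangoldt d) = (\<Sum>d\<in>{n<..N} \<inter> A. (mangoldt d :: real))"
    by (rule sum.mono_neutral_right) (use assms(1) in \<open>auto simp: A_def mangoldt_def\<close>)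
  also have "\<dots> \<le> (\<Sum>d\<in>A. (mangoldt d :: real))"
    by (intro sum_mono2) (auto simp: A_def mangoldt_nonneg)
  also have "\<dots> \<le> (\<Sum>d\<in>A. ln (real N))"
  proof (intro sum_mono)
    fix d assume "d \<in> A"
    hence d: "d > 0" "d \<le> N" by (auto simp: A_def)
    have "mangoldt d \<le> ln (real d)" by (rule mangoldt_le[OF d(1)])
    also have "\<dots> \<le> ln (real N)" using d by simp
    finally show "mangoldt d \<le> ln (real N)" .
  qed
  also have "\<dots> = card A * ln (real N)" by simp
  also have "\<dots> \<le> (sqrt N + 1) * (log 2 N + 1) * ln N"
    using card_primepow_not_prime[OF assms(3)] assms(3) by (intro mult_right_mono) (auto simp: A_def)
  finally show ?thesis by linarith
qed

text \<open>With a = \<open>chebyshev_const\<close>, \<open>psi\<close> is at least about a N at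
  \<open>N\<close> and at most about 6/5 a n at \<open>n\<close>. For N = 1.21 n the difference is
  linear in \<open>n\<close>, more than proper prime powers can contribute.\<close>

lemma prime_between_eventually:
  "\<exists>x0. \<forall>x\<ge>x0. \<exists>p. prime p \<and> x \<le> real p \<and> real p \<le> 121 / 100 * x"
proof -
  define a where "a = chebyshev_const"
  \<comment> \<open>Small enough for 0.998 * 1.21 > 1.2 * 1.001. The 0.998 arises because
    \<open>e\<close> is spent twice: on the lower bound for \<open>psi N\<close> and on the prime
    powers.\<close>
  define e where "e = a / 1000"
  have a0: "a > 0" using chebyshev_const_pos by (simp add: a_def)
  have e0: "e > 0" using a0 by (simp add: e_def)
  obtain K where K: "\<And>n. psi n \<le> 6 / 5 * (a + e) * n + K"
    using psi_upper[OF e0] unfolding a_def by blast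
  have "eventually (\<lambda>n. 5 * (ln (real n + 1) + 1) \<le> e * n \<and>
     (sqrt n + 1) * (log 2 n + 1) * ln n + K + a \<le> e * n \<and> n \<ge> 30) sequentially"
    using e0 by (intro eventually_conj eventually_ge_at_top; real_asymp)
  then obtain N0 where N0: "\<And>n. n \<ge> N0 \<Longrightarrow> 5 * (ln (real n + 1) + 1) \<le> e * n \<and>
     (sqrt n + 1) * (log 2 n + 1) * ln n + K + a \<le> e * n \<and> n \<ge> 30"
    unfolding eventually_sequentially by blast
  have "\<exists>p. prime p \<and> x \<le> real p \<and> real p \<le> 121 / 100 * x" if x: "x \<ge> real N0 + 1" for x :: real
  proof (rule ccontr)
    assume no: "\<not> ?thesis"
    define n where "n = nat \<lfloor>x\<rfloor>"
    define N where "N = nat \<lfloor>121 / 100 * real n\<rfloor>"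
    have x0: "x \<ge> 0" using x by linarith
    have nx: "real n \<le> x" "x < real n + 1" unfolding n_def using x0 by linarith+
    have nN0: "n \<ge> N0" using nx x by linarith
    have n30: "n \<ge> 30" using N0[OF nN0] by blast
    have NN: "real N \<le> 121 / 100 * real n" "121 / 100 * real n < real N + 1" unfolding N_def by linarith+
    have nN: "n \<le> N" using NN n30 by linarith
    have "psi N - psi n \<le> (sqrt N + 1) * (log 2 N + 1) * ln N"
    proof (rule psi_diff_le_if_no_prime)
      fix p assume p: "prime p" "n < p" "p \<le> N"
      have "x \<le> real p" using nx p by linarith
      moreover have "real p \<le> 121 / 100 * x" using p NN nx by linarith
      ultimately show False using no p by blast
    qed (use nN n30 in auto)
    moreover have "(sqrt N + 1) * (log 2 N + 1) * ln N \<le> e * N - K - a"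
      using N0[of N] nN nN0 by (simp add: algebra_simps)
    moreover have "psi n \<le> 6 / 5 * (a + e) * n + K" by (rule K)
    moreover have "psi N \<ge> a * N - e * N"
      using chebyshev_sum_le_psi[of N] chebyshev_sum_approx[of N] N0[of N] nN nN0
      unfolding a_def[symmetric] by (simp add: abs_le_iff)
    ultimately have "a * N - e * N \<le> 6 / 5 * (a + e) * n + e * N - a" by linarith
    \<comment> \<open>The summand \<open>a\<close> in the choice of \<open>N0\<close> becomes the
      \<open>+ 1\<close> here, which absorbs the rounding in \<open>N\<close>.\<close>
    hence *: "a * (998 / 1000 * N + 1) \<le> a * (6 / 5 * (1001 / 1000) * n)"
      unfolding e_def by (simp add: algebra_simps)
    have "998 / 1000 * N + 1 \<le> 6 / 5 * (1001 / 1000) * real n"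
      using mult_left_le_imp_le[OF * a0] .
    thus False using NN n30 by linarith
  qed
  thus ?thesis by blast
qed

section \<open>Graphs without four-cycles\<close>

text \<open>The vertex set is a parameter over an arbitrary type, so that the degree and edge bounds
  also apply to subgraphs living on a neighbourhood or on the set \<open>W\<close> of the surgery
  below.\<close>

definition sgraph :: "'a set \<Rightarrow> 'a set set \<Rightarrow> bool" where
  "sgraph V E \<longleftrightarrow> finite V \<and> (\<forall>e\<in>E. e \<subseteq> V \<and> card e = 2)"

definition nbr :: "'a set set \<Rightarrow> 'a \<Rightarrow> 'a set" where
  "nbr E v = {u. {v, u} \<in> E}"

abbreviation deg :: "'a set set \<Rightarrow> 'a \<Rightarrow> nat" where
  "deg E v \<equiv> card (nbr E v)"

definition c4_free :: "'a set set \<Rightarrow> bool" where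
  "c4_free E \<longleftrightarrow> (\<forall>u v x y. u \<noteq> v \<longrightarrow> x \<in> nbr E u \<inter> nbr E v \<longrightarrow> y \<in> nbr E u \<inter> nbr E v \<longrightarrow> x = y)"

lemma sgraph_finite: "sgraph V E \<Longrightarrow> finite V" "sgraph V E \<Longrightarrow> finite E"
  unfolding sgraph_def by (auto intro: finite_subset[of E "Pow V"])

lemma sgraph_subset: "sgraph V E \<Longrightarrow> E' \<subseteq> E \<Longrightarrow> sgraph V E'"
  unfolding sgraph_def by auto

lemma sgraph_edge: "sgraph V E \<Longrightarrow> e \<in> E \<Longrightarrow> \<exists>u v. e = {u, v} \<and> u \<noteq> v \<and> u \<in> V \<and> v \<in> V"
  unfolding sgraph_def by (metis card_2_iff insert_subset)

lemma nbr_sym: "u \<in> nbr E v \<longleftrightarrow> v \<in> nbr E u"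
  by (simp add: nbr_def insert_commute)

lemma nbr_subset: "sgraph V E \<Longrightarrow> nbr E v \<subseteq> V - {v}"
  unfolding sgraph_def nbr_def by force

lemma nbr_outside: "sgraph V E \<Longrightarrow> v \<notin> V \<Longrightarrow> nbr E v = {}"
  unfolding sgraph_def nbr_def by force

lemma finite_nbr: "sgraph V E \<Longrightarrow> finite (nbr E v)"
  using nbr_subset sgraph_finite(1) by (metis finite_Diff finite_subset)

lemma deg_le: "sgraph V E \<Longrightarrow> v \<in> V \<Longrightarrow> deg E v \<le> card V - 1"
  using nbr_subset sgraph_finite(1) by (metis card_Diff_singleton card_mono finite_Diff)

lemma deg_le_card: "sgraph V E \<Longrightarrow> deg E v \<le> card V"
  using nbr_subset[of V E v] sgraph_finite(1) by (meson Diff_subset card_mono subset_trans)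

lemma nbr_mono: "E \<subseteq> E' \<Longrightarrow> nbr E v \<subseteq> nbr E' v"
  unfolding nbr_def by auto

lemma deg_mono: "E \<subseteq> E' \<Longrightarrow> sgraph V E' \<Longrightarrow> deg E v \<le> deg E' v"
  by (intro card_mono finite_nbr nbr_mono)

lemma c4_free_subset: "c4_free E \<Longrightarrow> E' \<subseteq> E \<Longrightarrow> c4_free E'"
  unfolding c4_free_def nbr_def by blast

lemma c4_free_common:
  assumes "c4_free E" "sgraph V E" "u \<noteq> v"
  shows "card (nbr E u \<inter> nbr E v) \<le> 1"
proof -
  have "finite (nbr E u \<inter> nbr E v)" using finite_nbr[OF assms(2)] by simp
  thus ?thesis using assms(1,3) unfolding c4_free_def by (simp add: card_le_Suc0_iff_eq)
qed

lemma card_incident: 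
  assumes "sgraph V E"
  shows "card {e \<in> E. v \<in> e} = deg E v"
proof -
  have "{e \<in> E. v \<in> e} = (\<lambda>u. {v, u}) ` nbr E v"
    using sgraph_edge[OF assms] by (fastforce simp: nbr_def insert_commute)
  moreover have "inj_on (\<lambda>u. {v, u}) (nbr E v)"
    by (auto simp: inj_on_def doubleton_eq_iff)
  ultimately show ?thesis by (simp add: card_image)
qed

lemma handshake:
  assumes "sgraph V E"
  shows "(\<Sum>v\<in>V. deg E v) = 2 * card E"
proof -
  have fin: "finite V" "finite E" using assms sgraph_finite by auto
  have "(\<Sum>v\<in>V. deg E v) = (\<Sum>v\<in>V. \<Sum>e\<in>E. if v \<in> e then 1 else 0)"
    using fin by (simp add: card_incident[OF assms, symmetric] sum.If_cases Int_def)
  also have "\<dots> = (\<Sum>e\<in>E. \<Sum>v\<in>V. if v \<in> e then 1 else 0)" by (rule sum.swap)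
  also have "\<dots> = (\<Sum>e\<in>E. 2)"
  proof (intro sum.cong refl)
    fix e assume "e \<in> E"
    hence "e \<subseteq> V" "card e = 2" using assms by (auto simp: sgraph_def)
    moreover from this have "V \<inter> {v. v \<in> e} = e" by auto
    ultimately show "(\<Sum>v\<in>V. if v \<in> e then 1 else 0) = (2::nat)"
      using fin by (simp add: sum.If_cases)
  qed
  finally show ?thesis by simp
qed

lemma card_edges_meeting_le:
  assumes "sgraph V E" "finite N"
  shows "card {e \<in> E. e \<inter> N \<noteq> {}} \<le> (\<Sum>x\<in>N. deg E x)"
proof -
  have "{e \<in> E. e \<inter> N \<noteq> {}} = (\<Union>x\<in>N. {e \<in> E. x \<in> e})" by auto
  hence "card {e \<in> E. e \<inter> N \<noteq> {}} \<le> (\<Sum>x\<in>N. card {e \<in> E. x \<in> e})"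
    using card_UN_le[OF assms(2)] by metis
  thus ?thesis by (simp add: card_incident[OF assms(1)])
qed

lemma sum_deg_choose2_le:
  assumes "sgraph V E" "c4_free E"
  shows "(\<Sum>v\<in>V. deg E v choose 2) \<le> card V choose 2"
proof -
  define P where "P v = {B. B \<subseteq> nbr E v \<and> card B = 2}" for v
  have fin: "finite V" using assms sgraph_finite by auto
  have finP: "finite (P v)" for v unfolding P_def using finite_nbr[OF assms(1)] by auto
  have "(\<Sum>v\<in>V. deg E v choose 2) = (\<Sum>v\<in>V. card (P v))"
    unfolding P_def by (simp add: n_subsets finite_nbr[OF assms(1)])
  also have "\<dots> = card (\<Union>v\<in>V. P v)"
  proof (rule card_UN_disjoint[symmetric])
    show "\<forall>u\<in>V. \<forall>v\<in>V. u \<noteq> v \<longrightarrow> P u \<inter> P v = {}"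
    proof (intro ballI impI equals0I)
      fix u v B assume uv: "u \<noteq> v" and B: "B \<in> P u \<inter> P v"
      then obtain x y where "B = {x, y}" "x \<noteq> y" unfolding P_def by (auto simp: card_2_iff)
      thus False using B uv assms(2)[unfolded c4_free_def, rule_format, of x y u v]
        unfolding P_def by (auto simp: nbr_sym[of u] nbr_sym[of v])
    qed
  qed (use fin finP in auto)
  also have "\<dots> \<le> card {B. B \<subseteq> V \<and> card B = 2}"
    using fin nbr_subset[OF assms(1)] by (intro card_mono) (auto simp: P_def)
  finally show ?thesis by (simp add: n_subsets fin)
qed

lemma real_choose_two: "real (n choose 2) = real n * (real n - 1) / 2"
  by (cases n) (auto simp: choose_two algebra_simps real_of_nat_div)

lemma sum_deg_mult_le:
  assumes "sgraph V E" "c4_free E"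
  shows "(\<Sum>v\<in>V. real (deg E v) * (real (deg E v) - 1)) \<le> real (card V) * (real (card V) - 1)"
proof -
  have "real (\<Sum>v\<in>V. deg E v choose 2) \<le> real (card V choose 2)"
    using sum_deg_choose2_le[OF assms] by (rule of_nat_mono)
  thus ?thesis by (simp add: real_choose_two sum_divide_distrib[symmetric])
qed

lemma sum_squared_le_card_mult:
  fixes f :: "'a \<Rightarrow> real"
  shows "(\<Sum>i\<in>A. f i)\<^sup>2 \<le> card A * (\<Sum>i\<in>A. (f i)\<^sup>2)"
  using Cauchy_Schwarz_ineq_sum[of f "\<lambda>_. 1" A] by (simp add: mult.commute)

lemma sum_deg_square_eq:
  assumes "sgraph V E"
  shows "(\<Sum>v\<in>V. (real (deg E v))\<^sup>2) = (\<Sum>v\<in>V. real (deg E v) * (real (deg E v) - 1)) + 2 * card E"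
proof -
  have "(\<Sum>v\<in>V. real (deg E v)) = 2 * real (card E)"
    using handshake[OF assms] by (metis of_nat_mult of_nat_numeral of_nat_sum)
  thus ?thesis by (simp add: power2_eq_square right_diff_distrib sum_subtractf)
qed

text \<open>Cauchy-Schwarz turns the bound on the sum of \<open>d (d - 1)\<close> into 4 e^2 \<le> N
  (N (N - 1) + 2 e). For e > N the term 2 N e is absorbed by e^2. The resulting constant is twice
  the asymptotically best 1/2, in exchange for a bound without error term that holds for every
  graph.\<close>

lemma c4_free_card_square_le:
  assumes "sgraph V E" "c4_free E"
  shows "(real (card E))\<^sup>2 \<le> real (card V) ^ 3"
proof -
  define N e where "N = real (card V)" and "e = real (card E)"
  have s: "(\<Sum>v\<in>V. real (deg E v)) = 2 * e"
    unfolding e_def using handshake[OF assms(1)] by (metis of_nat_mult of_nat_numeral of_nat_sum)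
  have "(2 * e)\<^sup>2 \<le> N * (\<Sum>v\<in>V. (real (deg E v))\<^sup>2)"
    unfolding N_def s[symmetric] by (rule sum_squared_le_card_mult)
  also have "\<dots> \<le> N * (N * (N - 1) + 2 * e)"
    unfolding sum_deg_square_eq[OF assms(1)] using sum_deg_mult_le[OF assms]
    by (intro mult_left_mono) (auto simp: N_def e_def)
  finally have *: "4 * e\<^sup>2 \<le> N * (N * (N - 1) + 2 * e)" by (simp add: power2_eq_square)
  have N0: "N \<ge> 0" "e \<ge> 0" by (auto simp: N_def e_def)
  show ?thesis unfolding N_def[symmetric] e_def[symmetric]
  proof (cases "e \<le> N")
    case True
    have "N = 0 \<or> N \<ge> 1" unfolding N_def by (cases "card V") auto
    thus "e\<^sup>2 \<le> N ^ 3"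
    proof
      assume "N \<ge> 1"
      have "e\<^sup>2 \<le> N\<^sup>2" using True N0 by (intro power_mono) auto
      also have "\<dots> \<le> N ^ 3" using \<open>N \<ge> 1\<close> by (intro power_increasing) auto
      finally show ?thesis .
    qed (use True N0 in auto)
  next
    case False
    hence "N * e \<le> e * e" using N0 by (intro mult_right_mono) auto
    hence "2 * e\<^sup>2 \<le> N * (N * (N - 1))" using * by (simp add: power2_eq_square algebra_simps)
    also have "\<dots> \<le> N * (N * N)" using N0 by (intro mult_left_mono) auto
    also have "\<dots> = N ^ 3" by (simp add: power3_eq_cube)
    finally show "e\<^sup>2 \<le> N ^ 3" using N0 by (smt (verit) zero_le_power2)
  qed
qed

section \<open>Matchings\<close>

definition matchings :: "nat \<Rightarrow> 'a set set \<Rightarrow> 'a set set set" where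
  "matchings t E = {F. F \<subseteq> E \<and> card F = t \<and> pairwise disjnt F}"

abbreviation nmat :: "nat \<Rightarrow> 'a set set \<Rightarrow> nat" where
  "nmat t E \<equiv> card (matchings t E)"

lemma finite_matchings: "finite E \<Longrightarrow> finite (matchings t E)"
  unfolding matchings_def by simp

lemma matchings_0: "finite E \<Longrightarrow> matchings 0 E = {{}}"
  unfolding matchings_def by (auto dest: finite_subset)

lemma nmat_1: "nmat (Suc 0) E = card E"
proof -
  have "matchings (Suc 0) E = (\<lambda>e. {e}) ` E"
    unfolding matchings_def by (auto simp: card_1_singleton_iff)
  thus ?thesis by (simp add: card_image)
qed

lemma nmat_mono: "finite E' \<Longrightarrow> E \<subseteq> E' \<Longrightarrow> nmat t E \<le> nmat t E'"
  by (intro card_mono finite_matchings) (auto simp: matchings_def)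

lemma nmat_le_choose:
  assumes "finite E"
  shows "nmat t E \<le> card E choose t"
proof -
  have "nmat t E \<le> card {F. F \<subseteq> E \<and> card F = t}"
    using assms by (intro card_mono) (auto simp: matchings_def)
  thus ?thesis by (simp add: n_subsets assms)
qed

lemma matchings_remove: 
  assumes "F \<in> matchings (Suc t) E" "e \<in> F"
  shows "F - {e} \<in> matchings t E"
  using assms by (auto simp: matchings_def intro: pairwise_subset)

text \<open>A matching that meets \<open>B\<close> is recovered from one of its edges in
  \<open>B\<close> and the matching formed by the others.\<close>

lemma nmat_delete:
  assumes "finite E" "B \<subseteq> E"
  shows "nmat (Suc t) E \<le> nmat (Suc t) (E - B) + card B * nmat t E"
proof -
  have finB: "finite B" using assms finite_subset by blast
  have "matchings (Suc t) E \<subseteq> matchings (Suc t) (E - B) \<union> (\<lambda>(b, F). insert b F) ` (B \<times> matchings t E)"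
  proof
    fix F assume F: "F \<in> matchings (Suc t) E"
    show "F \<in> matchings (Suc t) (E - B) \<union> (\<lambda>(b, F). insert b F) ` (B \<times> matchings t E)"
    proof (cases "F \<inter> B = {}")
      case True
      thus ?thesis using F by (auto simp: matchings_def)
    next
      case False
      then obtain b where b: "b \<in> F" "b \<in> B" by auto
      have "(b, F - {b}) \<in> B \<times> matchings t E" using b matchings_remove[OF F] by auto
      moreover have "F = insert b (F - {b})" using b by auto
      ultimately show ?thesis by (metis (mono_tags, lifting) UnI2 case_prod_conv image_eqI)
    qed
  qed
  hence "nmat (Suc t) E \<le> card (matchings (Suc t) (E - B) \<union> (\<lambda>(b, F). insert b F) ` (B \<times> matchings t E))"
    using assms finB by (intro card_mono finite_UnI finite_imageI finite_cartesian_product finite_matchings) auto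
  also have "\<dots> \<le> nmat (Suc t) (E - B) + card ((\<lambda>(b, F). insert b F) ` (B \<times> matchings t E))"
    by (rule card_Un_le)
  also have "card ((\<lambda>(b, F). insert b F) ` (B \<times> matchings t E)) \<le> card (B \<times> matchings t E)"
    using assms finB by (intro card_image_le finite_cartesian_product finite_matchings) auto
  finally show ?thesis by (simp add: card_cartesian_product)
qed

lemma nmat_Suc_le:
  fixes E :: "'a set set"
  assumes "finite E"
  shows "nmat (Suc t) E \<le> card E * nmat t E"
proof -
  have "matchings (Suc t) ({} :: 'a set set) = {}" by (auto simp: matchings_def)
  thus ?thesis using nmat_delete[OF assms order.refl, of t] by simp
qed

lemma nmat_le_power:
  assumes "finite E"
  shows "nmat t E \<le> card E ^ t"
proof (induction t)
  case 0
  then show ?case using assms by (simp add: matchings_0)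
next
  case (Suc t)
  have "nmat (Suc t) E \<le> card E * nmat t E" by (rule nmat_Suc_le[OF assms])
  also have "\<dots> \<le> card E * card E ^ t" using Suc by simp
  finally show ?case by simp
qed

text \<open>Three disjoint kinds of matchings are counted: inside \<open>A\<close>, inside
  \<open>H\<close>, and one edge of \<open>H\<close> together with \<open>t\<close> edges of
  \<open>A\<close>. For \<open>t \<ge> 1\<close> the third kind really uses \<open>A\<close> and so
  differs from the second.\<close>

lemma nmat_union:
  assumes "finite A" "finite H" "A \<inter> H = {}" "t \<ge> 1"
  shows "nmat (Suc t) A + nmat (Suc t) H + (\<Sum>h\<in>H. nmat t {f \<in> A. f \<inter> h = {}}) \<le> nmat (Suc t) (A \<union> H)"
proof -
  define M where "M h = matchings t {f \<in> A. f \<inter> h = {}}" for h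
  define C where "C = (\<lambda>(h, F). insert h F) ` (SIGMA h:H. M h)"
  have fM: "finite (M h)" for h unfolding M_def using assms by (intro finite_matchings) auto
  have fC: "finite C" unfolding C_def using fM assms by (intro finite_imageI finite_SigmaI) auto
  have Msub: "F \<subseteq> A" "card F = t" "finite F" if "F \<in> M h" for F h
    using that assms by (auto simp: M_def matchings_def intro: finite_subset[OF _ assms(1)])
  have "inj_on (\<lambda>(h, F). insert h F) (SIGMA h:H. M h)"
  proof (rule inj_onI, clarify)
    fix h F h' F' assume a: "h \<in> H" "F \<in> M h" "h' \<in> H" "F' \<in> M h'" "insert h F = insert h' F'"
    have *: "insert h F \<inter> H = {h}" "insert h F \<inter> A = F" if "h \<in> H" "F \<in> M h" for h F
      using that(1) Msub(1)[OF that(2)] assms(3) by auto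
    have "insert h F \<inter> H = {h}" "insert h' F' \<inter> H = {h'}" "insert h F \<inter> A = F" "insert h' F' \<inter> A = F'"
      using *[OF a(1,2)] *[OF a(3,4)] by auto
    thus "h = h' \<and> F = F'" using a(5) by auto
  qed
  hence cC: "card C = (\<Sum>h\<in>H. card (M h))"
    unfolding C_def using fM assms by (simp add: card_image)
  have Csub: "C \<subseteq> matchings (Suc t) (A \<union> H)"
  proof
    fix G assume "G \<in> C"
    then obtain h F where G: "G = insert h F" "h \<in> H" "F \<in> M h" unfolding C_def by auto
    have hF: "h \<notin> F" using G Msub assms(3) by blast
    have "pairwise disjnt (insert h F)"
      using G(3) unfolding M_def matchings_def by (auto simp: pairwise_insert disjnt_def)
    thus "G \<in> matchings (Suc t) (A \<union> H)"
      using G Msub[OF G(3)] hF unfolding matchings_def by auto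
  qed
  have ne: "A \<inter> F \<noteq> {} \<and> H \<inter> F \<noteq> {}" if FC: "F \<in> C" for F
  proof -
    obtain h G where G: "F = insert h G" "h \<in> H" "G \<in> M h" using FC unfolding C_def by auto
    have "G \<noteq> {}" "G \<subseteq> A" using Msub[OF G(3)] assms(4) by auto
    thus ?thesis using G by auto
  qed
  have d: "matchings (Suc t) A \<inter> matchings (Suc t) H = {}"
          "(matchings (Suc t) A \<union> matchings (Suc t) H) \<inter> C = {}"
  proof -
    have s: "F \<noteq> {}" "F \<subseteq> X" if "F \<in> matchings (Suc t) X" for F X :: "'a set set"
      using that by (auto simp: matchings_def)
    show "matchings (Suc t) A \<inter> matchings (Suc t) H = {}" using s assms(3) by blast
    show "(matchings (Suc t) A \<union> matchings (Suc t) H) \<inter> C = {}" using s(2) ne assms(3) by blast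
  qed
  have "nmat (Suc t) A + nmat (Suc t) H + card C = card (matchings (Suc t) A \<union> matchings (Suc t) H \<union> C)"
    using d fC assms by (simp add: card_Un_disjoint finite_matchings)
  also have "\<dots> \<le> nmat (Suc t) (A \<union> H)"
    using assms Csub by (intro card_mono finite_matchings) (auto simp: matchings_def)
  finally show ?thesis unfolding cC M_def by simp
qed

text \<open>Double counting of pairs of a \<open>Suc t\<close>-matching and one of its edges. A
  \<open>t\<close>-matching covers at most \<open>2 t\<close> vertices, which lie on at most
  \<open>2 t * card V\<close> edges; every other edge extends it.\<close>

lemma nmat_Suc_ge:
  assumes "sgraph V E"
  shows "real (nmat t E) * (real (card E) - 2 * t * card V) \<le> real (Suc t) * real (nmat (Suc t) E)"
proof -
  have fin: "finite V" "finite E" using assms sgraph_finite by auto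
  define D where "D F = {e \<in> E. e \<inter> \<Union>F = {}}" for F
  have cardD: "real (card E) - 2 * t * card V \<le> real (card (D F))" if "F \<in> matchings t E" for F
  proof -
    have F: "F \<subseteq> E" "card F = t" using that by (auto simp: matchings_def)
    have finF: "finite F" using F fin finite_subset by blast
    have finU: "finite (\<Union>F)" using F assms finF fin unfolding sgraph_def by (meson Sup_least finite_subset subsetD)
    have "card (\<Union>F) \<le> (\<Sum>e\<in>F. card e)" by (rule card_Union_le_sum_card)
    also have "\<dots> = (\<Sum>e\<in>F. 2)" using F assms unfolding sgraph_def by (intro sum.cong) auto
    finally have cU: "card (\<Union>F) \<le> 2 * t" using F by simp
    have "card E = card (D F) + card {e \<in> E. e \<inter> \<Union>F \<noteq> {}}"
      unfolding D_def using fin by (subst card_Un_disjoint[symmetric]) (auto intro!: arg_cong[of _ _ card])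
    also have "card {e \<in> E. e \<inter> \<Union>F \<noteq> {}} \<le> (\<Sum>x\<in>\<Union>F. deg E x)"
      by (rule card_edges_meeting_le[OF assms finU])
    also have "\<dots> \<le> card (\<Union>F) * card V"
      using sum_bounded_above[of "\<Union>F" "deg E" "card V"] deg_le_card[OF assms] by simp
    also have "\<dots> \<le> 2 * t * card V" using cU by simp
    finally have "card E \<le> card (D F) + 2 * t * card V" by simp
    hence "real (card E) \<le> real (card (D F) + 2 * t * card V)" by (rule of_nat_mono)
    thus ?thesis by simp
  qed
  have sub: "(\<lambda>(F, e). (insert e F, e)) ` (SIGMA F:matchings t E. D F) \<subseteq> (SIGMA G:matchings (Suc t) E. G)"
  proof (rule subsetI)
    fix x assume "x \<in> (\<lambda>(F, e). (insert e F, e)) ` (SIGMA F:matchings t E. D F)"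
    then obtain F e where x: "x = (insert e F, e)" and a: "F \<in> matchings t E" "e \<in> D F" by auto
    have e: "e \<noteq> {}" "e \<in> E" "e \<inter> \<Union>F = {}" using a assms by (auto simp: D_def sgraph_def)
    hence "e \<notin> F" by auto
    moreover have "finite F" using a fin by (auto simp: matchings_def intro: finite_subset)
    moreover have "pairwise disjnt (insert e F)"
      using a e unfolding matchings_def by (auto simp: pairwise_insert disjnt_def)
    ultimately show "x \<in> (SIGMA G:matchings (Suc t) E. G)"
      using a e x unfolding matchings_def by auto
  qed
  have inj: "inj_on (\<lambda>(F, e). (insert e F, e)) (SIGMA F:matchings t E. D F)"
  proof (rule inj_onI)
    fix x y assume "x \<in> (SIGMA F:matchings t E. D F)" "y \<in> (SIGMA F:matchings t E. D F)"
      and "(case x of (F, e) \<Rightarrow> (insert e F, e)) = (case y of (F, e) \<Rightarrow> (insert e F, e))"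
    then obtain F e F' where xy: "x = (F, e)" "y = (F', e)" and a: "F \<in> matchings t E" "e \<in> D F" "F' \<in> matchings t E" "e \<in> D F'" "insert e F = insert e F'"
      by (cases x; cases y) auto
    have "e \<noteq> {}" "e \<inter> \<Union>F = {}" "e \<inter> \<Union>F' = {}" using a assms by (auto simp: D_def sgraph_def)
    hence "e \<notin> F" "e \<notin> F'" by auto
    thus "x = y" using a(5) xy by auto
  qed
  have "finite (SIGMA G:matchings (Suc t) E. G)"
    using fin by (intro finite_SigmaI finite_matchings) (auto simp: matchings_def intro: finite_subset)
  hence "card (SIGMA F:matchings t E. D F) \<le> card (SIGMA G:matchings (Suc t) E. G)"
    by (rule card_inj_on_le[OF inj sub])
  also have "card (SIGMA G:matchings (Suc t) E. G) = (\<Sum>G\<in>matchings (Suc t) E. card G)"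
    using fin by (intro card_SigmaI finite_matchings) (auto simp: matchings_def intro: finite_subset)
  also have "\<dots> = Suc t * nmat (Suc t) E" by (simp add: matchings_def)
  also have "card (SIGMA F:matchings t E. D F) = (\<Sum>F\<in>matchings t E. card (D F))"
    using fin by (intro card_SigmaI finite_matchings) (auto simp: D_def)
  finally have "real (\<Sum>F\<in>matchings t E. card (D F)) \<le> real (Suc t * nmat (Suc t) E)" by (rule of_nat_mono)
  moreover have "real (nmat t E) * (real (card E) - 2 * t * card V) \<le> (\<Sum>F\<in>matchings t E. real (card (D F)))"
    using sum_bounded_below[of "matchings t E" "real (card E) - 2 * t * card V" "\<lambda>F. real (card (D F))"] cardD by simp
  ultimately show ?thesis by (simp add: distrib_right)
qed

text \<open>Together with \<open>nmat_le_choose\<close> this says that a graph with far more edges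
  than vertices has about \<open>card E ^ t / t!\<close> matchings of size \<open>t\<close>: the
  disjointness condition is then of lower order.\<close>

lemma nmat_ge_power:
  assumes "sgraph V E" "2 * real t * card V \<le> card E"
  shows "(real (card E) - 2 * t * card V) ^ t \<le> fact t * real (nmat t E)"
proof -
  define x where "x = real (card E) - 2 * t * card V"
  have "s \<le> t \<Longrightarrow> x ^ s \<le> fact s * real (nmat s E)" for s
  proof (induction s)
    case 0
    then show ?case using sgraph_finite(2)[OF assms(1)] by (simp add: matchings_0)
  next
    case (Suc s)
    have x0: "x \<ge> 0" using assms by (simp add: x_def)
    have "real (2 * s * card V) \<le> real (2 * t * card V)" using Suc.prems by (intro of_nat_mono mult_right_mono) auto
    hence xs: "x \<le> real (card E) - 2 * s * card V" unfolding x_def by simp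
    have "x ^ Suc s \<le> (fact s * real (nmat s E)) * x" using Suc x0 by (simp add: mult.commute mult_left_mono)
    also have "\<dots> \<le> fact s * (real (nmat s E) * (real (card E) - 2 * s * card V))"
      using xs by (simp add: mult_left_mono mult.assoc)
    also have "\<dots> \<le> fact s * (real (Suc s) * real (nmat (Suc s) E))"
      by (intro mult_left_mono nmat_Suc_ge[OF assms(1)]) auto
    finally show ?case by (simp add: algebra_simps)
  qed
  thus ?thesis unfolding x_def by blast
qed

section \<open>Dense graphs without four-cycles\<close>

text \<open>The points satisfying the adjacency equation with a given point form a line, and two
  such lines share at most one point. Every vertex has one solution for each first coordinate below
  \<open>m\<close>, possibly itself, so its degree is at least \<open>m - 1\<close>. The parameter
  \<open>m\<close> is free because for \<open>p\<close> above the square root of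
  \<open>card V\<close> only part of the plane fits.\<close>

lemma c4_free_construction:
  fixes V :: "'a set"
  assumes p: "prime p" and V: "finite V" "m * p \<le> card V" and mp: "m \<le> p"
  obtains H where "sgraph V H" "c4_free H" "m * m * p \<le> 2 * card H + m * p"
proof -
  obtain V' where V': "V' \<subseteq> V" "card V' = m * p"
    using obtain_subset_with_card_n[OF V(2)] by metis
  have finV': "finite V'" using V V' finite_subset by blast
  have p0: "p > 0" using p prime_gt_0_nat by blast
  have "card V' = card ({..<m} \<times> {..<p})" using V' by simp
  then obtain g where g: "bij_betw g V' ({..<m} \<times> {..<p})"
    using finV' by (metis finite_SigmaI finite_lessThan finite_same_card_bij)
  \<comment> \<open>the affine part of the polarity graph over the field with \<open>p\<close> elements, restricted to first coordinates
      below \<open>m\<close>: \<open>(a, b)\<close> and \<open>(c, d)\<close> are adjacent iff \<open>b + d = a c\<close>\<close>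
  define R where "R x y \<longleftrightarrow> int p dvd int (snd x) + int (snd y) - int (fst x) * int (fst y)" for x y :: "nat \<times> nat"
  define H where "H = {{u, v} |u v. u \<in> V' \<and> v \<in> V' \<and> u \<noteq> v \<and> R (g u) (g v)}"
  have Rsym: "R x y = R y x" for x y unfolding R_def by (simp add: algebra_simps)
  have gm: "fst (g v) < m" "snd (g v) < p" if "v \<in> V'" for v
    using bij_betwE[OF g] that by (auto simp: mem_Times_iff)
  have ginj: "g u = g v \<Longrightarrow> u = v" if "u \<in> V'" "v \<in> V'" for u v
    using g that by (auto simp: bij_betw_def inj_on_def)
  have sg: "sgraph V H" unfolding sgraph_def H_def using V V' by auto
  have nbr: "v \<in> nbr H u \<longleftrightarrow> u \<in> V' \<and> v \<in> V' \<and> u \<noteq> v \<and> R (g u) (g v)" for u v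
    unfolding nbr_def H_def using Rsym[of "g u" "g v"] by (auto simp: doubleton_eq_iff)
  have eqI: "a = b" if "int p dvd int a - int b" "a < p" "b < p" for a b
  proof -
    have "int a mod int p = int b mod int p" unfolding mod_eq_dvd_iff by (rule that(1))
    hence "a mod p = b mod p" by (metis of_nat_eq_iff zmod_int)
    thus ?thesis using that(2,3) by simp
  qed
  have "c4_free H"
    unfolding c4_free_def
  proof (intro allI impI)
    fix u v x y assume uv: "u \<noteq> v" and "x \<in> nbr H u \<inter> nbr H v" "y \<in> nbr H u \<inter> nbr H v"
    hence mem: "u \<in> V'" "v \<in> V'" "x \<in> V'" "y \<in> V'"
      and R: "R (g u) (g x)" "R (g v) (g x)" "R (g u) (g y)" "R (g v) (g y)"
      by (auto simp: nbr)
    obtain a b c d x1 x2 y1 y2 where gs: "g u = (a, b)" "g v = (c, d)" "g x = (x1, x2)" "g y = (y1, y2)"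
      by (metis surj_pair)
    have lt: "a < p" "c < p" "x1 < p" "y1 < p" "b < p" "d < p" "x2 < p" "y2 < p"
      using gm[OF mem(1)] gm[OF mem(2)] gm[OF mem(3)] gm[OF mem(4)] gs mp by auto
    define h where "h e f k l = int e + int f - int k * int l" for e f k l :: nat
    have D: "int p dvd h b x2 a x1" "int p dvd h d x2 c x1" "int p dvd h b y2 a y1" "int p dvd h d y2 c y1"
      using R unfolding R_def gs h_def by auto
    \<comment> \<open>This combination eliminates all second coordinates.\<close>
    have "int p dvd (h d x2 c x1 - h b x2 a x1) - (h d y2 c y1 - h b y2 a y1)"
      using D by (intro dvd_diff) auto
    also have "(h d x2 c x1 - h b x2 a x1) - (h d y2 c y1 - h b y2 a y1) = (int a - int c) * (int x1 - int y1)"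
      unfolding h_def by (simp add: algebra_simps)
    finally have "int p dvd int a - int c \<or> int p dvd int x1 - int y1"
      using p by (simp add: prime_dvd_mult_iff)
    moreover have "\<not> int p dvd int a - int c"
    proof
      assume "int p dvd int a - int c"
      hence ac: "a = c" using eqI lt by blast
      have "int p dvd h b x2 a x1 - h d x2 c x1" using D by (intro dvd_diff) auto
      hence "int p dvd int b - int d" unfolding h_def ac by simp
      hence "b = d" using eqI lt by blast
      thus False using ginj[OF mem(1,2)] gs uv ac by simp
    qed
    ultimately have xy: "x1 = y1" using eqI lt by blast
    have "int p dvd h b x2 a x1 - h b y2 a y1" using D by (intro dvd_diff) auto
    hence "int p dvd int x2 - int y2" unfolding h_def xy by simp
    hence "x2 = y2" using eqI lt by blast
    thus "x = y" using ginj[OF mem(3,4)] gs xy by simp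
  qed
  have degH: "m \<le> deg H u + 1" if u: "u \<in> V'" for u
  proof -
    obtain a b where ab: "g u = (a, b)" by (metis surj_pair)
    \<comment> \<open>For each first coordinate \<open>c\<close> the adjacency equation is solved
      for the second one. The solution may be \<open>u\<close> itself, an absolute point of the
      polarity, which explains the \<open>+ 1\<close> in the degree bound.\<close>
    define w where "w c = inv_into V' g (c, nat ((int a * int c - int b) mod int p))" for c
    have gw: "w c \<in> V'" "g (w c) = (c, nat ((int a * int c - int b) mod int p))" if "c < m" for c
    proof -
      have "(c, nat ((int a * int c - int b) mod int p)) \<in> {..<m} \<times> {..<p}"
        using that p0 by (simp add: nat_less_iff)
      hence "(c, nat ((int a * int c - int b) mod int p)) \<in> g ` V'"
        using g by (simp add: bij_betw_def)
      thus "w c \<in> V'" "g (w c) = (c, nat ((int a * int c - int b) mod int p))"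
        unfolding w_def by (auto intro: inv_into_into f_inv_into_f)
    qed
    have Rw: "R (g u) (g (w c))" if "c < m" for c
    proof -
      have "int p dvd (int a * int c - int b) mod int p - (int a * int c - int b)"
        by (metis dvd_minus_mod dvd_minus_iff minus_diff_eq)
      thus ?thesis using p0 unfolding R_def gw(2)[OF that] ab by (simp add: algebra_simps)
    qed
    have "w ` {..<m} \<subseteq> insert u (nbr H u)" using u gw Rw by (auto simp: nbr)
    moreover have "inj_on w {..<m}" by (rule inj_onI) (metis gw(2) fst_conv lessThan_iff)
    ultimately have "m \<le> card (insert u (nbr H u))"
      using finite_nbr[OF sg] by (metis card_image card_lessThan card_mono finite_insert)
    also have "\<dots> \<le> deg H u + 1" using card_insert_le_m1[of "deg H u + 1" "nbr H u" u] by simp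
    finally show ?thesis .
  qed
  have "m * p * m = (\<Sum>u\<in>V'. m)" using V' by simp
  also have "\<dots> \<le> (\<Sum>u\<in>V'. deg H u + 1)" by (intro sum_mono degH)
  also have "\<dots> = (\<Sum>u\<in>V'. deg H u) + m * p" by (simp only: sum.distrib) (simp add: V')
  also have "(\<Sum>u\<in>V'. deg H u) \<le> (\<Sum>u\<in>V. deg H u)" using V V' by (intro sum_mono2) auto
  finally have "m * p * m \<le> 2 * card H + m * p" using handshake[OF sg] by simp
  thus ?thesis using that sg \<open>c4_free H\<close> by (simp add: mult_ac)
qed

lemma dense_c4_free_exists:
  "\<exists>w0. \<forall>V :: 'a set. finite V \<longrightarrow> w0 \<le> card V \<longrightarrow>
     (\<exists>H. sgraph V H \<and> c4_free H \<and> 43 / 100 * sqrt (card V) ^ 3 \<le> card H)"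
proof -
  obtain x0 where x0: "\<And>x. x \<ge> x0 \<Longrightarrow> \<exists>p. prime p \<and> x \<le> real p \<and> real p \<le> 121 / 100 * x"
    using prime_between_eventually by blast
  \<comment> \<open>The prime is sought between 0.955 z and 1.21 * 0.955 z = 1.15555 z. At the lower
    end the edge density is 0.955^3 / 2 > 0.435, at the upper end, after cutting, 1 / (2 * 1.15555)
    > 0.432. Both leave room above 0.43 for the terms of order z^2.\<close>
  have "eventually (\<lambda>w. 955 / 1000 * sqrt (real w) \<ge> x0 \<and> sqrt (real w) \<ge> 1000) sequentially"
    by (intro eventually_conj; real_asymp)
  then obtain w0 where w0: "\<And>w. w \<ge> w0 \<Longrightarrow> 955 / 1000 * sqrt (real w) \<ge> x0 \<and> sqrt (real w) \<ge> 1000"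
    unfolding eventually_sequentially by blast
  have "\<exists>H. sgraph V H \<and> c4_free H \<and> 43 / 100 * sqrt (card V) ^ 3 \<le> card H"
    if V: "finite V" "w0 \<le> card V" for V :: "'a set"
  proof -
    define w z where "w = card V" and "z = sqrt (real w)"
    have z: "955 / 1000 * z \<ge> x0" "z \<ge> 1000" using w0 V unfolding z_def w_def by auto
    have zz: "z * z = real w" unfolding z_def by simp
    obtain p where p: "prime p" "955 / 1000 * z \<le> real p" "real p \<le> 121 / 100 * (955 / 1000 * z)"
      using x0[OF z(1)] by blast
    have p0: "p > 0" using p(1) prime_gt_0_nat by blast
    have z3: "z ^ 3 = z * z * z" by (simp add: power3_eq_cube)
    have z2: "1000 * (z * z) \<le> z * z * z" using z by (simp add: mult_right_mono)
    show ?thesis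
    proof (cases "real p \<le> z")
      case True
      have "real p * real p \<le> z * z" using True by (intro mult_mono) auto
      hence "real (p * p) \<le> real w" using zz by simp
      hence "p * p \<le> card V" unfolding w_def using of_nat_le_iff by blast
      then obtain H where H: "sgraph V H" "c4_free H" "p * p * p \<le> 2 * card H + p * p"
        using c4_free_construction[OF p(1) V(1), of p] by blast
      have "real (p * p * p) \<le> real (2 * card H + p * p)" using H(3) by (rule of_nat_mono)
      hence h: "real p * real p * real p \<le> 2 * real (card H) + real p * real p" by simp
      have "(955 / 1000 * z) ^ 3 \<le> real p ^ 3" using p z by (intro power_mono) auto
      hence "(955 / 1000) ^ 3 * (z * z * z) \<le> real p * real p * real p" by (simp add: power3_eq_cube)
      moreover have "real p * real p \<le> z * z" by fact
      ultimately have "86 / 100 * (z * z * z) \<le> 2 * real (card H)" using h z2 by (simp add: power3_eq_cube)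
      hence "43 / 100 * z ^ 3 \<le> real (card H)" unfolding z3 by linarith
      thus ?thesis using H unfolding z_def w_def by blast
    next
      case False
      \<comment> \<open>\<open>p\<close> is too large for the full polarity graph; dropping first coordinates keeps the density \<open>1 / p\<close>\<close>
      define m where "m = w div p"
      have pm: "m * p \<le> card V" unfolding m_def w_def by (metis div_times_less_eq_dividend)
      have "w < p * p"
      proof -
        have "z * z < real p * real p" using False z by (intro mult_strict_mono) auto
        hence "real w < real (p * p)" using zz by simp
        thus ?thesis using of_nat_less_iff by blast
      qed
      hence mp: "m \<le> p" unfolding m_def by (simp add: less_mult_imp_div_less less_imp_le)
      obtain H where H: "sgraph V H" "c4_free H" "m * m * p \<le> 2 * card H + m * p"
        using c4_free_construction[OF p(1) V(1) pm mp] by blast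
      have "real (m * m * p) \<le> real (2 * card H + m * p)" using H(3) by (rule of_nat_mono)
      hence h: "real m * (real m * real p) \<le> 2 * real (card H) + real m * real p" by (simp add: mult_ac)
      have "w < p * (m + 1)" unfolding m_def using p0 by (simp add: dividend_less_times_div)
      hence "real w < real (p * (m + 1))" using of_nat_less_iff by blast
      hence 1: "z * z < real p * (real m + 1)" using zz by (simp add: distrib_left)
      define P M where "P = real p" and "M = real m"
      have M0: "M \<ge> 0" "P > 0" using p0 by (auto simp: M_def P_def)
      have P: "P \<le> 116 / 100 * z" using p(3) z unfolding P_def by linarith
      have 2: "z * z - 116 / 100 * z \<le> M * P" using 1 P unfolding M_def P_def by (simp add: algebra_simps)
      have 3: "865 / 1000 * z - 1 \<le> M"
      proof -
        have "z * z < 115555 / 100000 * z * (M + 1)"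
        proof -
          have "real p * (real m + 1) \<le> (115555 / 100000 * z) * (real m + 1)"
            using p(3) by (intro mult_right_mono) auto
          thus ?thesis using 1 unfolding M_def by linarith
        qed
        hence "z * z < z * (115555 / 100000 * (M + 1))" by (simp add: mult_ac)
        hence "z < 115555 / 100000 * (M + 1)" using z by (simp add: mult_less_cancel_left_pos)
        hence "z * (100000 / 115555) < M + 1" by (simp add: field_simps)
        moreover have "z * (865 / 1000) \<le> z * (100000 / 115555)" using z by (intro mult_left_mono) auto
        ultimately show ?thesis by linarith
      qed
      have "(865 / 1000 * z - 1) * (z * z - 116 / 100 * z) \<le> M * (M * P)"
        using 2 3 z M0 by (intro mult_mono) (auto simp: algebra_simps intro: mult_right_mono)
      moreover have "M * P \<le> z * z"
      proof -
        have "real (m * p) \<le> real (card V)" using pm by (rule of_nat_mono)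
        thus ?thesis unfolding M_def P_def zz w_def by simp
      qed
      ultimately have "(865 / 1000 * z - 1) * (z * z - 116 / 100 * z) - z * z \<le> 2 * real (card H)"
        using h unfolding M_def P_def by linarith
      moreover have "(865 / 1000 * z - 1) * (z * z - 116 / 100 * z) - z * z
          = 865 / 1000 * (z * z * z) - (2 + 10034 / 10000) * (z * z) + 116 / 100 * z"
        by (simp add: field_simps)
      ultimately have "865 / 1000 * (z * z * z) - (2 + 10034 / 10000) * (z * z) + 116 / 100 * z \<le> 2 * real (card H)"
        by (simp only:)
      moreover have "z * z \<ge> 0" by simp
      moreover have "86 / 100 * A \<le> c" if "865 / 1000 * A - (2 + 10034 / 10000) * B + 116 / 100 * z \<le> c"
          "0 \<le> B" "1000 * B \<le> A" for A B c :: real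
        using that z by (simp add: field_simps)
      ultimately have "86 / 100 * (z * z * z) \<le> 2 * real (card H)" using z2 by blast
      hence "43 / 100 * z ^ 3 \<le> real (card H)" unfolding z3 by linarith
      thus ?thesis using H unfolding z_def w_def by blast
    qed
  qed
  thus ?thesis by blast
qed

text \<open>The start \<open>k = 2\<close>, the pair \<open>(r, t) = (7, 4)\<close>, is tight: 4! =
  24 against 6! * 0.43^4 = 24.6. From there on the right side grows faster, its quotient of
  consecutive values being cubic in \<open>k\<close> and that of the left side quadratic.\<close>

lemma boundary_factorial_ineq:
  assumes "k \<ge> 2"
  shows "fact (2 * k) < fact (3 * k) * (43 / 100 :: real) ^ (2 * k)"
  using assms
proof (induction k rule: dec_induct)
  case base
  have "(6::nat) = Suc (Suc (Suc (Suc (Suc (Suc 0)))))" "(4::nat) = Suc (Suc (Suc (Suc 0)))" by simp_all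
  then show ?case by (simp add: numeral_eq_Suc field_simps)
next
  case (step k)
  define K where "K = real k"
  have K: "K \<ge> 2" using step by (simp add: K_def)
  have e: "2 * Suc k = Suc (Suc (2 * k))" "3 * Suc k = Suc (Suc (Suc (3 * k)))" by simp_all
  have f2: "fact (2 * Suc k) = (2 * K + 2) * (2 * K + 1) * (fact (2 * k) :: real)"
    unfolding e K_def by (simp add: algebra_simps)
  have f3: "fact (3 * Suc k) = (3 * K + 3) * (3 * K + 2) * (3 * K + 1) * (fact (3 * k) :: real)"
    unfolding e K_def by (simp add: algebra_simps)
  have pw: "(43 / 100 :: real) ^ (2 * Suc k) = (1849 / 10000) * (43 / 100) ^ (2 * k)"
    unfolding e by simp
  have "(2 * K + 2) * (2 * K + 1) \<le> (3 * K + 3) * (3 * K + 2) * (3 * K + 1) * (1849 / 10000)"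
  proof -
    have "(3 * K + 3) * (3 * K + 2) * 6 \<le> (3 * K + 3) * (3 * K + 2) * (3 * K + 1)"
      using K by (intro mult_left_mono) auto
    moreover have "(2 * K + 2) * (2 * K + 1) \<le> (3 * K + 3) * (3 * K + 2) * 6 * (1849 / 10000)"
    proof -
      have "(2 * K + 2) * (2 * K + 1) = 4 * (K * K) + 6 * K + 2"
        "(3 * K + 3) * (3 * K + 2) = 9 * (K * K) + 15 * K + 6" by (simp_all add: algebra_simps)
      moreover have "K * K \<ge> 0" by simp
      ultimately show ?thesis using K by linarith
    qed
    ultimately show ?thesis by linarith
  qed
  hence "fact (2 * Suc k) \<le> (3 * K + 3) * (3 * K + 2) * (3 * K + 1) * (1849 / 10000) * (fact (2 * k) :: real)"
    unfolding f2 by (intro mult_right_mono) auto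
  also have "\<dots> < (3 * K + 3) * (3 * K + 2) * (3 * K + 1) * (1849 / 10000) * (fact (3 * k) * (43 / 100) ^ (2 * k))"
    using K step.IH by (intro mult_strict_left_mono mult_pos_pos) auto
  also have "\<dots> = fact (3 * Suc k) * (43 / 100) ^ (2 * Suc k)" unfolding f3 pw by simp
  finally show ?case .
qed

lemma matching_constant_beats_star_constant:
  assumes "2 * (r - 1) = 3 * t" "t \<ge> 2" "(r, t) \<noteq> (4, 2)"
  shows "1 / fact (r - 1) < (43 / 100 :: real) ^ t / fact t"
proof -
  obtain k where k: "t = 2 * k" "r - 1 = 3 * k"
  proof -
    have "even t" using assms(1) by presburger
    then obtain k where "t = 2 * k" by blast
    thus ?thesis using that assms(1) by simp
  qed
  have "k \<noteq> 1" using k assms by auto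
  hence "k \<ge> 2" using k assms by linarith
  from boundary_factorial_ineq[OF this] show ?thesis unfolding k by (simp add: field_simps)
qed

text \<open>Here \<open>z\<close> stands for the square root of the number of vertices. The slack is
  what the comparison of colourings will consume: the factor \<open>1 + \<kappa>\<close> covers
  stars spread over several centres, one \<kappa> z^(3t) the stars at vertices of small blue degree,
  and the other a small number of red matchings.\<close>

lemma matching_count_dominates:
  assumes "2 * (r - 1) \<le> 3 * t" "t \<ge> 2" "(r, t) \<noteq> (4, 2)"
  obtains \<kappa> :: real where "\<kappa> > 0"
    "eventually (\<lambda>z::real. (1 + \<kappa>) * (z ^ (2 * (r - 1)) / fact (r - 1)) + 2 * \<kappa> * z ^ (3 * t)
        \<le> (43 / 100 * z ^ 3 - 2 * real t * z\<^sup>2) ^ t / fact t) at_top"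
proof -
  \<comment> \<open>The limits of the matching and star terms after division by z^(3t); the star
    term survives only on the boundary line.\<close>
  define c b :: real where "c = (43 / 100) ^ t / fact t"
    and "b = (if 2 * (r - 1) = 3 * t then 1 / fact (r - 1) else 0)"
  \<comment> \<open>With this choice \<open>(1 + \<kappa>) * b + 2 * \<kappa>\<close> is the
    midpoint of \<open>b\<close> and \<open>c\<close>.\<close>
  define \<kappa> where "\<kappa> = (c - b) / (2 * (b + 2))"
  have b0: "b \<ge> 0" by (simp add: b_def)
  have bc: "b < c" using matching_constant_beats_star_constant[of r t] assms
    by (auto simp: b_def c_def)
  have k0: "\<kappa> > 0" unfolding \<kappa>_def using b0 bc by (intro divide_pos_pos) auto
  have "\<kappa> * (b + 2) = (c - b) / 2" unfolding \<kappa>_def using b0 by (simp add: divide_simps)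
  hence "\<kappa> * (b + 2) < c - b" using bc by simp
  hence lt: "(1 + \<kappa>) * b + 2 * \<kappa> < c" by (simp add: algebra_simps)
  have star: "((\<lambda>z. z ^ (2 * (r - 1)) / z ^ (3 * t) / fact (r - 1)) \<longlongrightarrow> b) at_top"
  proof (cases "2 * (r - 1) = 3 * t")
    case True
    have "eventually (\<lambda>z::real. z ^ (2 * (r - 1)) / z ^ (3 * t) / fact (r - 1) = b) at_top"
      using eventually_gt_at_top[of 0] by eventually_elim (use True in \<open>simp add: b_def\<close>)
    thus ?thesis by (rule tendsto_eventually)
  next
    case False
    define j where "j = 3 * t - 2 * (r - 1)"
    have j: "3 * t = 2 * (r - 1) + j" "j > 0" using False assms by (auto simp: j_def)
    have "((\<lambda>z::real. (1 / z) ^ j / fact (r - 1)) \<longlongrightarrow> 0 ^ j / fact (r - 1)) at_top"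
      by (intro tendsto_intros) (real_asymp | simp)+
    moreover have "eventually (\<lambda>z::real. (1 / z) ^ j / fact (r - 1) = z ^ (2 * (r - 1)) / z ^ (3 * t) / fact (r - 1)) at_top"
      using eventually_gt_at_top[of 0] by eventually_elim (simp only: j power_add, simp add: field_simps)
    ultimately show ?thesis using False j by (simp add: b_def tendsto_cong zero_power)
  qed
  have L: "((\<lambda>z. (1 + \<kappa>) * (z ^ (2 * (r - 1)) / z ^ (3 * t) / fact (r - 1)) + 2 * \<kappa>) \<longlongrightarrow> (1 + \<kappa>) * b + 2 * \<kappa>) at_top"
    by (intro tendsto_intros star)
  have R: "((\<lambda>z::real. (43 / 100 - 2 * real t * (1 / z)) ^ t / fact t) \<longlongrightarrow> (43 / 100 - 2 * real t * 0) ^ t / fact t) at_top"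
    by (intro tendsto_intros) (real_asymp | simp)+
  have "eventually (\<lambda>z. (1 + \<kappa>) * (z ^ (2 * (r - 1)) / z ^ (3 * t) / fact (r - 1)) + 2 * \<kappa>
      < (43 / 100 - 2 * real t * (1 / z)) ^ t / fact t) at_top"
  proof -
    obtain m where m: "(1 + \<kappa>) * b + 2 * \<kappa> < m" "m < c" using dense[OF lt] by blast
    have "m < (43 / 100 - 2 * real t * 0) ^ t / fact t" using m(2) by (simp add: c_def)
    from order_tendstoD(1)[OF R this] order_tendstoD(2)[OF L m(1)]
    show ?thesis by eventually_elim linarith
  qed
  hence "eventually (\<lambda>z. (1 + \<kappa>) * (z ^ (2 * (r - 1)) / fact (r - 1)) + 2 * \<kappa> * z ^ (3 * t)
        \<le> (43 / 100 * z ^ 3 - 2 * real t * z\<^sup>2) ^ t / fact t) at_top"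
    using eventually_gt_at_top[of 0]
  proof eventually_elim
    case (elim z)
    have "(1 + \<kappa>) * (z ^ (2 * (r - 1)) / fact (r - 1)) + 2 * \<kappa> * z ^ (3 * t)
       = z ^ (3 * t) * ((1 + \<kappa>) * (z ^ (2 * (r - 1)) / z ^ (3 * t) / fact (r - 1)) + 2 * \<kappa>)"
      using elim by (simp add: field_simps)
    also have "\<dots> \<le> z ^ (3 * t) * ((43 / 100 - 2 * real t * (1 / z)) ^ t / fact t)"
      using elim by (intro mult_left_mono) auto
    also have "\<dots> = (z ^ 3 * (43 / 100 - 2 * real t * (1 / z))) ^ t / fact t"
      by (simp add: power_mult power_mult_distrib)
    also have "z ^ 3 * (43 / 100 - 2 * real t * (1 / z)) = 43 / 100 * z ^ 3 - 2 * real t * z\<^sup>2"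
      using elim by (simp add: field_simps power2_eq_square power3_eq_cube)
    finally show ?case .
  qed
  with k0 show ?thesis using that by blast
qed

text \<open>The edge count is exported along with the matchings, because a graph \<open>H\<close>
  inserted into another one also contributes mixed matchings, in proportion to its number of
  edges.\<close>

lemma many_matchings_exist:
  assumes "2 * (r - 1) \<le> 3 * t" "t \<ge> 2" "(r, t) \<noteq> (4, 2)"
  obtains \<kappa> :: real and w0 :: nat where "\<kappa> > 0"
    "\<And>V :: 'a set. finite V \<Longrightarrow> w0 \<le> card V \<Longrightarrow> \<exists>H. sgraph V H \<and> c4_free H
       \<and> 43 / 100 * sqrt (card V) ^ 3 \<le> card H
       \<and> (1 + \<kappa>) * (real (card V) ^ (r - 1) / fact (r - 1)) + 2 * \<kappa> * sqrt (card V) ^ (3 * t) \<le> nmat t H"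
proof -
  obtain \<kappa> :: real where k: "\<kappa> > 0" and ev:
    "eventually (\<lambda>z::real. (1 + \<kappa>) * (z ^ (2 * (r - 1)) / fact (r - 1)) + 2 * \<kappa> * z ^ (3 * t)
        \<le> (43 / 100 * z ^ 3 - 2 * real t * z\<^sup>2) ^ t / fact t) at_top"
    using matching_count_dominates[OF assms] .
  obtain w1 where w1: "\<And>V :: 'a set. finite V \<Longrightarrow> w1 \<le> card V \<Longrightarrow>
     \<exists>H. sgraph V H \<and> c4_free H \<and> 43 / 100 * sqrt (card V) ^ 3 \<le> card H"
    using dense_c4_free_exists by blast
  have "filterlim (\<lambda>n. sqrt (real n)) at_top sequentially" by real_asymp
  from eventually_compose_filterlim[OF ev this]
  have "eventually (\<lambda>n. (1 + \<kappa>) * (sqrt (real n) ^ (2 * (r - 1)) / fact (r - 1)) + 2 * \<kappa> * sqrt (real n) ^ (3 * t)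
        \<le> (43 / 100 * sqrt (real n) ^ 3 - 2 * real t * (sqrt (real n))\<^sup>2) ^ t / fact t) sequentially" .
  moreover have "eventually (\<lambda>n. 2 * real t * real n \<le> 43 / 100 * sqrt (real n) ^ 3) sequentially"
    by real_asymp
  ultimately have "eventually (\<lambda>n. (1 + \<kappa>) * (sqrt (real n) ^ (2 * (r - 1)) / fact (r - 1)) + 2 * \<kappa> * sqrt (real n) ^ (3 * t)
        \<le> (43 / 100 * sqrt (real n) ^ 3 - 2 * real t * (sqrt (real n))\<^sup>2) ^ t / fact t
        \<and> 2 * real t * real n \<le> 43 / 100 * sqrt (real n) ^ 3) sequentially"
    by (rule eventually_conj)
  then obtain w2 where w2: "\<And>n. n \<ge> w2 \<Longrightarrow> (1 + \<kappa>) * (sqrt (real n) ^ (2 * (r - 1)) / fact (r - 1)) + 2 * \<kappa> * sqrt (real n) ^ (3 * t)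
        \<le> (43 / 100 * sqrt (real n) ^ 3 - 2 * real t * (sqrt (real n))\<^sup>2) ^ t / fact t
        \<and> 2 * real t * real n \<le> 43 / 100 * sqrt (real n) ^ 3"
    unfolding eventually_sequentially by blast
  show ?thesis
  proof (rule that[OF k, of "max w1 w2"])
    fix V :: "'a set" assume V: "finite V" "max w1 w2 \<le> card V"
    define n where "n = card V"
    obtain H where H: "sgraph V H" "c4_free H" "43 / 100 * sqrt n ^ 3 \<le> card H"
      using w1[OF V(1)] V(2) unfolding n_def by auto
    have n: "(1 + \<kappa>) * (sqrt (real n) ^ (2 * (r - 1)) / fact (r - 1)) + 2 * \<kappa> * sqrt (real n) ^ (3 * t)
        \<le> (43 / 100 * sqrt (real n) ^ 3 - 2 * real t * (sqrt (real n))\<^sup>2) ^ t / fact t"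
        "2 * real t * real n \<le> 43 / 100 * sqrt (real n) ^ 3"
      using w2[of n] V(2) unfolding n_def by auto
    have "(43 / 100 * sqrt (real n) ^ 3 - 2 * real t * (sqrt (real n))\<^sup>2) ^ t \<le> (real (card H) - 2 * real t * card V) ^ t"
      using H(3) n(2) by (intro power_mono) (auto simp: n_def)
    also have "\<dots> \<le> fact t * real (nmat t H)"
      using nmat_ge_power[OF H(1), of t] H(3) n(2) by (simp add: n_def mult.assoc)
    finally have "(43 / 100 * sqrt (real n) ^ 3 - 2 * real t * (sqrt (real n))\<^sup>2) ^ t / fact t \<le> real (nmat t H)"
      by (simp add: field_simps)
    with n(1) have "(1 + \<kappa>) * (real n ^ (r - 1) / fact (r - 1)) + 2 * \<kappa> * sqrt n ^ (3 * t) \<le> nmat t H"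
      by (simp add: power_mult)
    thus "\<exists>H. sgraph V H \<and> c4_free H
       \<and> 43 / 100 * sqrt (card V) ^ 3 \<le> card H
       \<and> (1 + \<kappa>) * (real (card V) ^ (r - 1) / fact (r - 1)) + 2 * \<kappa> * sqrt (card V) ^ (3 * t) \<le> nmat t H"
      using H unfolding n_def by blast
  qed
qed

section \<open>Counting copies\<close>

lemma graph_on_iff_sgraph: "graph_on n E \<longleftrightarrow> sgraph {..<n} E"
proof
  assume "graph_on n E"
  thus "sgraph {..<n} E" unfolding graph_on_def sgraph_def
    by (simp add: subset_iff) (metis card_2_iff insertE lessThan_iff singletonD)
next
  assume a: "sgraph {..<n} E"
  show "graph_on n E" unfolding graph_on_def
  proof
    fix e assume "e \<in> E"
    from sgraph_edge[OF a this] show "e \<in> {e. \<exists>u v. e = {u, v} \<and> u \<noteq> v \<and> u < n \<and> v < n}" by auto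
  qed
qed

lemma graph_iso_rev:
  assumes "snd H \<subseteq> Pow (fst H)" "snd G \<subseteq> Pow (fst G)"
  shows "graph_iso G H \<longleftrightarrow> (\<exists>g. bij_betw g (fst H) (fst G) \<and> (image g) ` (snd H) = snd G)"
proof
  assume "graph_iso G H"
  then obtain f where f: "bij_betw f (fst G) (fst H)" "(image f) ` (snd G) = snd H"
    unfolding graph_iso_def by blast
  define g where "g = inv_into (fst G) f"
  have "image g ` (snd H) = snd G"
  proof -
    have "g ` f ` e = e" if "e \<in> snd G" for e
      unfolding g_def using that f assms by (intro inv_into_image_cancel) (auto simp: bij_betw_def)
    hence "(\<lambda>e. g ` f ` e) ` snd G = snd G" by force
    thus ?thesis unfolding f(2)[symmetric] by (simp add: image_image)
  qed
  thus "\<exists>g. bij_betw g (fst H) (fst G) \<and> (image g) ` (snd H) = snd G"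
    using bij_betw_inv_into[OF f(1)] unfolding g_def by blast
next
  assume "\<exists>g. bij_betw g (fst H) (fst G) \<and> (image g) ` (snd H) = snd G"
  then obtain g where g: "bij_betw g (fst H) (fst G)" "(image g) ` (snd H) = snd G" by blast
  define f where "f = inv_into (fst H) g"
  have "image f ` (snd G) = snd H"
  proof -
    have "f ` g ` e = e" if "e \<in> snd H" for e
      unfolding f_def using that g assms by (intro inv_into_image_cancel) (auto simp: bij_betw_def)
    hence "(\<lambda>e. f ` g ` e) ` snd H = snd H" by force
    thus ?thesis unfolding g(2)[symmetric] by (simp add: image_image)
  qed
  thus "graph_iso G H"
    using bij_betw_inv_into[OF g(1)] unfolding f_def graph_iso_def by blast
qed

text \<open>When the pattern has no isolated vertex, the vertices of a copy are determined by its
  edges, so a copy is just the image of the pattern's edges under an injective map.\<close>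

lemma graph_iso_Union_rev:
  fixes F :: "'a set set" and H :: "'b set \<times> 'b set set"
  assumes "snd H \<subseteq> Pow (fst H)" "\<Union>(snd H) = fst H"
  shows "graph_iso (\<Union>F, F) H \<longleftrightarrow> (\<exists>g. inj_on g (fst H) \<and> (image g) ` (snd H) = F)"
proof -
  have "\<Union> (image g ` snd H) = g ` fst H" for g :: "'b \<Rightarrow> 'a" using assms(2) by blast
  thus ?thesis using assms(1) by (subst graph_iso_rev) (auto simp: bij_betw_def)
qed

lemma graph_iso_matching:
  assumes "sgraph V E" "F \<subseteq> E"
  shows "graph_iso (\<Union>F, F) (matching t) \<longleftrightarrow> card F = t \<and> pairwise disjnt F"
proof -
  have edges: "snd (matching t) = (\<lambda>i. {2 * i, 2 * i + 1}) ` {..<t}" by (auto simp: matching_def)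
  have U: "snd (matching t) \<subseteq> Pow (fst (matching t))" "\<Union>(snd (matching t)) = fst (matching t)"
  proof -
    have "x \<in> (\<Union>i\<in>{..<t}. {2 * i, 2 * i + 1})" if "x < 2 * t" for x :: nat
      using that by (intro UN_I[of "x div 2"]) auto
    thus "\<Union>(snd (matching t)) = fst (matching t)" unfolding edges by (auto simp: matching_def)
  qed (auto simp: matching_def)
  show ?thesis
  proof
    assume "graph_iso (\<Union>F, F) (matching t)"
    then obtain g where g: "inj_on g {0..<2 * t}" "(image g) ` (snd (matching t)) = F"
      unfolding graph_iso_Union_rev[OF U] by (auto simp: matching_def)
    have F: "F = (\<lambda>i. {g (2 * i), g (2 * i + 1)}) ` {..<t}"
      unfolding g(2)[symmetric] edges by (simp add: image_image)
    have dis: "{g (2 * i), g (2 * i + 1)} \<inter> {g (2 * j), g (2 * j + 1)} = {}" if "i < t" "j < t" "i \<noteq> j" for i j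
    proof -
      have "g a \<noteq> g b" if "a \<noteq> b" "a < 2 * t" "b < 2 * t" for a b
        using inj_onD[OF g(1), of a b] that by auto
      note neq = this
      have "g (2 * i) \<noteq> g (2 * j)" "g (2 * i + 1) \<noteq> g (2 * j + 1)"
        by (rule neq; use that in simp)+
      moreover have "g (2 * i) \<noteq> g (2 * j + 1)" "g (2 * i + 1) \<noteq> g (2 * j)"
        by (rule neq; use that in \<open>presburger | simp\<close>)+
      ultimately show ?thesis by auto
    qed
    have "inj_on (\<lambda>i. {g (2 * i), g (2 * i + 1)}) {..<t}"
      by (rule inj_onI) (use dis in fastforce)
    hence "card F = t" unfolding F by (simp add: card_image)
    moreover have "pairwise disjnt F"
    proof (rule pairwiseI)
      fix A B assume "A \<in> F" "B \<in> F" and AB: "A \<noteq> B"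
      then obtain i j where ij: "i < t" "j < t" "A = {g (2 * i), g (2 * i + 1)}" "B = {g (2 * j), g (2 * j + 1)}"
        unfolding F by blast
      moreover have "i \<noteq> j" using AB ij by blast
      ultimately show "disjnt A B" unfolding disjnt_def using dis by blast
    qed
    ultimately show "card F = t \<and> pairwise disjnt F" by blast
  next
    assume a: "card F = t \<and> pairwise disjnt F"
    have finF: "finite F" using assms sgraph_finite finite_subset by blast
    obtain h where h: "bij_betw h {..<t} F"
      using a finF by (metis card_lessThan finite_lessThan finite_same_card_bij)
    have hF: "h i \<in> F" if "i < t" for i using bij_betwE[OF h] that by auto
    have "\<exists>p q. h i = {p, q} \<and> p \<noteq> q" if "i < t" for i
      using sgraph_edge[OF assms(1) subsetD[OF assms(2) hF[OF that]]] by blast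
    then obtain p q where pq: "\<And>i. i < t \<Longrightarrow> h i = {p i, q i} \<and> p i \<noteq> q i" by metis
    define g where "g x = (if even x then p (x div 2) else q (x div 2))" for x
    have gh: "g x \<in> h (x div 2)" if "x < 2 * t" for x
      using pq[of "x div 2"] that by (auto simp: g_def)
    have dis: "h i \<inter> h j = {}" if "i < t" "j < t" "i \<noteq> j" for i j
    proof -
      have "h i \<noteq> h j" using inj_onD[OF bij_betw_imp_inj_on[OF h], of i j] that by auto
      thus ?thesis using pairwiseD[of disjnt F "h i" "h j"] a hF that by (simp add: disjnt_def)
    qed
    have "inj_on g {0..<2 * t}"
    proof (rule inj_onI)
      fix x y assume xy: "x \<in> {0..<2 * t}" "y \<in> {0..<2 * t}" "g x = g y"
      have d: "x div 2 = y div 2"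
        using dis[of "x div 2" "y div 2"] gh[of x] gh[of y] xy by fastforce
      have "even x \<longleftrightarrow> even y"
        using xy pq[of "x div 2"] d by (auto simp: g_def split: if_splits)
      thus "x = y" using d by presburger
    qed
    moreover have "(image g) ` (snd (matching t)) = F"
    proof -
      have "(image g) ` (snd (matching t)) = (\<lambda>i. {g (2 * i), g (2 * i + 1)}) ` {..<t}"
        unfolding edges by (simp add: image_image)
      also have "\<dots> = h ` {..<t}" by (intro image_cong) (auto simp: g_def pq)
      finally show ?thesis using h by (simp add: bij_betw_def)
    qed
    ultimately show "graph_iso (\<Union>F, F) (matching t)"
      unfolding graph_iso_Union_rev[OF U] by (auto simp: matching_def)
  qed
qed

lemma copies_matching:
  assumes "sgraph V E"
  shows "copies (matching t) E = nmat t E"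
proof -
  have "{F. F \<subseteq> E \<and> graph_iso (\<Union>F, F) (matching t)} = matchings t E"
    unfolding matchings_def using graph_iso_matching[OF assms] by blast
  thus ?thesis by (simp add: copies_def)
qed

definition stars :: "'a \<Rightarrow> 'a set \<Rightarrow> 'a set set" where
  "stars c T = (\<lambda>x. {c, x}) ` T"

lemma graph_iso_star:
  assumes "r \<ge> 2"
  shows "graph_iso (\<Union>F, F) (star r) \<longleftrightarrow> (\<exists>c T. F = stars c T \<and> c \<notin> T \<and> finite T \<and> card T = r - 1)"
proof -
  have edges: "snd (star r) = (\<lambda>i. {0, i}) ` {1..<r}" by (auto simp: star_def)
  have U: "snd (star r) \<subseteq> Pow (fst (star r))" "\<Union>(snd (star r)) = fst (star r)"
  proof -
    \<comment> \<open>A leaf lies on its own edge; \<open>max 1 x\<close> places the centre 0 on the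
      edge \<open>{0, 1}\<close>, which is present since \<open>r \<ge> 2\<close>.\<close>
    have "x \<in> (\<Union>i\<in>{1..<r}. {0, i})" if "x < r" for x :: nat
      using that assms by (intro UN_I[of "max 1 x"]) auto
    thus "\<Union>(snd (star r)) = fst (star r)" using assms unfolding edges by (auto simp: star_def)
  qed (auto simp: star_def)
  have "graph_iso (\<Union>F, F) (star r) \<longleftrightarrow> (\<exists>g. inj_on g {0..<r} \<and> stars (g 0) (g ` {1..<r}) = F)"
    unfolding graph_iso_Union_rev[OF U] edges stars_def by (simp add: star_def image_image)
  also have "\<dots> \<longleftrightarrow> (\<exists>c T. F = stars c T \<and> c \<notin> T \<and> finite T \<and> card T = r - 1)"
  proof
    assume "\<exists>g. inj_on g {0..<r} \<and> stars (g 0) (g ` {1..<r}) = F"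
    then obtain g where g: "inj_on g {0..<r}" "stars (g 0) (g ` {1..<r}) = F" by blast
    have "g 0 \<notin> g ` {1..<r}"
    proof
      assume "g 0 \<in> g ` {1..<r}"
      then obtain x where "x \<in> {1..<r}" "g 0 = g x" by blast
      thus False using inj_onD[OF g(1), of 0 x] by auto
    qed
    moreover have "card (g ` {1..<r}) = r - 1"
      using card_image[OF inj_on_subset[OF g(1)], of "{1..<r}"] by auto
    ultimately show "\<exists>c T. F = stars c T \<and> c \<notin> T \<and> finite T \<and> card T = r - 1"
      using g(2) by (intro exI[of _ "g 0"] exI[of _ "g ` {1..<r}"]) auto
  next
    assume "\<exists>c T. F = stars c T \<and> c \<notin> T \<and> finite T \<and> card T = r - 1"
    then obtain c T where T: "F = stars c T" "c \<notin> T" "finite T" "card T = r - 1" by blast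
    have "card {1..<r} = card T" using T by simp
    then obtain h where h: "bij_betw h {1..<r} T" using T(3) by (metis finite_atLeastLessThan finite_same_card_bij)
    define g where "g x = (if x = 0 then c else h x)" for x :: nat
    have im: "g ` {1..<r} = T" using h by (auto simp: g_def bij_betw_def)
    have "inj_on g {0..<r}"
    proof (rule inj_onI)
      fix x y assume xy: "x \<in> {0..<r}" "y \<in> {0..<r}" "g x = g y"
      have "h z \<noteq> c" if "z \<in> {1..<r}" for z using h T(2) that by (auto simp: bij_betw_def)
      from this[of x] this[of y] show "x = y"
        using xy inj_onD[OF bij_betw_imp_inj_on[OF h], of x y] by (auto simp: g_def split: if_splits)
    qed
    thus "\<exists>g. inj_on g {0..<r} \<and> stars (g 0) (g ` {1..<r}) = F"
      using im T(1) by (intro exI[of _ g]) (simp add: g_def)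
  qed
  finally show ?thesis .
qed

lemma star_copies_eq:
  assumes "sgraph V E" "r \<ge> 2"
  shows "{F. F \<subseteq> E \<and> graph_iso (\<Union>F, F) (star r)} = (\<Union>c\<in>V. stars c ` {T. T \<subseteq> nbr E c \<and> card T = r - 1})"
    (is "?L = ?R")
proof
  show "?L \<subseteq> ?R"
  proof
    fix F assume "F \<in> ?L"
    hence FE: "F \<subseteq> E" "graph_iso (\<Union>F, F) (star r)" by auto
    obtain c T where "F = stars c T" "card T = r - 1"
      using FE(2) unfolding graph_iso_star[OF assms(2)] by blast
    with FE(1) have T: "F \<subseteq> E" "F = stars c T" "card T = r - 1" by auto
    have sub: "T \<subseteq> nbr E c" using T unfolding stars_def nbr_def by auto
    moreover have "c \<in> V"
    proof -
      obtain x where "x \<in> T" using T(3) assms(2) by fastforce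
      hence "nbr E c \<noteq> {}" using sub by blast
      thus ?thesis using nbr_outside[OF assms(1)] by blast
    qed
    ultimately show "F \<in> ?R" using T by blast
  qed
  show "?R \<subseteq> ?L"
  proof
    fix F assume "F \<in> ?R"
    then obtain c T where T: "c \<in> V" "F = stars c T" "T \<subseteq> nbr E c" "card T = r - 1" by blast
    have "finite T" "c \<notin> T" using T(3) nbr_subset[OF assms(1)] finite_nbr[OF assms(1)] finite_subset by blast+
    moreover have "F \<subseteq> E" using T unfolding stars_def nbr_def by auto
    ultimately show "F \<in> ?L" using graph_iso_star[OF assms(2)] T by blast
  qed
qed

lemma stars_inj: "stars c T = stars c T' \<Longrightarrow> T = T'"
  for T T' :: "'a set"
proof -
  have "T \<subseteq> T'" if "stars c T = stars c T'" for T T'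
  proof
    fix x assume "x \<in> T"
    hence "{c, x} \<in> stars c T'" using that unfolding stars_def by blast
    thus "x \<in> T'" unfolding stars_def by (auto simp: doubleton_eq_iff)
  qed
  thus "T = T'" if "stars c T = stars c T'" using that by (metis subset_antisym)
qed

text \<open>Only an inequality, because for \<open>r = 2\<close> each edge is counted at both of its
  ends. From \<open>r = 3\<close> on, two edges of a star determine its centre and equality
  holds.\<close>

lemma copies_star_le:
  assumes "sgraph V E" "r \<ge> 2"
  shows "copies (star r) E \<le> (\<Sum>v\<in>V. deg E v choose (r - 1))"
proof -
  have "copies (star r) E \<le> (\<Sum>c\<in>V. card (stars c ` {T. T \<subseteq> nbr E c \<and> card T = r - 1}))"
    unfolding copies_def star_copies_eq[OF assms] using sgraph_finite(1)[OF assms(1)] by (rule card_UN_le)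
  also have "\<dots> = (\<Sum>c\<in>V. card {T. T \<subseteq> nbr E c \<and> card T = r - 1})"
    by (intro sum.cong refl card_image inj_onI) (auto dest: stars_inj)
  finally show ?thesis by (simp add: n_subsets finite_nbr[OF assms(1)])
qed

lemma stars_center_unique:
  assumes "stars c T = stars d T'" "card T \<ge> 2" "c \<notin> T" "d \<notin> T'"
  shows "c = d"
proof -
  obtain x y where "x \<in> T" "y \<in> T" "x \<noteq> y"
    using assms(2) by (metis card_le_Suc0_iff_eq card.infinite numeral_2_eq_2 not_less_eq_eq zero_le)
  hence "{c, x} \<in> stars d T'" "{c, y} \<in> stars d T'" "x \<noteq> y" "c \<noteq> x" "c \<noteq> y"
    using assms unfolding stars_def by auto
  thus ?thesis unfolding stars_def by (auto simp: doubleton_eq_iff)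
qed

lemma copies_star:
  assumes "sgraph V E" "r \<ge> 3"
  shows "copies (star r) E = (\<Sum>v\<in>V. deg E v choose (r - 1))"
proof -
  have r2: "r \<ge> 2" using assms by simp
  have "copies (star r) E = (\<Sum>c\<in>V. card (stars c ` {T. T \<subseteq> nbr E c \<and> card T = r - 1}))"
    unfolding copies_def star_copies_eq[OF assms(1) r2]
  proof (rule card_UN_disjoint)
    show "finite V" using sgraph_finite(1)[OF assms(1)] .
    show "\<forall>c\<in>V. finite (stars c ` {T. T \<subseteq> nbr E c \<and> card T = r - 1})"
      using finite_nbr[OF assms(1)] by auto
    show "\<forall>c\<in>V. \<forall>d\<in>V. c \<noteq> d \<longrightarrow> stars c ` {T. T \<subseteq> nbr E c \<and> card T = r - 1}
        \<inter> stars d ` {T. T \<subseteq> nbr E d \<and> card T = r - 1} = {}"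
    proof (intro ballI impI equals0I)
      fix c d F assume cd: "c \<noteq> d" and "F \<in> stars c ` {T. T \<subseteq> nbr E c \<and> card T = r - 1}
        \<inter> stars d ` {T. T \<subseteq> nbr E d \<and> card T = r - 1}"
      then obtain T T' where T: "stars c T = stars d T'" "T \<subseteq> nbr E c" "T' \<subseteq> nbr E d" "card T = r - 1" by blast
      have "c \<notin> T" "d \<notin> T'" using T nbr_subset[OF assms(1)] by blast+
      moreover have "card T \<ge> 2" using T(4) assms(2) by linarith
      ultimately show False using stars_center_unique[OF T(1)] cd by blast
    qed
  qed
  also have "\<dots> = (\<Sum>c\<in>V. card {T. T \<subseteq> nbr E c \<and> card T = r - 1})"
    by (intro sum.cong refl card_image inj_onI) (auto dest: stars_inj)
  finally show ?thesis by (simp add: n_subsets finite_nbr[OF assms(1)])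
qed

text \<open>Serves the pair \<open>(r, t) = (2, 1)\<close>, where every edge counts once in either
  colour and the factor 2 lost in the degree sum could not be recovered.\<close>

lemma copies_star_2_le:
  assumes "finite E"
  shows "copies (star 2) E \<le> card E"
proof -
  have "{F. F \<subseteq> E \<and> graph_iso (\<Union>F, F) (star 2)} \<subseteq> (\<lambda>e. {e}) ` E"
  proof
    fix F assume "F \<in> {F. F \<subseteq> E \<and> graph_iso (\<Union>F, F) (star 2)}"
    then obtain c T where "F \<subseteq> E" "F = stars c T" "card T = 1"
      using graph_iso_star[of 2 F] by auto
    thus "F \<in> (\<lambda>e. {e}) ` E" by (auto simp: stars_def card_1_singleton_iff)
  qed
  hence "copies (star 2) E \<le> card ((\<lambda>e. {e}) ` E)"
    unfolding copies_def using assms by (intro card_mono) auto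
  thus ?thesis using card_image_le[OF assms, of "\<lambda>e. {e}"] by linarith
qed

lemma free_of_C4_iff:
  assumes "sgraph V E"
  shows "free_of C4 E \<longleftrightarrow> c4_free E"
proof -
  have U: "snd C4 \<subseteq> Pow (fst C4)" "\<Union>(snd C4) = fst C4" by (auto simp: C4_def)
  have V4: "{0..<4::nat} = {0, 1, 2, 3}" by auto
  have iso: "graph_iso (\<Union>F, F) C4 \<longleftrightarrow>
    (\<exists>g :: nat \<Rightarrow> nat. inj_on g {0, 1, 2, 3} \<and> F = {{g 0, g 1}, {g 1, g 2}, {g 2, g 3}, {g 3, g 0}})" for F :: "nat set set"
    unfolding graph_iso_Union_rev[OF U] by (auto simp: C4_def V4)
  show ?thesis
  proof
    assume free: "free_of C4 E"
    show "c4_free E" unfolding c4_free_def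
    proof (intro allI impI, rule ccontr)
      fix u v x y assume a: "u \<noteq> v" "x \<in> nbr E u \<inter> nbr E v" "y \<in> nbr E u \<inter> nbr E v" "x \<noteq> y"
      define g where "g i = (if i = 0 then u else if i = 1 then x else if i = 2 then v else y)" for i :: nat
      have d: "u \<noteq> x" "u \<noteq> y" "v \<noteq> x" "v \<noteq> y" using a nbr_subset[OF assms] by blast+
      have "inj_on g {0, 1, 2, 3}" using a d by (auto simp: g_def inj_on_def)
      moreover have "{{g 0, g 1}, {g 1, g 2}, {g 2, g 3}, {g 3, g 0}} \<subseteq> E"
        using a by (auto simp: g_def nbr_def insert_commute)
      ultimately show False using free iso unfolding free_of_def by blast
    qed
  next
    assume c4: "c4_free E"
    show "free_of C4 E" unfolding free_of_def
    proof
      assume "\<exists>F. F \<subseteq> E \<and> graph_iso (\<Union>F, F) C4"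
      then obtain g where g: "inj_on g {0, 1, 2, 3::nat}"
        "{{g 0, g 1}, {g 1, g 2}, {g 2, g 3}, {g 3, g 0}} \<subseteq> E" using iso by metis
      have "g 0 \<noteq> g 2" "g 1 \<noteq> g 3" using g(1) by (auto simp: inj_on_def)
      moreover have "g 1 \<in> nbr E (g 0) \<inter> nbr E (g 2)" "g 3 \<in> nbr E (g 0) \<inter> nbr E (g 2)"
        using g(2) by (auto simp: nbr_def insert_commute)
      ultimately show False using c4 unfolding c4_free_def by blast
    qed
  qed
qed

section \<open>Many matchings\<close>

text \<open>A set added to the union shares at most one element with each earlier set. Blue
  neighbourhoods of distinct vertices are of this kind, so a few large ones are almost
  disjoint.\<close>

lemma sum_card_le_card_Union:
  assumes "finite L" "\<And>v. v \<in> L \<Longrightarrow> finite (A v)"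
    "\<And>u v. u \<in> L \<Longrightarrow> v \<in> L \<Longrightarrow> u \<noteq> v \<Longrightarrow> card (A u \<inter> A v) \<le> 1"
  shows "(\<Sum>v\<in>L. card (A v)) \<le> card (\<Union>v\<in>L. A v) + (card L)\<^sup>2"
  using assms
proof (induction L rule: finite_induct)
  case empty
  then show ?case by simp
next
  case (insert x L)
  have IH: "(\<Sum>v\<in>L. card (A v)) \<le> card (\<Union>v\<in>L. A v) + (card L)\<^sup>2"
    using insert.prems by (intro insert.IH) auto
  have fU: "finite (\<Union>v\<in>L. A v)"
    by (rule finite_UN_I[OF insert.hyps(1)]) (auto intro: insert.prems(1))
  have "card (A x \<inter> (\<Union>v\<in>L. A v)) = card (\<Union>v\<in>L. A x \<inter> A v)" by (simp only: Int_UN_distrib)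
  also have "\<dots> \<le> (\<Sum>v\<in>L. card (A x \<inter> A v))" by (rule card_UN_le[OF insert.hyps(1)])
  also have "\<dots> \<le> (\<Sum>v\<in>L. 1)" using insert by (intro sum_mono insert.prems(2)) auto
  finally have i: "card (A x \<inter> (\<Union>v\<in>L. A v)) \<le> card L" by simp
  have "card (A x) + card (\<Union>v\<in>L. A v) = card (A x \<union> (\<Union>v\<in>L. A v)) + card (A x \<inter> (\<Union>v\<in>L. A v))"
    using fU insert.prems by (intro card_Un_Int) auto
  thus ?case using IH i insert.hyps by (simp add: power2_eq_square)
qed

text \<open>Several centres with a given total degree have, to leading order, no more stars than a
  single centre of that degree.\<close>

lemma sum_power_le_power_sum:
  fixes f :: "'a \<Rightarrow> real"
  assumes "finite L" "\<And>v. v \<in> L \<Longrightarrow> f v \<ge> 0" "k > 0"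
  shows "(\<Sum>v\<in>L. f v ^ k) \<le> (\<Sum>v\<in>L. f v) ^ k"
  using assms(1,2)
proof (induction L rule: finite_induct)
  case empty
  then show ?case using assms(3) by simp
next
  case (insert x L)
  obtain j where k: "k = Suc j" using assms(3) gr0_conv_Suc by blast
  define S where "S = (\<Sum>v\<in>L. f v)"
  have S: "S \<ge> 0" "f x \<ge> 0" using insert by (auto simp: S_def intro: sum_nonneg)
  have "f x ^ k + S ^ k \<le> f x * (f x + S) ^ j + S * (f x + S) ^ j"
    unfolding k power_Suc using S by (intro add_mono mult_left_mono power_mono) auto
  also have "\<dots> = (f x + S) ^ k" by (simp add: k distrib_right)
  finally show ?case using insert by (simp add: S_def)
qed

lemma choose_le_power_div_fact: "real (n choose k) \<le> real n ^ k / fact k"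
proof -
  have "real ((n choose k) * fact k) \<le> real (n ^ k)"
    using binomial_fact_pow[of n k] by (rule of_nat_mono)
  thus ?thesis by (simp add: field_simps)
qed

lemma choose_le_power: "n choose k \<le> n ^ k"
  using binomial_fact_pow[of n k] by (metis fact_ge_1 le_trans mult.right_neutral mult_le_mono2)

text \<open>Every vertex \<open>u\<close> other than \<open>v\<close> has at most one neighbour in
  \<open>N\<close> and thus accounts for at most one of these edges; \<open>v\<close> itself
  accounts for at most \<open>card V\<close>.\<close>

lemma card_edges_meeting_nbr_le:
  assumes "sgraph V E" "c4_free E" "N \<subseteq> nbr E v"
  shows "card {e \<in> E. e \<inter> N \<noteq> {}} \<le> 2 * card V"
proof -
  have fin: "finite V" using assms sgraph_finite by blast
  have finN: "finite (N \<inter> X)" for X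
    using finite_subset[OF assms(3) finite_nbr[OF assms(1)]] by simp
  have "{e \<in> E. e \<inter> N \<noteq> {}} \<subseteq> (\<Union>u\<in>V. (\<lambda>x. {x, u}) ` (N \<inter> nbr E u))"
  proof
    fix e assume e: "e \<in> {e \<in> E. e \<inter> N \<noteq> {}}"
    then obtain x where x: "x \<in> e" "x \<in> N" by blast
    obtain u where u: "e = {x, u}" "u \<in> V"
      using sgraph_edge[OF assms(1), of e] e x(1) by auto
    have "x \<in> nbr E u" using e u by (simp add: nbr_def insert_commute)
    thus "e \<in> (\<Union>u\<in>V. (\<lambda>x. {x, u}) ` (N \<inter> nbr E u))" using u x by blast
  qed
  hence "card {e \<in> E. e \<inter> N \<noteq> {}} \<le> card (\<Union>u\<in>V. (\<lambda>x. {x, u}) ` (N \<inter> nbr E u))"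
    using fin finN by (intro card_mono) auto
  also have "\<dots> \<le> (\<Sum>u\<in>V. card ((\<lambda>x. {x, u}) ` (N \<inter> nbr E u)))" by (rule card_UN_le[OF fin])
  also have "\<dots> \<le> (\<Sum>u\<in>V. 1 + (if u = v then card V else 0))"
  proof (intro sum_mono)
    fix u assume "u \<in> V"
    have "card ((\<lambda>x. {x, u}) ` (N \<inter> nbr E u)) \<le> card (N \<inter> nbr E u)" by (rule card_image_le[OF finN])
    also have "\<dots> \<le> card (nbr E v \<inter> nbr E u)"
      using assms(3) finite_nbr[OF assms(1)] by (intro card_mono) auto
    also have "\<dots> \<le> 1 + (if u = v then card V else 0)"
      using c4_free_common[OF assms(2,1), of v u] deg_le_card[OF assms(1), of v] by auto
    finally show "card ((\<lambda>x. {x, u}) ` (N \<inter> nbr E u)) \<le> 1 + (if u = v then card V else 0)" .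
  qed
  also have "\<dots> \<le> 2 * card V" using fin by (simp only: sum.distrib) auto
  finally show ?thesis .
qed

lemma c4_free_disjoint_union:
  assumes "c4_free A" "c4_free H" "\<And>a. a \<in> A \<Longrightarrow> a \<inter> W = {}" "\<And>h. h \<in> H \<Longrightarrow> h \<subseteq> W"
  shows "c4_free (A \<union> H)"
proof -
  have hA: "p \<notin> W \<and> q \<notin> W" if "{p, q} \<in> A" for p q using assms(3)[OF that] by auto
  have hH: "p \<in> W \<and> q \<in> W" if "{p, q} \<in> H" for p q using assms(4)[OF that] by auto
  have nbr: "nbr (A \<union> H) u = (if u \<in> W then nbr H u else nbr A u)" for u
    unfolding nbr_def by (auto dest: hA hH)
  have sub: "nbr H u \<subseteq> W" "nbr A u \<inter> W = {}" for u
    unfolding nbr_def by (auto dest: hA hH)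
  show ?thesis unfolding c4_free_def
  proof (intro allI impI)
    fix u v x y
    assume a: "u \<noteq> v" "x \<in> nbr (A \<union> H) u \<inter> nbr (A \<union> H) v" "y \<in> nbr (A \<union> H) u \<inter> nbr (A \<union> H) v"
    have "u \<in> W \<longleftrightarrow> v \<in> W" using a(2) sub unfolding nbr by (auto split: if_splits)
    thus "x = y" using a assms(1,2)[unfolded c4_free_def, rule_format, of u v x y] unfolding nbr
      by (auto split: if_splits)
  qed
qed

text \<open>A blue edge turned red completes every red \<open>(s + 1)\<close>-matching that avoids
  its ends. The matchings it cannot complete contain one of the at most \<open>2 * card V\<close>
  red edges meeting it.\<close>

lemma nmat_recolour:
  assumes "sgraph V E" "E1 \<subseteq> E"
  shows "real (nmat (s + 2) (E - E1)) + real (card E1) * (real (nmat (s + 1) (E - E1)) - 2 * real (card V) * real (nmat s (E - E1)))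
     \<le> real (nmat (s + 2) E)"
proof -
  define E2 where "E2 = E - E1"
  have fin: "finite E" "finite E1" "finite E2" using assms sgraph_finite finite_subset unfolding E2_def by blast+
  have sg2: "sgraph V E2" using assms sgraph_subset unfolding E2_def by blast
  have one: "real (nmat (s + 1) E2) - 2 * real (card V) * real (nmat s E2) \<le> real (nmat (s + 1) {f \<in> E2. f \<inter> e = {}})"
    if e: "e \<in> E1" for e
  proof -
    define B where "B = {f \<in> E2. f \<inter> e \<noteq> {}}"
    have c: "card e = 2" using assms e unfolding sgraph_def by auto
    hence fe: "finite e" using card.infinite by fastforce
    have "card B \<le> (\<Sum>x\<in>e. deg E2 x)" unfolding B_def by (rule card_edges_meeting_le[OF sg2 fe])
    also have "\<dots> \<le> 2 * card V" using sum_bounded_above[of e "deg E2" "card V"] deg_le_card[OF sg2] c by simp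
    finally have cB: "card B \<le> 2 * card V" .
    have "nmat (Suc s) E2 \<le> nmat (Suc s) (E2 - B) + card B * nmat s E2"
      by (rule nmat_delete[OF fin(3)]) (auto simp: B_def)
    also have "\<dots> \<le> nmat (Suc s) (E2 - B) + 2 * card V * nmat s E2" using cB by simp
    also have "E2 - B = {f \<in> E2. f \<inter> e = {}}" by (auto simp: B_def)
    finally have "real (nmat (Suc s) E2) \<le> real (nmat (Suc s) {f \<in> E2. f \<inter> e = {}} + 2 * card V * nmat s E2)"
      by (rule of_nat_mono)
    thus ?thesis by simp
  qed
  have "nmat (Suc (s + 1)) E2 + nmat (Suc (s + 1)) E1 + (\<Sum>e\<in>E1. nmat (s + 1) {f \<in> E2. f \<inter> e = {}}) \<le> nmat (Suc (s + 1)) (E2 \<union> E1)"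
    by (rule nmat_union) (use fin in \<open>auto simp: E2_def\<close>)
  also have "E2 \<union> E1 = E" using assms by (auto simp: E2_def)
  finally have "nmat (s + 2) E2 + (\<Sum>e\<in>E1. nmat (s + 1) {f \<in> E2. f \<inter> e = {}}) \<le> nmat (s + 2) E" by simp
  hence "real (nmat (s + 2) E2 + (\<Sum>e\<in>E1. nmat (s + 1) {f \<in> E2. f \<inter> e = {}})) \<le> real (nmat (s + 2) E)"
    by (rule of_nat_mono)
  moreover have "real (card E1) * (real (nmat (s + 1) E2) - 2 * real (card V) * real (nmat s E2))
      \<le> (\<Sum>e\<in>E1. real (nmat (s + 1) {f \<in> E2. f \<inter> e = {}}))"
    by (rule sum_bounded_below) (use one in auto)
  ultimately show ?thesis unfolding E2_def by simp
qed

text \<open>Once all edges meeting \<open>W\<close> are removed, \<open>A\<close> and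
  \<open>H\<close> share no vertex. Hence no four-cycle can mix them, and every edge of
  \<open>H\<close> extends every matching of \<open>A\<close>.\<close>

lemma surgery:
  assumes "sgraph V E2" "c4_free E2" "W \<subseteq> V" "sgraph W H" "c4_free H" "A = {e \<in> E2. e \<inter> W = {}}"
  shows "sgraph V (A \<union> H)" "c4_free (A \<union> H)"
    "nmat (s + 2) A + nmat (s + 2) H + card H * nmat (s + 1) A \<le> nmat (s + 2) (A \<union> H)"
proof -
  have Hs: "h \<subseteq> W \<and> h \<noteq> {}" if "h \<in> H" for h using that assms(4) unfolding sgraph_def by auto
  have As: "a \<inter> W = {}" if "a \<in> A" for a using that assms(6) by auto
  have fin: "finite A" "finite H" using sgraph_finite(2)[OF assms(1)] sgraph_finite(2)[OF assms(4)] assms(6) by auto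
  have AH: "A \<inter> H = {}" using Hs As by fastforce
  show "sgraph V (A \<union> H)" using assms unfolding sgraph_def by auto
  show "c4_free (A \<union> H)"
    using Hs As assms(5) c4_free_subset[OF assms(2), of A] assms(6)
    by (intro c4_free_disjoint_union[of A H W]) auto
  have "nmat (Suc (s + 1)) A + nmat (Suc (s + 1)) H + (\<Sum>h\<in>H. nmat (s + 1) {f \<in> A. f \<inter> h = {}}) \<le> nmat (Suc (s + 1)) (A \<union> H)"
    by (rule nmat_union) (use fin AH in auto)
  moreover have "{f \<in> A. f \<inter> h = {}} = A" if "h \<in> H" for h using that Hs As by blast
  ultimately show "nmat (s + 2) A + nmat (s + 2) H + card H * nmat (s + 1) A \<le> nmat (s + 2) (A \<union> H)" by simp
qed

lemma eventually_power_dominates: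
  assumes "a < (b :: nat)" "K > (0 :: real)"
  shows "eventually (\<lambda>y. C * y ^ a \<le> K * y ^ b) at_top"
proof -
  have "eventually (\<lambda>y::real. y \<ge> 1 \<and> C / K \<le> y) at_top"
    by (intro eventually_conj eventually_ge_at_top)
  thus ?thesis
  proof eventually_elim
    case (elim y)
    have "C \<le> K * y" using elim assms by (simp add: field_simps)
    hence "C * y ^ a \<le> K * y * y ^ a" using elim by (intro mult_right_mono) auto
    also have "\<dots> = K * y ^ Suc a" by simp
    also have "\<dots> \<le> K * y ^ b" using elim assms by (intro mult_left_mono power_increasing) auto
    finally show ?case .
  qed
qed

lemma sum_deg_square_le:
  assumes "sgraph V E" "c4_free E" "real (card V) = y ^ 16" "y \<ge> 1"
  shows "real (card E) \<le> y ^ 24" "(\<Sum>v\<in>V. (real (deg E v))\<^sup>2) \<le> 3 * y ^ 32"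
proof -
  have "(real (card E))\<^sup>2 \<le> (y ^ 24)\<^sup>2"
    using c4_free_card_square_le[OF assms(1,2)] by (simp add: assms(3) flip: power_mult)
  thus e: "real (card E) \<le> y ^ 24" by (rule power2_le_imp_le) (use assms in auto)
  have "(\<Sum>v\<in>V. (real (deg E v))\<^sup>2) \<le> y ^ 16 * (y ^ 16 - 1) + 2 * y ^ 24"
    unfolding sum_deg_square_eq[OF assms(1)] using sum_deg_mult_le[OF assms(1,2)] e by (simp add: assms(3))
  also have "y ^ 16 * (y ^ 16 - 1) \<le> y ^ 16 * y ^ 16" using assms by (intro mult_left_mono) auto
  also have "y ^ 16 * y ^ 16 = y ^ 32" by (simp flip: power_add)
  also have "y ^ 24 \<le> y ^ 32" using assms by (intro power_increasing) auto
  finally show "(\<Sum>v\<in>V. (real (deg E v))\<^sup>2) \<le> 3 * y ^ 32" by simp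
qed

lemma star_sum_low_le:
  fixes D :: real
  assumes "finite U" "\<And>v. v \<in> U \<Longrightarrow> real (d v) \<le> D" "r \<ge> 2"
  shows "real (\<Sum>v\<in>U. d v choose (r - 1)) \<le> (\<Sum>v\<in>U. (real (d v))\<^sup>2) * D ^ (r - 3)"
proof -
  have "real (d v choose (r - 1)) \<le> (real (d v))\<^sup>2 * D ^ (r - 3)" if v: "v \<in> U" for v
  proof -
    have "real (d v choose (r - 1)) \<le> real (d v) ^ (r - 1)"
      using choose_le_power[of "d v" "r - 1"] by (metis of_nat_mono of_nat_power)
    also have "\<dots> \<le> (real (d v))\<^sup>2 * real (d v) ^ (r - 3)"
    proof (cases "r = 2")
      \<comment> \<open>For \<open>r = 2\<close> the exponent \<open>r - 3\<close> is truncated to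
        0, and the square is reached by \<open>d \<le> d^2\<close>.\<close>
      case True
      have "d v \<le> (d v)\<^sup>2" by (simp add: power2_eq_square)
      hence "real (d v) \<le> (real (d v))\<^sup>2" by (metis of_nat_mono of_nat_power)
      thus ?thesis using True by simp
    next
      case False
      hence "r - 1 = 2 + (r - 3)" using assms(3) by simp
      thus ?thesis by (simp only: power_add)
    qed
    also have "\<dots> \<le> (real (d v))\<^sup>2 * D ^ (r - 3)"
      using assms(2)[OF v] by (intro mult_left_mono power_mono) auto
    finally show ?thesis .
  qed
  hence "real (\<Sum>v\<in>U. d v choose (r - 1)) \<le> (\<Sum>v\<in>U. (real (d v))\<^sup>2 * D ^ (r - 3))"
    by (simp add: sum_mono)
  thus ?thesis by (simp add: sum_distrib_right)
qed

text \<open>Linear in the degrees, so that the bound is proportional to the number of blue edges,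
  exactly like the gain from recolouring them. This comparison works however few blue edges there
  are.\<close>

lemma star_sum_linear_le:
  fixes D :: real
  assumes "finite U" "\<And>v. v \<in> U \<Longrightarrow> real (d v) \<le> D" "r \<ge> 2"
  shows "real (\<Sum>v\<in>U. d v choose (r - 1)) \<le> (\<Sum>v\<in>U. real (d v)) * D ^ (r - 2)"
proof -
  have "real (d v choose (r - 1)) \<le> real (d v) * D ^ (r - 2)" if v: "v \<in> U" for v
  proof -
    have "real (d v choose (r - 1)) \<le> real (d v) ^ (r - 1)"
      using choose_le_power[of "d v" "r - 1"] by (metis of_nat_mono of_nat_power)
    also have "real (d v) ^ (r - 1) = real (d v) * real (d v) ^ (r - 2)"
    proof -
      have "r - 1 = Suc (r - 2)" using assms(3) by simp
      thus ?thesis by simp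
    qed
    also have "\<dots> \<le> real (d v) * D ^ (r - 2)"
      using assms(2)[OF v] by (intro mult_left_mono power_mono) auto
    finally show ?thesis .
  qed
  hence "real (\<Sum>v\<in>U. d v choose (r - 1)) \<le> (\<Sum>v\<in>U. real (d v) * D ^ (r - 2))"
    by (simp add: sum_mono)
  thus ?thesis by (simp add: sum_distrib_right)
qed

lemma coloured_count_le_matching_count:
  assumes rt: "2 * (r - 1) \<le> 3 * t" "t \<ge> 2" "(r, t) \<noteq> (4, 2)" "r \<ge> 2"
  shows "\<exists>N. \<forall>(V :: 'a set) E E1. N \<le> card V \<longrightarrow> sgraph V E \<longrightarrow> c4_free E \<longrightarrow> E1 \<subseteq> E \<longrightarrow>
     (\<exists>E'. sgraph V E' \<and> c4_free E' \<and> (\<Sum>v\<in>V. deg E1 v choose (r - 1)) + nmat t (E - E1) \<le> nmat t E')"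
proof -
  obtain \<kappa> :: real and w0 :: nat where kappa: "\<kappa> > 0" and w0:
    "\<And>V :: 'a set. finite V \<Longrightarrow> w0 \<le> card V \<Longrightarrow> \<exists>H. sgraph V H \<and> c4_free H
       \<and> 43 / 100 * sqrt (card V) ^ 3 \<le> card H
       \<and> (1 + \<kappa>) * (real (card V) ^ (r - 1) / fact (r - 1)) + 2 * \<kappa> * sqrt (card V) ^ (3 * t) \<le> nmat t H"
    using many_matchings_exist[OF rt(1-3), where ?'a = 'a] by metis
  define s where "s = t - 2"
  have t: "t = s + 2" using rt by (simp add: s_def)
  \<comment> \<open>A relative error \<open>\<epsilon>\<close> in the total degree of the large
    centres then costs exactly the factor \<open>1 + \<kappa>\<close> in the number of
    stars.\<close>
  define \<epsilon> where "\<epsilon> = root (r - 1) (1 + \<kappa>) - 1"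
  have eps: "\<epsilon> > 0" "(1 + \<epsilon>) ^ (r - 1) = 1 + \<kappa>"
    using kappa rt(4) by (auto simp: \<epsilon>_def)
  have ex: "32 + 14 * (r - 3) < 24 * t" "20 + 24 * (s + 1) < 24 * t"
    "32 + 14 * (r - 3) < 21 + 24 * (s + 1)" "20 + 24 * (s + 1) < 21 + 24 * (s + 1)"
    "16 + 24 * s < 24 * (s + 1)"
    using rt unfolding t by auto
  \<comment> \<open>The estimate 21 s + 28 < 24 s + 24 is available from \<open>s = 2\<close> on,
    the tightest case being \<open>(r, t) = (7, 4)\<close> with 70 < 72. For \<open>s = 0\<close>
    the exclusion of \<open>(4, 2)\<close> is essential, as 28 < 24 fails.\<close>
  have "14 * (r - 2) < 24 * (s + 1)"
  proof -
    have r: "2 * r \<le> 3 * s + 8" using rt(1,4) unfolding t by arith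
    consider "s = 0" | "s = 1" | "s \<ge> 2" by linarith
    thus ?thesis
    proof cases
      case 1
      hence "r \<le> 3" using r rt unfolding t by auto
      thus ?thesis by simp
    next
      case 2
      hence "r \<le> 5" using r by simp
      thus ?thesis using 2 by simp
    next
      case 3
      define q where "q = r - 2"
      have "2 * q \<le> 3 * s + 4" using r by (simp add: q_def)
      hence "7 * (2 * q) \<le> 7 * (3 * s + 4)" by (rule mult_le_mono2)
      thus ?thesis unfolding q_def[symmetric] using 3 by simp
    qed
  qed
  note ex = ex this
  have k: "\<kappa> / 2 > 0" "43 / 400 * \<kappa> > 0" using kappa by auto
  have "eventually (\<lambda>y::real. y \<ge> 1 \<and> 9 * y ^ 8 \<le> \<epsilon> * y ^ 14 \<and> 3 * y ^ (32 + 14 * (r - 3)) \<le> \<kappa> * y ^ (24 * t) \<and>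
     real w0 * y ^ 0 \<le> 1 * y ^ 14 \<and> 6 * y ^ (20 + 24 * (s + 1)) \<le> \<kappa> / 2 * y ^ (24 * t) \<and>
     6 * y ^ (20 + 24 * (s + 1)) \<le> 43 / 400 * \<kappa> * y ^ (21 + 24 * (s + 1)) \<and>
     3 * y ^ (32 + 14 * (r - 3)) \<le> 43 / 400 * \<kappa> * y ^ (21 + 24 * (s + 1)) \<and>
     2 * y ^ (16 + 24 * s) \<le> \<kappa> / 2 * y ^ (24 * (s + 1)) \<and>
     2 * y ^ (14 * (r - 2)) \<le> \<kappa> / 2 * y ^ (24 * (s + 1))) at_top"
    by (intro eventually_conj eventually_ge_at_top eventually_power_dominates ex k kappa eps(1)) auto
  then obtain Y where Y: "\<And>y::real. y \<ge> Y \<Longrightarrow> y \<ge> 1 \<and> 9 * y ^ 8 \<le> \<epsilon> * y ^ 14 \<and> 3 * y ^ (32 + 14 * (r - 3)) \<le> \<kappa> * y ^ (24 * t) \<and>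
     real w0 * y ^ 0 \<le> 1 * y ^ 14 \<and> 6 * y ^ (20 + 24 * (s + 1)) \<le> \<kappa> / 2 * y ^ (24 * t) \<and>
     6 * y ^ (20 + 24 * (s + 1)) \<le> 43 / 400 * \<kappa> * y ^ (21 + 24 * (s + 1)) \<and>
     3 * y ^ (32 + 14 * (r - 3)) \<le> 43 / 400 * \<kappa> * y ^ (21 + 24 * (s + 1)) \<and>
     2 * y ^ (16 + 24 * s) \<le> \<kappa> / 2 * y ^ (24 * (s + 1)) \<and>
     2 * y ^ (14 * (r - 2)) \<le> \<kappa> / 2 * y ^ (24 * (s + 1))"
    unfolding eventually_at_top_linorder by blast
  define N where "N = nat \<lceil>(max Y 1) ^ 16\<rceil>"
  have main: "\<exists>E'. sgraph V E' \<and> c4_free E' \<and> (\<Sum>v\<in>V. deg E1 v choose (r - 1)) + nmat t (E - E1) \<le> nmat t E'"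
    if N: "N \<le> card V" and G: "sgraph V E" "c4_free E" "E1 \<subseteq> E" for V :: "'a set" and E E1
  proof -
    \<comment> \<open>with \<open>y = n^(1/16)\<close> all the orders of magnitude below are natural powers of \<open>y\<close>\<close>
    define y where "y = root 16 (real (card V))"
    have n: "real (card V) = y ^ 16" unfolding y_def by simp
    have "max Y 1 ^ 16 \<le> y ^ 16" unfolding n[symmetric] using N unfolding N_def by linarith
    hence "max Y 1 \<le> y" by (rule power_le_imp_le_base[of _ 15, simplified]) (simp add: y_def)
    hence yY: "y \<ge> Y" by simp
    note I = Y[OF yY]
    have y1: "y \<ge> 1" using I by blast
    have y0: "y ^ k > 0" for k using y1 by simp
    define E2 where "E2 = E - E1"
    define d where "d v = deg E1 v" for v
    \<comment> \<open>The exponents leave the window 6/7 < a < 9/10 for a threshold n^a. The red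
      edges at \<open>W\<close> number up to order n^(3-2a), to be beaten by the n^(3a/2) edges of a
      dense graph on \<open>W\<close>; this needs a > 6/7. Recolouring when no degree is large needs
      a (r - 2) < 3 (t - 1) / 2, for \<open>(7, 4)\<close> thus a < 9/10. The value 7/8 lies in
      between.\<close>
    define L where "L = {v \<in> V. y ^ 14 \<le> real (d v)}"
    define W where "W = (\<Union>v\<in>L. nbr E1 v)"
    have finV: "finite V" using G sgraph_finite by blast
    have finL: "finite L" using finV by (simp add: L_def)
    have g1: "sgraph V E1" "c4_free E1" and g2: "sgraph V E2" "c4_free E2"
      using sgraph_subset[OF G(1)] c4_free_subset[OF G(2)] G(3) by (auto simp: E2_def)
    have WV: "W \<subseteq> V" unfolding W_def using nbr_subset[OF g1(1)] by blast
    have finW: "finite W" using WV finV finite_subset by blast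
    have Wn: "real (card W) \<le> real (card V)" using WV finV by (simp add: card_mono)
    note sq = sum_deg_square_le[OF g1 n y1]
    note e2 = sum_deg_square_le(1)[OF g2 n y1]
    have matE2: "real (nmat k E2) \<le> y ^ (24 * k)" for k
    proof -
      have "real (nmat k E2) \<le> real (card E2 ^ k)"
        using nmat_le_power[OF sgraph_finite(2)[OF g2(1)]] by (rule of_nat_mono)
      also have "\<dots> = real (card E2) ^ k" by simp
      also have "\<dots> \<le> (y ^ 24) ^ k" using e2 by (intro power_mono) auto
      finally show ?thesis by (simp add: power_mult)
    qed
    have cardL: "real (card L) \<le> 3 * y ^ 4"
    proof -
      have "real (card L) * y ^ 28 \<le> (\<Sum>v\<in>L. (real (d v))\<^sup>2)"
      proof (rule sum_bounded_below)
        fix v assume "v \<in> L"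
        hence "y ^ 14 \<le> real (d v)" by (simp add: L_def)
        hence "(y ^ 14)\<^sup>2 \<le> (real (d v))\<^sup>2" using y0[of 14] by (intro power_mono) auto
        thus "y ^ 28 \<le> (real (d v))\<^sup>2" by (simp flip: power_mult)
      qed
      also have "\<dots> \<le> (\<Sum>v\<in>V. (real (d v))\<^sup>2)" using finV by (intro sum_mono2) (auto simp: L_def)
      also have "\<dots> \<le> 3 * y ^ 32" using sq(2) by (simp add: d_def)
      also have "\<dots> = (3 * y ^ 4) * y ^ 28" by (simp flip: power_add)
      finally show ?thesis using y0[of 28] by simp
    qed
    define Slow Shigh where "Slow = real (\<Sum>v\<in>V - L. d v choose (r - 1))"
      and "Shigh = real (\<Sum>v\<in>L. d v choose (r - 1))"
    have S: "real (\<Sum>v\<in>V. deg E1 v choose (r - 1)) = Slow + Shigh"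
      unfolding Slow_def Shigh_def d_def
      by (subst of_nat_add[symmetric], subst sum.subset_diff[of L V]) (auto simp: L_def finV)
    have low: "Slow \<le> 3 * y ^ (32 + 14 * (r - 3))"
    proof -
      have "Slow \<le> (\<Sum>v\<in>V - L. (real (d v))\<^sup>2) * (y ^ 14) ^ (r - 3)"
        unfolding Slow_def using finV rt(4) by (intro star_sum_low_le) (auto simp: L_def)
      also have "(\<Sum>v\<in>V - L. (real (d v))\<^sup>2) \<le> (\<Sum>v\<in>V. (real (d v))\<^sup>2)" using finV by (intro sum_mono2) auto
      also have "\<dots> \<le> 3 * y ^ 32" using sq(2) by (simp add: d_def)
      also have "3 * y ^ 32 * (y ^ 14) ^ (r - 3) = 3 * y ^ (32 + 14 * (r - 3))"
        by (simp add: power_add power_mult)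
      finally show ?thesis using y0[of 14] by (simp add: mult_right_mono)
    qed
    have sumL: "(\<Sum>v\<in>L. real (d v)) \<le> real (card W) + 9 * y ^ 8"
    proof -
      have "(\<Sum>v\<in>L. d v) \<le> card W + (card L)\<^sup>2"
        unfolding d_def W_def
        using finL finite_nbr[OF g1(1)] c4_free_common[OF g1(2,1)] by (intro sum_card_le_card_Union) auto
      hence "real (\<Sum>v\<in>L. d v) \<le> real (card W + (card L)\<^sup>2)" by (rule of_nat_mono)
      moreover have "(real (card L))\<^sup>2 \<le> (3 * y ^ 4)\<^sup>2" using cardL by (intro power_mono) auto
      ultimately show ?thesis by (simp add: power_mult_distrib flip: power_mult)
    qed
    \<comment> \<open>Needed twice: with \<open>x = card V\<close> against a new graph on all of
      \<open>V\<close>, and with \<open>x = card W\<close> against one on \<open>W\<close>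
      only.\<close>
    have high: "Shigh \<le> (1 + \<kappa>) * (x ^ (r - 1) / fact (r - 1))" if "real (card W) \<le> x" "y ^ 14 \<le> x" for x
    proof -
      have "Shigh \<le> (\<Sum>v\<in>L. real (d v) ^ (r - 1) / fact (r - 1))"
        unfolding Shigh_def by (simp add: sum_mono choose_le_power_div_fact)
      also have "\<dots> = (\<Sum>v\<in>L. real (d v) ^ (r - 1)) / fact (r - 1)" by (simp add: sum_divide_distrib)
      also have "\<dots> \<le> (\<Sum>v\<in>L. real (d v)) ^ (r - 1) / fact (r - 1)"
        using finL rt(4) by (intro divide_right_mono sum_power_le_power_sum) auto
      also have "\<dots> \<le> ((1 + \<epsilon>) * x) ^ (r - 1) / fact (r - 1)"
      proof -
        have "(\<Sum>v\<in>L. real (d v)) \<le> x + \<epsilon> * y ^ 14" using sumL that I by linarith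
        also have "\<epsilon> * y ^ 14 \<le> \<epsilon> * x" using that eps by (intro mult_left_mono) auto
        finally have "(\<Sum>v\<in>L. real (d v)) \<le> (1 + \<epsilon>) * x" by (simp add: algebra_simps)
        thus ?thesis by (intro divide_right_mono power_mono sum_nonneg) auto
      qed
      also have "\<dots> = (1 + \<kappa>) * (x ^ (r - 1) / fact (r - 1))" by (simp only: power_mult_distrib eps(2)) simp
      finally show ?thesis .
    qed
    have w0y: "w0 \<le> c" if "y ^ 14 \<le> real c" for c
    proof -
      have "real w0 \<le> real c" using I that by simp
      thus ?thesis by simp
    qed
    have suff: ?thesis if E': "sgraph V E'" "c4_free E'" "Slow + Shigh + real (nmat t E2) \<le> real (nmat t E')" for E'
    proof -
      have "real ((\<Sum>v\<in>V. deg E1 v choose (r - 1)) + nmat t (E - E1)) \<le> real (nmat t E')"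
        using E'(3) S by (simp add: E2_def)
      hence "(\<Sum>v\<in>V. deg E1 v choose (r - 1)) + nmat t (E - E1) \<le> nmat t E'"
        by (simp only: of_nat_le_iff)
      thus ?thesis using E' by blast
    qed
    show ?thesis
    proof (cases "real (nmat t E2) < \<kappa> * y ^ (24 * t)")
      case True
      have V14: "y ^ 14 \<le> real (card V)" unfolding n using y1 by (intro power_increasing) auto
      obtain H where H: "sgraph V H" "c4_free H"
        "(1 + \<kappa>) * (real (card V) ^ (r - 1) / fact (r - 1)) + 2 * \<kappa> * sqrt (card V) ^ (3 * t) \<le> nmat t H"
        using w0[OF finV w0y[OF V14]] by blast
      have "sqrt (card V) = y ^ 8" unfolding n by (rule real_sqrt_unique) (use y0[of 8] in \<open>auto simp flip: power_mult\<close>)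
      hence "sqrt (card V) ^ (3 * t) = y ^ (24 * t)" by (simp flip: power_mult)
      hence "Slow + Shigh + real (nmat t E2) \<le> real (nmat t H)"
      proof -
        assume sq: "sqrt (card V) ^ (3 * t) = y ^ (24 * t)"
        have "3 * y ^ (32 + 14 * (r - 3)) \<le> \<kappa> * y ^ (24 * t)" using I by blast
        moreover have "(1 + \<kappa>) * (real (card V) ^ (r - 1) / fact (r - 1)) + 2 * (\<kappa> * y ^ (24 * t)) \<le> nmat t H"
          using H(3) unfolding sq by (simp only: mult.assoc)
        ultimately show ?thesis using True low high[OF Wn V14] by linarith
      qed
      thus ?thesis using H suff by blast
    next
      case False
      hence big: "\<kappa> * y ^ (24 * (s + 2)) \<le> real (nmat (s + 2) E2)" by (simp add: t)
      \<comment> \<open>A matching of size \<open>s + 1\<close> extends in at most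
        \<open>y ^ 24\<close> ways, so many matchings of size \<open>s + 2\<close> force many of
        size \<open>s + 1\<close>. Recolouring and surgery both gain in proportion to the
        latter.\<close>
      have ratio: "c * y ^ (24 * (s + 1)) \<le> real (nmat (s + 1) A)"
        if "A \<subseteq> E2" "c * y ^ (24 * (s + 2)) \<le> real (nmat (s + 2) A)" for A c
      proof -
        have finA: "finite A" using that sgraph_finite(2)[OF g2(1)] finite_subset by blast
        have "real (nmat (Suc (s + 1)) A) \<le> real (card A * nmat (s + 1) A)"
          by (rule of_nat_mono[OF nmat_Suc_le[OF finA]])
        also have "\<dots> \<le> real (card E2) * real (nmat (s + 1) A)"
          using that sgraph_finite(2)[OF g2(1)] by (simp add: card_mono mult_right_mono)
        also have "\<dots> \<le> y ^ 24 * real (nmat (s + 1) A)" using e2 by (intro mult_right_mono) auto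
        finally have "c * y ^ (24 * (s + 2)) \<le> y ^ 24 * real (nmat (s + 1) A)" using that by simp
        also have "c * y ^ (24 * (s + 2)) = y ^ 24 * (c * y ^ (24 * (s + 1)))"
          by (simp flip: power_add)
        finally show ?thesis using y0[of 24] by simp
      qed
      show ?thesis
      proof (cases "L = {}")
        case True
        have "\<kappa> / 2 * y ^ (24 * (s + 1)) \<le> real (nmat (s + 1) E2) - 2 * real (card V) * real (nmat s E2)"
        proof -
          have "2 * real (card V) * real (nmat s E2) \<le> 2 * y ^ 16 * y ^ (24 * s)"
            unfolding n using matE2[of s] y0[of 16] by (intro mult_left_mono) auto
          also have "\<dots> = 2 * y ^ (16 + 24 * s)" by (simp add: power_add)
          also have "\<dots> \<le> \<kappa> / 2 * y ^ (24 * (s + 1))" using I by blast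
          finally show ?thesis using ratio[OF order.refl big] by simp
        qed
        hence "2 * y ^ (14 * (r - 2)) \<le> real (nmat (s + 1) E2) - 2 * real (card V) * real (nmat s E2)"
          using I by linarith
        hence "real (card E1) * (2 * y ^ (14 * (r - 2))) \<le>
           real (card E1) * (real (nmat (s + 1) E2) - 2 * real (card V) * real (nmat s E2))"
          by (intro mult_left_mono) auto
        moreover have "Slow \<le> real (card E1) * (2 * y ^ (14 * (r - 2)))"
        proof -
          have "Slow \<le> (\<Sum>v\<in>V - L. real (d v)) * (y ^ 14) ^ (r - 2)"
            unfolding Slow_def using finV rt(4) by (intro star_sum_linear_le) (auto simp: L_def)
          also have "(\<Sum>v\<in>V - L. real (d v)) = 2 * real (card E1)"
            using handshake[OF g1(1)] True unfolding d_def by (metis Diff_empty of_nat_mult of_nat_numeral of_nat_sum)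
          finally show ?thesis by (simp add: mult.assoc mult.left_commute flip: power_mult)
        qed
        moreover have "Shigh = 0" using True by (simp add: Shigh_def)
        ultimately have "Slow + Shigh + real (nmat t E2) \<le> real (nmat t E)"
          using nmat_recolour[OF G(1,3), of s] unfolding E2_def[symmetric] t by linarith
        thus ?thesis using G suff by blast
      next
        case False
        then obtain v where v: "v \<in> L" by blast
        have W14: "y ^ 14 \<le> real (card W)"
        proof -
          have "y ^ 14 \<le> real (d v)" using v by (simp add: L_def)
          also have "d v \<le> card W" unfolding d_def W_def using v finW
            by (intro card_mono) (auto simp: W_def)
          finally show ?thesis by simp
        qed
        obtain H where H: "sgraph W H" "c4_free H" "43 / 100 * sqrt (card W) ^ 3 \<le> card H"
          "(1 + \<kappa>) * (real (card W) ^ (r - 1) / fact (r - 1)) + 2 * \<kappa> * sqrt (card W) ^ (3 * t) \<le> nmat t H"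
          using w0[OF finW w0y[OF W14]] by blast
        have Hs: "Shigh \<le> real (nmat t H)"
        proof -
          have "0 \<le> 2 * \<kappa> * sqrt (card W) ^ (3 * t)" using kappa by simp
          thus ?thesis using high[OF order.refl W14] H(4) by linarith
        qed
        have Hc: "43 / 100 * y ^ 21 \<le> real (card H)"
        proof -
          have "y ^ 7 \<le> sqrt (card W)" using W14 by (intro real_le_rsqrt) (simp flip: power_mult)
          hence "(y ^ 7) ^ 3 \<le> sqrt (card W) ^ 3" using y0[of 7] by (intro power_mono) auto
          thus ?thesis using H(3) by (simp flip: power_mult)
        qed
        define A where "A = {e \<in> E2. e \<inter> W = {}}"
        have AE: "A \<subseteq> E2" by (auto simp: A_def)
        have lost: "real (nmat (s + 2) E2) \<le> real (nmat (s + 2) A) + 6 * y ^ (20 + 24 * (s + 1))"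
        proof -
          define B where "B = {e \<in> E2. e \<inter> W \<noteq> {}}"
          have BU: "B = (\<Union>v\<in>L. {e \<in> E2. e \<inter> nbr E1 v \<noteq> {}})" unfolding B_def W_def by auto
          have "card B \<le> (\<Sum>v\<in>L. card {e \<in> E2. e \<inter> nbr E1 v \<noteq> {}})"
            unfolding BU by (rule card_UN_le[OF finL])
          also have "\<dots> \<le> (\<Sum>v\<in>L. 2 * card V)"
          proof (intro sum_mono)
            fix v
            have "card {e \<in> E2. e \<inter> nbr E1 v \<noteq> {}} \<le> card {e \<in> E. e \<inter> nbr E1 v \<noteq> {}}"
              using sgraph_finite(2)[OF G(1)] by (intro card_mono) (auto simp: E2_def)
            also have "\<dots> \<le> 2 * card V" by (rule card_edges_meeting_nbr_le[OF G(1,2) nbr_mono[OF G(3)]])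
            finally show "card {e \<in> E2. e \<inter> nbr E1 v \<noteq> {}} \<le> 2 * card V" .
          qed
          also have "\<dots> = card L * (2 * card V)" by simp
          finally have "real (card B) \<le> real (card L * (2 * card V))" by (rule of_nat_mono)
          also have "\<dots> = real (card L) * (2 * y ^ 16)" by (simp add: n)
          also have "\<dots> \<le> (3 * y ^ 4) * (2 * y ^ 16)" using cardL y0[of 16] by (intro mult_right_mono) auto
          also have "\<dots> = 6 * y ^ 20" by (simp flip: power_add)
          finally have cB: "real (card B) \<le> 6 * y ^ 20" .
          have "nmat (Suc (s + 1)) E2 \<le> nmat (Suc (s + 1)) (E2 - B) + card B * nmat (s + 1) E2"
            by (rule nmat_delete) (use sgraph_finite(2)[OF g2(1)] in \<open>auto simp: B_def\<close>)
          hence "real (nmat (Suc (s + 1)) E2) \<le> real (nmat (Suc (s + 1)) (E2 - B) + card B * nmat (s + 1) E2)"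
            by (rule of_nat_mono)
          also have "E2 - B = A" by (auto simp: A_def B_def)
          also have "real (nmat (Suc (s + 1)) A + card B * nmat (s + 1) E2)
             = real (nmat (s + 2) A) + real (card B) * real (nmat (s + 1) E2)" by simp
          also have "real (card B) * real (nmat (s + 1) E2) \<le> (6 * y ^ 20) * y ^ (24 * (s + 1))"
            using cB matE2[of "s + 1"] y0 by (intro mult_mono) auto
          also have "\<dots> = 6 * y ^ (20 + 24 * (s + 1))" by (simp add: power_add)
          finally show ?thesis by simp
        qed
        have I4: "6 * y ^ (20 + 24 * (s + 1)) \<le> \<kappa> / 2 * y ^ (24 * (s + 2))" using I unfolding t by blast
        have "\<kappa> / 2 * y ^ (24 * (s + 2)) \<le> real (nmat (s + 2) A)" using lost big I4 by simp
        from ratio[OF AE this] have "43 / 100 * y ^ 21 * (\<kappa> / 2 * y ^ (24 * (s + 1))) \<le> real (card H) * real (nmat (s + 1) A)"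
          using Hc y0[of "24 * (s + 1)"] kappa by (intro mult_mono mult_nonneg_nonneg) auto
        also have "43 / 100 * y ^ 21 * (\<kappa> / 2 * y ^ (24 * (s + 1))) = 2 * (43 / 400 * \<kappa> * y ^ (21 + 24 * (s + 1)))"
          by (simp add: power_add)
        \<comment> \<open>Mixed matchings pay for the deleted red edges and for the stars at small
          degrees; the stars centred in \<open>L\<close> are paid for by the matchings inside
          \<open>H\<close> alone.\<close>
        finally have gain: "6 * y ^ (20 + 24 * (s + 1)) + 3 * y ^ (32 + 14 * (r - 3)) \<le> real (card H) * real (nmat (s + 1) A)"
          using I by linarith
        note sur = surgery(1,2)[OF g2 WV H(1,2) A_def]
        note sur3 = surgery(3)[OF g2 WV H(1,2) A_def, of s]
        have "real (nmat (s + 2) A + nmat (s + 2) H + card H * nmat (s + 1) A) \<le> real (nmat (s + 2) (A \<union> H))"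
          using sur3 by (rule of_nat_mono)
        hence "Slow + Shigh + real (nmat t E2) \<le> real (nmat t (A \<union> H))"
          using gain lost low Hs unfolding t by simp
        thus ?thesis using sur(1,2) suff by blast
      qed
    qed
  qed
  show ?thesis by (rule exI[of _ N]) (use main in blast)
qed

section \<open>Many stars\<close>

lemma fact_mult_choose_Suc: "fact (Suc k) * (a choose Suc k) = fact k * (a choose k) * (a - k)"
proof -
  have "Suc k * (a choose Suc k) = (a - k) * (a choose k)"
    by (simp only: binomial_absorption binomial_absorb_comp)
  hence "fact k * (Suc k * (a choose Suc k)) = fact k * ((a - k) * (a choose k))" by simp
  thus ?thesis by (simp add: algebra_simps)
qed

lemma power_le_fact_mult_choose:
  assumes "k \<le> a"
  shows "(real a - real k) ^ k \<le> fact k * real (a choose k)"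
proof -
  have "j \<le> k \<Longrightarrow> (real a - real k) ^ j \<le> fact j * real (a choose j)" for j
  proof (induction j)
    case (Suc j)
    have "real (fact (Suc j) * (a choose Suc j)) = real (fact j * (a choose j) * (a - j))"
      by (simp only: fact_mult_choose_Suc)
    hence e: "fact (Suc j) * real (a choose Suc j) = fact j * real (a choose j) * (real a - real j)"
      using Suc.prems assms by (simp add: of_nat_diff del: fact_Suc)
    have "(real a - real k) ^ Suc j = (real a - real k) ^ j * (real a - real k)" by simp
    also have "\<dots> \<le> fact j * real (a choose j) * (real a - real j)"
      using Suc assms by (intro mult_mono) auto
    finally show ?case by (simp only: e)
  qed simp
  thus ?thesis by blast
qed

text \<open>The factor \<open>d (d - 1)\<close> is split off unchanged because
  \<open>sum_deg_mult_le\<close> bounds its sum with the sharp constant.\<close>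

lemma fact_mult_choose_le:
  assumes "k \<ge> 2"
  shows "fact k * real (d choose k) \<le> real d * (real d - 1) * real d ^ (k - 2)"
  using assms
proof (induction k rule: dec_induct)
  case base
  have "fact 2 * real (d choose 2) = real d * (real d - 1)"
    by (simp add: real_choose_two)
  then show ?case by simp
next
  case (step k)
  have "real (fact (Suc k) * (d choose Suc k)) = real (fact k * (d choose k) * (d - k))"
    by (simp only: fact_mult_choose_Suc)
  hence "fact (Suc k) * real (d choose Suc k) = fact k * real (d choose k) * real (d - k)"
    by (simp del: fact_Suc)
  also have "\<dots> \<le> (real d * (real d - 1) * real d ^ (k - 2)) * real d"
    by (rule mult_mono[OF step.IH]) (auto intro: order_trans[OF _ step.IH])
  also have "\<dots> = real d * (real d - 1) * real d ^ (Suc k - 2)"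
  proof -
    have "Suc k - 2 = Suc (k - 2)" using step.hyps by simp
    thus ?thesis by (simp only: power_Suc mult_ac)
  qed
  finally show ?case .
qed

text \<open>Each added element lies in at least \<open>a choose k\<close> new sets of size
  \<open>Suc k\<close>. With \<open>s\<close> missing leaves this counts the stars that a centre
  falls short of.\<close>

lemma choose_add_ge: "(a choose Suc k) + s * (a choose k) \<le> (a + s) choose Suc k"
proof (induction s)
  case (Suc s)
  have "a choose k \<le> (a + s) choose k" by (rule binomial_right_mono) simp
  thus ?case using Suc by simp
qed simp

text \<open>Reads \<open>d (d - 1)\<close> as the weight of a vertex. The total weight is at most
  about n^2, and a unit of weight yields at most B^(r-3) / (r-1)! stars, so the full star count
  requires a vertex of almost full degree.\<close>

lemma star_sum_weighted_le:
  fixes B :: real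
  assumes "finite U" "\<And>v. v \<in> U \<Longrightarrow> real (d v) \<le> B" "r \<ge> 3"
  shows "fact (r - 1) * real (\<Sum>v\<in>U. d v choose (r - 1)) \<le> (\<Sum>v\<in>U. real (d v) * (real (d v) - 1)) * B ^ (r - 3)"
proof -
  have "fact (r - 1) * real (d v choose (r - 1)) \<le> real (d v) * (real (d v) - 1) * B ^ (r - 3)" if v: "v \<in> U" for v
  proof -
    have "fact (r - 1) * real (d v choose (r - 1)) \<le> real (d v) * (real (d v) - 1) * real (d v) ^ (r - 1 - 2)"
      using assms(3) by (intro fact_mult_choose_le) simp
    also have "\<dots> \<le> real (d v) * (real (d v) - 1) * B ^ (r - 1 - 2)"
    proof (intro mult_left_mono power_mono)
      show "0 \<le> real (d v) * (real (d v) - 1)" by (cases "d v") auto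
    qed (use assms(2)[OF v] in auto)
    also have "r - 1 - 2 = r - 3" by simp
    finally show ?thesis .
  qed
  hence "(\<Sum>v\<in>U. fact (r - 1) * real (d v choose (r - 1))) \<le> (\<Sum>v\<in>U. real (d v) * (real (d v) - 1) * B ^ (r - 3))"
    by (rule sum_mono)
  thus ?thesis by (simp add: sum_distrib_left sum_distrib_right)
qed

section \<open>Colourings with an almost spanning blue star\<close>

text \<open>Here \<open>s\<close> counts the vertices outside the blue star at \<open>v\<close>. A
  vertex other than \<open>v\<close> has at most one neighbour among the leaves \<open>N\<close>.
  Its blue neighbours are thus \<open>v\<close>, at most one leaf, and outsiders. The red edges form
  a matching on \<open>N\<close>, a C4-free graph on the outsiders \<open>R\<close>, and at most two
  edges from each outsider to the star.\<close>

lemma near_star_structure: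
  assumes G: "sgraph V E" "c4_free E" "E1 \<subseteq> E" and v: "v \<in> V" and n: "card V = deg E1 v + 1 + s"
  shows "\<And>u. u \<in> V \<Longrightarrow> u \<noteq> v \<Longrightarrow> deg E1 u \<le> s + 2"
    and "2 * real (card (E - E1)) \<le> real (deg E1 v) + 4 * real s + 2 * sqrt (real s) ^ 3"
proof -
  define N R where "N = nbr E1 v" and "R = V - {v} - N"
  have finV: "finite V" using G sgraph_finite by blast
  have g1: "sgraph V E1" using G sgraph_subset by blast
  have NV: "N \<subseteq> V - {v}" unfolding N_def by (rule nbr_subset[OF g1])
  have finN: "finite N" "finite R"
    using finite_subset[OF NV] finV unfolding R_def by auto
  have cR: "card R = s"
    unfolding R_def using NV finV n v finN by (simp add: card_Diff_subset N_def)
  have NE: "N \<subseteq> nbr E v" unfolding N_def by (rule nbr_mono[OF G(3)])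
  have com: "card (N \<inter> nbr E u) \<le> 1" if "u \<noteq> v" for u
  proof -
    have "card (N \<inter> nbr E u) \<le> card (nbr E v \<inter> nbr E u)"
      using NE finite_nbr[OF G(1)] by (intro card_mono) auto
    also have "\<dots> \<le> 1" by (rule c4_free_common[OF G(2,1) that[symmetric]])
    finally show ?thesis .
  qed
  show "deg E1 u \<le> s + 2" if u: "u \<in> V" "u \<noteq> v" for u
  proof -
    have "nbr E1 u \<subseteq> {v} \<union> R \<union> (N \<inter> nbr E u)"
      using nbr_subset[OF g1] nbr_mono[OF G(3), of u] unfolding R_def by blast
    hence "deg E1 u \<le> card ({v} \<union> R \<union> (N \<inter> nbr E u))"
      using finN by (intro card_mono) auto
    also have "\<dots> \<le> card ({v} \<union> R) + card (N \<inter> nbr E u)" by (rule card_Un_le)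
    also have "card ({v} \<union> R) \<le> card {v} + card R" by (rule card_Un_le)
    finally show ?thesis using com[OF u(2)] cR by simp
  qed
  define EN ER EB where "EN = {e \<in> E. e \<subseteq> N}" and "ER = {e \<in> E. e \<subseteq> R}"
    and "EB = (\<Union>x\<in>R. insert {x, v} ((\<lambda>u. {x, u}) ` (N \<inter> nbr E x)))"
  have sub: "E - E1 \<subseteq> EN \<union> ER \<union> EB"
  proof
    fix e assume e: "e \<in> E - E1"
    then obtain p q where pq: "e = {p, q}" "p \<noteq> q" "p \<in> V" "q \<in> V" using sgraph_edge[OF G(1)] by blast
    have notblue: "\<not> (p = v \<and> q \<in> N)" "\<not> (q = v \<and> p \<in> N)"
      using e pq unfolding N_def nbr_def by (auto simp: insert_commute)
    have nb: "q \<in> nbr E p" "p \<in> nbr E q" using e pq by (auto simp: nbr_def insert_commute)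
    have X: "{x, u} \<in> EB" if "x \<in> R" "u = v \<or> u \<in> N \<inter> nbr E x" for x u
      unfolding EB_def using that by blast
    have cases: "x = v \<or> x \<in> N \<or> x \<in> R" if "x \<in> V" for x using that by (auto simp: R_def)
    consider "p \<in> R" "q \<in> R" | "p \<in> R" "q = v \<or> q \<in> N" | "q \<in> R" "p = v \<or> p \<in> N" | "p \<in> N" "q \<in> N"
      using cases[OF pq(3)] cases[OF pq(4)] notblue pq(2) by blast
    thus "e \<in> EN \<union> ER \<union> EB"
    proof cases
      case 1
      thus ?thesis using pq e unfolding ER_def by simp
    next
      case 2
      thus ?thesis using X[of p q] nb pq(1) by simp
    next
      case 3
      thus ?thesis using X[of q p] nb pq(1) by (simp add: insert_commute)
    next
      case 4
      thus ?thesis using pq e unfolding EN_def by simp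
    qed
  qed
  have fin: "finite EN" "finite ER" using sgraph_finite(2)[OF G(1)] by (auto simp: EN_def ER_def)
  have finX: "finite EB" unfolding EB_def using finN by auto
  have cB: "card EB \<le> 2 * s"
  proof -
    have "card EB \<le> (\<Sum>x\<in>R. card (insert {x, v} ((\<lambda>u. {x, u}) ` (N \<inter> nbr E x))))"
      unfolding EB_def by (rule card_UN_le[OF finN(2)])
    also have "\<dots> \<le> (\<Sum>x\<in>R. 2)"
    proof (intro sum_mono)
      fix x assume "x \<in> R"
      hence "x \<noteq> v" by (simp add: R_def)
      have "card (insert {x, v} ((\<lambda>u. {x, u}) ` (N \<inter> nbr E x))) \<le> Suc (card ((\<lambda>u. {x, u}) ` (N \<inter> nbr E x)))"
        by (rule card_insert_le_m1) auto
      also have "\<dots> \<le> Suc (card (N \<inter> nbr E x))" using finN by (simp add: card_image_le)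
      finally show "card (insert {x, v} ((\<lambda>u. {x, u}) ` (N \<inter> nbr E x))) \<le> 2"
        using com[OF \<open>x \<noteq> v\<close>] by simp
    qed
    finally show ?thesis using cR by simp
  qed
  have sN: "sgraph N EN" and sR: "sgraph R ER"
    using G(1) finN unfolding sgraph_def EN_def ER_def by auto
  have cN: "2 * card EN \<le> card N"
  proof -
    have "2 * card EN = (\<Sum>u\<in>N. deg EN u)" using handshake[OF sN] by simp
    also have "\<dots> \<le> (\<Sum>u\<in>N. 1)"
    proof (intro sum_mono)
      fix u assume "u \<in> N"
      hence "u \<noteq> v" using NV by blast
      have "nbr EN u \<subseteq> N \<inter> nbr E u" unfolding EN_def nbr_def by auto
      hence "deg EN u \<le> card (N \<inter> nbr E u)" using finN by (intro card_mono) auto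
      thus "deg EN u \<le> 1" using com[OF \<open>u \<noteq> v\<close>] by linarith
    qed
    finally show ?thesis by simp
  qed
  have cER: "real (card ER) \<le> sqrt (real s) ^ 3"
  proof (rule power2_le_imp_le)
    have "c4_free ER" by (rule c4_free_subset[OF G(2)]) (auto simp: ER_def)
    from c4_free_card_square_le[OF sR this] cR
    have "(real (card ER))\<^sup>2 \<le> real s ^ 3" by simp
    also have "\<dots> = (sqrt (real s) ^ 3)\<^sup>2"
      by (metis of_nat_0_le_iff power_even_eq power_mult_distrib power_commutes mult.commute power_mult real_sqrt_pow2)
    finally show "(real (card ER))\<^sup>2 \<le> (sqrt (real s) ^ 3)\<^sup>2" .
  qed simp
  have "card (E - E1) \<le> card (EN \<union> ER \<union> EB)" using sub fin finX by (intro card_mono) auto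
  also have "\<dots> \<le> card EN + card ER + card EB"
    using card_Un_le[of "EN \<union> ER" EB] card_Un_le[of EN ER] by linarith
  finally have "2 * card (E - E1) \<le> card N + 2 * card ER + 4 * s" using cN cB by linarith
  hence "real (2 * card (E - E1)) \<le> real (card N + 2 * card ER + 4 * s)" by (rule of_nat_mono)
  thus "2 * real (card (E - E1)) \<le> real (deg E1 v) + 4 * real s + 2 * sqrt (real s) ^ 3"
    using cER by (simp add: N_def)
qed

text \<open>With P = s n^(r-2) / (r-2)!, the centre \<open>v\<close> misses at least 0.9 P stars,
  the other centres bring back at most 0.1 P, and the red matchings, bounded by \<open>M\<close>, at
  most 0.7 P.\<close>

lemma near_star_strict:
  assumes G: "sgraph V E" "c4_free E" "E1 \<subseteq> E" and v: "v \<in> V" and n: "card V = deg E1 v + 1 + s"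
    and r: "r \<ge> 4" and s: "1 \<le> s" "real s \<le> card V / (40 * r)" and large: "40 * r\<^sup>2 \<le> card V"
    and M: "M \<le> 7 / 10 * (real s * real (card V) ^ (r - 2) / fact (r - 2))"
  shows "real (\<Sum>u\<in>V. deg E1 u choose (r - 1)) + M < real ((card V - 1) choose (r - 1))"
proof -
  define x where "x = real (card V)"
  \<comment> \<open>Makes (1 - 2 \<epsilon>)^(r-2) at least 0.9 by Bernoulli's inequality and 12
    \<epsilon> at most 0.1; the assumption on \<open>card V\<close> turns into r \<le> \<epsilon>
    x.\<close>
  define \<epsilon> where "\<epsilon> = 1 / (40 * real r)"
  define d where "d u = deg E1 u" for u
  have finV: "finite V" using G sgraph_finite by blast
  have g1: "sgraph V E1" "c4_free E1" using G sgraph_subset c4_free_subset by blast+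
  have eps: "\<epsilon> > 0" "\<epsilon> \<le> 1 / 160" using r by (auto simp: \<epsilon>_def field_simps)
  have sx: "real s \<le> \<epsilon> * x" using s(2) by (simp add: \<epsilon>_def x_def)
  have rx: "real r \<le> \<epsilon> * x"
  proof -
    have "real (40 * r\<^sup>2) \<le> x" unfolding x_def using large by (rule of_nat_mono)
    thus ?thesis using r by (simp add: \<epsilon>_def field_simps power2_eq_square)
  qed
  have x0: "x > 0" using n by (simp add: x_def)
  have dv: "real (d v) = x - 1 - real s" using n by (simp add: d_def x_def)
  define f where "f = (fact (r - 2) :: real)"
  have f0: "f > 0" by (simp add: f_def)
  have fr: "(fact (r - 1) :: real) = (real r - 1) * f"
  proof -
    have "r - 1 = Suc (r - 2)" using r by simp
    hence "(fact (r - 1) :: real) = real (Suc (r - 2)) * f" unfolding f_def by (metis fact_Suc)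
    thus ?thesis using r by (simp add: of_nat_diff)
  qed
  define P where "P = real s * x ^ (r - 2) / f"
  have P0: "P > 0" using s x0 f0 by (simp add: P_def)
  define others where "others = real (\<Sum>u\<in>V - {v}. d u choose (r - 1))"
  have split: "real (\<Sum>u\<in>V. deg E1 u choose (r - 1)) = real (d v choose (r - 1)) + others"
    unfolding others_def d_def using finV v by (subst of_nat_add[symmetric]) (simp only: sum.remove)
  have others: "others \<le> 1 / 10 * P"
  proof -
    have "(\<Sum>u\<in>V. real (d u) * (real (d u) - 1)) \<le> x * (x - 1)"
      unfolding d_def x_def by (rule sum_deg_mult_le[OF g1])
    moreover have "(\<Sum>u\<in>V. real (d u) * (real (d u) - 1))
       = real (d v) * (real (d v) - 1) + (\<Sum>u\<in>V - {v}. real (d u) * (real (d u) - 1))"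
      using finV v by (rule sum.remove)
    \<comment> \<open>The vertex \<open>v\<close> alone takes up the whole available weight except
      for order \<open>s x\<close>.\<close>
    moreover have "x * (x - 1) - real (d v) * (real (d v) - 1) \<le> 4 * real s * x"
    proof -
      have "x * (x - 1) - real (d v) * (real (d v) - 1) = x * (2 * real s + 2) - (real s + 1) * (real s + 2)"
        unfolding dv by (simp add: algebra_simps)
      also have "\<dots> \<le> x * (2 * real s + 2)" by simp
      also have "\<dots> \<le> x * (4 * real s)" using s x0 by (intro mult_left_mono) auto
      finally show ?thesis by (simp add: mult_ac)
    qed
    ultimately have A: "(\<Sum>u\<in>V - {v}. real (d u) * (real (d u) - 1)) \<le> 4 * real s * x" by linarith
    have B: "real (d u) \<le> 3 * \<epsilon> * x" if "u \<in> V - {v}" for u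
    proof -
      have "d u \<le> s + 2" unfolding d_def using near_star_structure(1)[OF G v n] that by blast
      hence "real (d u) \<le> 3 * real s" using s by linarith
      thus ?thesis using sx by linarith
    qed
    have "fact (r - 1) * others \<le> (\<Sum>u\<in>V - {v}. real (d u) * (real (d u) - 1)) * (3 * \<epsilon> * x) ^ (r - 3)"
      unfolding others_def using finV B r by (intro star_sum_weighted_le) auto
    also have "\<dots> \<le> 4 * real s * x * (3 * \<epsilon> * x) ^ (r - 3)"
      using A eps x0 by (intro mult_right_mono) auto
    also have "(3 * \<epsilon> * x) ^ (r - 3) = (3 * \<epsilon>) ^ (r - 3) * x ^ (r - 3)" by (simp add: power_mult_distrib)
    \<comment> \<open>By \<open>r \<ge> 4\<close> at least one small factor is present, which makes
      the other centres negligible against the loss at \<open>v\<close>.\<close>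
    also have "(3 * \<epsilon>) ^ (r - 3) \<le> (3 * \<epsilon>) ^ 1"
      using eps r by (intro power_decreasing) auto
    also have "4 * real s * x * ((3 * \<epsilon>) ^ 1 * x ^ (r - 3)) = 12 * \<epsilon> * (real s * x ^ (r - 2))"
    proof -
      have "r - 2 = Suc (r - 3)" using r by simp
      thus ?thesis by simp
    qed
    also have "real s * x ^ (r - 2) = P * f" using f0 by (simp add: P_def)
    finally have "(real r - 1) * f * others \<le> 12 * \<epsilon> * (P * f)"
      unfolding fr using x0 by (simp add: mult_left_mono mult_right_mono)
    hence "f * ((real r - 1) * others) \<le> f * (12 * \<epsilon> * P)" by (simp add: mult_ac)
    hence le: "(real r - 1) * others \<le> 12 * \<epsilon> * P" using f0 by simp
    have "others \<ge> 0" unfolding others_def by (rule of_nat_0_le_iff)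
    hence "others \<le> (real r - 1) * others" using r mult_right_mono[of 1 "real r - 1" others] by simp
    also have "\<dots> \<le> 12 * \<epsilon> * P" by (rule le)
    also have "\<dots> \<le> 1 / 10 * P" using eps P0 by (intro mult_right_mono) auto
    finally show ?thesis .
  qed
  have loss: "real (d v choose (r - 1)) + 9 / 10 * P \<le> real ((card V - 1) choose (r - 1))"
  proof -
    have r1: "r - 1 = Suc (r - 2)" using r by simp
    have "(d v choose Suc (r - 2)) + s * (d v choose (r - 2)) \<le> (d v + s) choose Suc (r - 2)" by (rule choose_add_ge)
    also have "d v + s = card V - 1" using n by (simp add: d_def)
    finally have "real ((d v choose (r - 1)) + s * (d v choose (r - 2))) \<le> real ((card V - 1) choose (r - 1))"
      unfolding r1 by (rule of_nat_mono)
    moreover have "9 / 10 * P \<le> real s * real (d v choose (r - 2))"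
    proof -
      have dr: "real (d v) - real (r - 2) \<ge> (1 - 2 * \<epsilon>) * x"
        using sx rx r unfolding dv by (simp add: algebra_simps)
      have pos: "(1 - 2 * \<epsilon>) * x \<ge> 0" using eps x0 by simp
      hence "r - 2 \<le> d v" using dr by linarith
      have "9 / 10 * x ^ (r - 2) \<le> (1 - 2 * \<epsilon>) ^ (r - 2) * x ^ (r - 2)"
      proof (intro mult_right_mono)
        have "9 / 10 \<le> 1 + real (r - 2) * (- (2 * \<epsilon>))" using r by (simp add: \<epsilon>_def field_simps)
        also have "\<dots> \<le> (1 + - (2 * \<epsilon>)) ^ (r - 2)" using eps by (intro Bernoulli_inequality) auto
        finally show "9 / 10 \<le> (1 - 2 * \<epsilon>) ^ (r - 2)" by simp
      qed (use x0 in auto)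
      also have "\<dots> = ((1 - 2 * \<epsilon>) * x) ^ (r - 2)" by (simp add: power_mult_distrib)
      also have "\<dots> \<le> (real (d v) - real (r - 2)) ^ (r - 2)" using dr pos by (intro power_mono)
      also have "\<dots> \<le> f * real (d v choose (r - 2))"
        unfolding f_def by (rule power_le_fact_mult_choose[OF \<open>r - 2 \<le> d v\<close>])
      finally have "real s * (9 / 10 * x ^ (r - 2)) \<le> real s * (f * real (d v choose (r - 2)))"
        by (intro mult_left_mono) auto
      thus ?thesis using f0 by (simp add: P_def field_simps)
    qed
    ultimately show ?thesis by simp
  qed
  have "M \<le> 7 / 10 * P" using M by (simp add: P_def x_def f_def)
  thus ?thesis using split others loss P0 by linarith
qed

text \<open>The term with \<open>K\<close> stands for any error smaller than n^(r-1) by a factor of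
  order sqrt n; such errors cannot make up for a fixed proportion of missing stars.\<close>

lemma spanning_star_dominates:
  fixes K \<epsilon> :: real
  assumes "\<epsilon> > 0" "r \<ge> 4"
  shows "eventually (\<lambda>n. (1 - \<epsilon>) * (real n ^ (r - 1) / fact (r - 1)) + K * sqrt n ^ (2 * r - 3)
     < real ((n - 1) choose (r - 1))) sequentially"
proof -
  define f where "f = (fact (r - 1) :: real)"
  have f0: "f > 0" by (simp add: f_def)
  have "((\<lambda>n. (1 - \<epsilon>) + K * f * (1 / sqrt (real n))) \<longlongrightarrow> (1 - \<epsilon>) + K * f * 0) sequentially"
    by (intro tendsto_intros) real_asymp
  hence L: "eventually (\<lambda>n. (1 - \<epsilon>) + K * f * (1 / sqrt (real n)) < 1 - \<epsilon> / 2) sequentially"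
    by (rule order_tendstoD(2)) (use assms in simp)
  have "((\<lambda>n. (1 - real r * (1 / real n)) ^ (r - 1)) \<longlongrightarrow> (1 - real r * 0) ^ (r - 1)) sequentially"
    by (intro tendsto_intros)
  hence R: "eventually (\<lambda>n. 1 - \<epsilon> / 2 < (1 - real r * (1 / real n)) ^ (r - 1)) sequentially"
    by (rule order_tendstoD(1)) (use assms in simp)
  show ?thesis
    using L R eventually_ge_at_top[of "2 * r"]
  proof eventually_elim
    case (elim n)
    have n0: "real n > 0" using elim assms by simp
    have z0: "sqrt n > 0" using n0 by simp
    have nz: "real n ^ (r - 1) = sqrt n ^ (2 * r - 3) * sqrt n"
    proof -
      have "2 * (r - 1) = Suc (2 * r - 3)" using assms(2) by simp
      hence "sqrt n ^ (2 * (r - 1)) = sqrt n ^ (2 * r - 3) * sqrt n" by (simp only: power_Suc mult.commute)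
      thus ?thesis by (simp add: power_mult)
    qed
    have "(1 - \<epsilon>) * real n ^ (r - 1) + K * f * sqrt n ^ (2 * r - 3)
       = real n ^ (r - 1) * ((1 - \<epsilon>) + K * f * (1 / sqrt (real n)))"
      unfolding nz using z0 by (simp add: field_simps)
    also have "\<dots> < real n ^ (r - 1) * (1 - real r * (1 / real n)) ^ (r - 1)"
      using elim n0 by (intro mult_strict_left_mono) auto
    also have "\<dots> = (real n * (1 - real r * (1 / real n))) ^ (r - 1)" by (simp add: power_mult_distrib)
    also have "real n * (1 - real r * (1 / real n)) = real (n - 1) - real (r - 1)"
      using n0 elim assms(2) by (simp add: field_simps of_nat_diff)
    also have "(real (n - 1) - real (r - 1)) ^ (r - 1) \<le> f * real ((n - 1) choose (r - 1))"
      unfolding f_def by (rule power_le_fact_mult_choose) (use elim in simp)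
    finally have "(1 - \<epsilon>) * real n ^ (r - 1) + K * f * sqrt n ^ (2 * r - 3) < f * real ((n - 1) choose (r - 1))" .
    moreover have "f * ((1 - \<epsilon>) * (real n ^ (r - 1) / f) + K * sqrt n ^ (2 * r - 3))
        = (1 - \<epsilon>) * real n ^ (r - 1) + K * f * sqrt n ^ (2 * r - 3)"
      using f0 by (simp add: distrib_left)
    ultimately have "f * ((1 - \<epsilon>) * (real n ^ (r - 1) / f) + K * sqrt n ^ (2 * r - 3)) < f * real ((n - 1) choose (r - 1))"
      by simp
    thus ?case using f0 by (simp add: f_def)
  qed
qed

section \<open>Colourings without an almost spanning blue star\<close>

lemma card_le_sqrt_cube:
  assumes "sgraph V E" "c4_free E"
  shows "real (card E) \<le> sqrt (card V) ^ 3"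
proof (rule power2_le_imp_le)
  have "(real (card E))\<^sup>2 \<le> real (card V) ^ 3" by (rule c4_free_card_square_le[OF assms])
  also have "real (card V) ^ 3 = (sqrt (card V) ^ 3)\<^sup>2"
  proof -
    have "(sqrt (card V) ^ 3)\<^sup>2 = ((sqrt (card V))\<^sup>2) ^ 3" by (simp only: power_mult[symmetric] mult.commute)
    thus ?thesis by simp
  qed
  finally show "(real (card E))\<^sup>2 \<le> (sqrt (card V) ^ 3)\<^sup>2" .
qed simp

text \<open>Bounded degrees cost the factor (1 - \<epsilon>)^(r-3), at most 1 - \<epsilon>, in the
  weighted star bound. Since 3 t \<le> 2 r - 3, the red matchings have order at most n^((2r-3)/2)
  and count as an error term.\<close>

lemma large_star_needed:
  fixes \<epsilon> :: real
  assumes "r \<ge> 4" "3 * t < 2 * (r - 1)" "\<epsilon> > 0" "\<epsilon> \<le> 1"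
  shows "\<exists>N. \<forall>(V :: 'a set) E E1. N \<le> card V \<longrightarrow> sgraph V E \<longrightarrow> c4_free E \<longrightarrow> E1 \<subseteq> E \<longrightarrow>
     (\<forall>v\<in>V. real (deg E1 v) < (1 - \<epsilon>) * real (card V)) \<longrightarrow>
     real (\<Sum>v\<in>V. deg E1 v choose (r - 1)) + real (nmat t (E - E1)) < real ((card V - 1) choose (r - 1))"
proof -
  obtain N where N: "\<And>n. n \<ge> N \<Longrightarrow> (1 - \<epsilon>) * (real n ^ (r - 1) / fact (r - 1)) + 1 * sqrt n ^ (2 * r - 3)
     < real ((n - 1) choose (r - 1))"
    using spanning_star_dominates[OF assms(3,1), of 1] unfolding eventually_sequentially by blast
  have "real (\<Sum>v\<in>V. deg E1 v choose (r - 1)) + real (nmat t (E - E1)) < real ((card V - 1) choose (r - 1))"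
    if c: "max N 1 \<le> card V" and G: "sgraph V E" "c4_free E" "E1 \<subseteq> E"
      and D: "\<forall>v\<in>V. real (deg E1 v) < (1 - \<epsilon>) * real (card V)" for V :: "'a set" and E E1
  proof -
    define x where "x = real (card V)"
    have x1: "x \<ge> 1" using c by (simp add: x_def)
    have finV: "finite V" using G sgraph_finite by blast
    have g1: "sgraph V E1" "c4_free E1" and g2: "sgraph V (E - E1)" "c4_free (E - E1)"
      using sgraph_subset[OF G(1)] c4_free_subset[OF G(2)] G(3) by auto
    have "fact (r - 1) * real (\<Sum>v\<in>V. deg E1 v choose (r - 1))
        \<le> (\<Sum>v\<in>V. real (deg E1 v) * (real (deg E1 v) - 1)) * ((1 - \<epsilon>) * x) ^ (r - 3)"
      using finV D assms(1) by (intro star_sum_weighted_le) (auto simp: x_def intro: less_imp_le)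
    also have "\<dots> \<le> (x * x) * ((1 - \<epsilon>) * x) ^ (r - 3)"
    proof (intro mult_right_mono)
      show "(\<Sum>v\<in>V. real (deg E1 v) * (real (deg E1 v) - 1)) \<le> x * x"
        using sum_deg_mult_le[OF g1] x1 by (simp add: x_def right_diff_distrib)
    qed (use assms x1 in auto)
    also have "((1 - \<epsilon>) * x) ^ (r - 3) = (1 - \<epsilon>) ^ (r - 3) * x ^ (r - 3)" by (simp add: power_mult_distrib)
    also have "(x * x) * ((1 - \<epsilon>) ^ (r - 3) * x ^ (r - 3)) = (1 - \<epsilon>) ^ (r - 3) * x ^ (r - 1)"
    proof -
      have "r - 1 = Suc (Suc (r - 3))" using assms by simp
      thus ?thesis by simp
    qed
    also have "\<dots> \<le> (1 - \<epsilon>) ^ 1 * x ^ (r - 1)"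
      using assms x1 by (intro mult_right_mono power_decreasing) auto
    finally have S: "real (\<Sum>v\<in>V. deg E1 v choose (r - 1)) \<le> (1 - \<epsilon>) * (x ^ (r - 1) / fact (r - 1))"
      by (simp add: field_simps)
    have "real (nmat t (E - E1)) \<le> real (card (E - E1) ^ t)"
      by (rule of_nat_mono[OF nmat_le_power[OF sgraph_finite(2)[OF g2(1)]]])
    also have "\<dots> = real (card (E - E1)) ^ t" by simp
    also have "\<dots> \<le> (sqrt x ^ 3) ^ t"
      unfolding x_def by (intro power_mono card_le_sqrt_cube[OF g2]) auto
    also have "\<dots> = sqrt x ^ (3 * t)" by (simp add: power_mult)
    also have "\<dots> \<le> sqrt x ^ (2 * r - 3)" using assms x1 by (intro power_increasing) auto
    finally have "real (nmat t (E - E1)) \<le> sqrt x ^ (2 * r - 3)" .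
    thus ?thesis using S N[of "card V"] c unfolding x_def by simp
  qed
  thus ?thesis by (intro exI[of _ "max N 1"]) blast
qed

text \<open>Stars and matchings both have order x^3, so constants decide. At vertices of degree
  below x / 8, a unit of weight \<open>d (d - 1)\<close> yields at most x / 48 stars, and, as 4 e^2
  is about x times the weight there, at most x / 8 matchings. Together this is 7/8 of the x / 6
  stars possible at a vertex of full degree, and \<epsilon> \<le> 1/8 gives 7/8 \<le> 1 -
  \<epsilon>.\<close>

lemma large_star_needed_4_2:
  fixes \<epsilon> :: real
  assumes "\<epsilon> > 0" "\<epsilon> \<le> 1 / 8"
  shows "\<exists>N. \<forall>(V :: 'a set) E E1. N \<le> card V \<longrightarrow> sgraph V E \<longrightarrow> c4_free E \<longrightarrow> E1 \<subseteq> E \<longrightarrow>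
     (\<forall>v\<in>V. real (deg E1 v) < (1 - \<epsilon>) * real (card V)) \<longrightarrow>
     real (\<Sum>v\<in>V. deg E1 v choose (4 - 1)) + real (nmat 2 (E - E1)) < real ((card V - 1) choose (4 - 1))"
proof -
  obtain N where N: "\<And>n. n \<ge> N \<Longrightarrow> (1 - \<epsilon>) * (real n ^ (4 - 1) / fact (4 - 1)) + 4705 * sqrt n ^ (2 * 4 - 3)
     < real ((n - 1) choose (4 - 1))"
    using spanning_star_dominates[OF assms(1), of 4 4705] unfolding eventually_sequentially by auto
  have "real (\<Sum>v\<in>V. deg E1 v choose (4 - 1)) + real (nmat 2 (E - E1)) < real ((card V - 1) choose (4 - 1))"
    if c: "max N 1 \<le> card V" and G: "sgraph V E" "c4_free E" "E1 \<subseteq> E"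
      and D: "\<forall>v\<in>V. real (deg E1 v) < (1 - \<epsilon>) * real (card V)" for V :: "'a set" and E E1
  proof -
    define z where "z = sqrt (card V)"
    define x where "x = real (card V)"
    have xz: "x = z ^ 2" by (simp add: x_def z_def)
    have z1: "z \<ge> 1" "x \<ge> 1" using c by (auto simp: z_def x_def)
    have finV: "finite V" using G sgraph_finite by blast
    have g2: "sgraph V (E - E1)" "c4_free (E - E1)"
      using sgraph_subset[OF G(1)] c4_free_subset[OF G(2)] by auto
    define D where "D v = real (deg E v)" for v
    \<comment> \<open>vertices in \<open>H\<close> can carry many stars but few edges, the others the reverse; they compete for the
        same \<open>x^2 / 2\<close> pairs\<close>
    define H where "H = {v \<in> V. x / 8 \<le> D v}"
    define Ph Pl where "Ph = (\<Sum>v\<in>H. D v * (D v - 1))" and "Pl = (\<Sum>v\<in>V - H. D v * (D v - 1))"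
    define e where "e = real (card E)"
    have HV: "H \<subseteq> V" "finite H" using finV by (auto simp: H_def)
    have e3: "e \<le> z ^ 3" unfolding e_def z_def by (rule card_le_sqrt_cube[OF G(1,2)])
    have e0: "e \<ge> 0" by (simp add: e_def)
    have split: "(\<Sum>v\<in>V. f v) = (\<Sum>v\<in>V - H. f v) + (\<Sum>v\<in>H. f v)" for f :: "'a \<Rightarrow> real"
      by (rule sum.subset_diff[OF HV(1) finV])
    have PP: "Ph + Pl \<le> x * x"
    proof -
      have "(\<Sum>v\<in>V. D v * (D v - 1)) \<le> x * (x - 1)" unfolding D_def x_def by (rule sum_deg_mult_le[OF G(1,2)])
      also have "\<dots> \<le> x * x" using z1 by (intro mult_left_mono) auto
      finally show ?thesis using split[of "\<lambda>v. D v * (D v - 1)"] by (simp add: Ph_def Pl_def)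
    qed
    have Dnn: "D v * (D v - 1) \<ge> 0" for v unfolding D_def by (cases "deg E v") auto
    have Ppos: "Ph \<ge> 0" "Pl \<ge> 0" unfolding Ph_def Pl_def by (auto intro: sum_nonneg Dnn)
    have sumD: "(\<Sum>v\<in>V. D v) = 2 * e"
      unfolding D_def e_def using handshake[OF G(1)] by (metis of_nat_mult of_nat_numeral of_nat_sum)
    have star: "6 * real (\<Sum>v\<in>V. deg E1 v choose 3) \<le> (1 - \<epsilon>) * x * Ph + x / 8 * Pl"
    proof -
      have one: "6 * real (deg E1 v choose 3) \<le> D v * (D v - 1) * B" if v: "real (deg E1 v) \<le> B" for v B
      proof -
        have "fact 3 * real (deg E1 v choose 3) \<le> real (deg E1 v) * (real (deg E1 v) - 1) * real (deg E1 v) ^ (3 - 2)"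
          by (rule fact_mult_choose_le) simp
        hence "6 * real (deg E1 v choose 3) \<le> real (deg E1 v) * (real (deg E1 v) - 1) * real (deg E1 v)"
          by (simp add: fact_numeral)
        also have "\<dots> \<le> D v * (D v - 1) * B"
        proof (rule mult_mono)
          have le: "real (deg E1 v) \<le> D v" unfolding D_def using deg_mono[OF G(3,1)] by simp
          show "real (deg E1 v) * (real (deg E1 v) - 1) \<le> D v * (D v - 1)"
          proof (cases "deg E1 v = 0")
            case False
            thus ?thesis using le by (intro mult_mono) auto
          qed (use Dnn in simp)
        qed (use v Dnn in auto)
        finally show ?thesis .
      qed
      have "6 * real (\<Sum>v\<in>V. deg E1 v choose 3) = (\<Sum>v\<in>V. 6 * real (deg E1 v choose 3))"
        by (simp add: sum_distrib_left)
      also have "\<dots> = (\<Sum>v\<in>V - H. 6 * real (deg E1 v choose 3)) + (\<Sum>v\<in>H. 6 * real (deg E1 v choose 3))"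
        by (rule split)
      also have "\<dots> \<le> (\<Sum>v\<in>V - H. D v * (D v - 1) * (x / 8)) + (\<Sum>v\<in>H. D v * (D v - 1) * ((1 - \<epsilon>) * x))"
      proof (intro add_mono sum_mono one)
        fix v assume "v \<in> V - H"
        hence "D v \<le> x / 8" by (auto simp: H_def)
        moreover have "real (deg E1 v) \<le> D v" unfolding D_def using deg_mono[OF G(3,1)] by simp
        ultimately show "real (deg E1 v) \<le> x / 8" by linarith
      next
        fix v assume "v \<in> H"
        thus "real (deg E1 v) \<le> (1 - \<epsilon>) * x" using \<open>\<forall>v\<in>V. real (deg E1 v) < (1 - \<epsilon>) * real (card V)\<close> HV
          by (auto simp: x_def intro: less_imp_le)
      qed
      finally show ?thesis unfolding Ph_def Pl_def by (simp add: sum_distrib_left mult_ac)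
    qed
    have sq: "(\<Sum>v\<in>V. (D v)\<^sup>2) \<le> 3 * x\<^sup>2"
    proof -
      have "(\<Sum>v\<in>V. (D v)\<^sup>2) = (\<Sum>v\<in>V. D v * (D v - 1)) + 2 * e"
        unfolding D_def e_def using sum_deg_square_eq[OF G(1)] by simp
      also have "\<dots> \<le> x * x + 2 * z ^ 3" using PP e3 split[of "\<lambda>v. D v * (D v - 1)"] by (simp add: Ph_def Pl_def)
      also have "z ^ 3 \<le> z ^ 4" using z1 by (intro power_increasing) auto
      also have "z ^ 4 = x * x" by (simp add: xz flip: power_add)
      finally show ?thesis by (simp add: power2_eq_square)
    qed
    have cH: "real (card H) \<le> 192"
    proof -
      have "real (card H) * (x / 8)\<^sup>2 \<le> (\<Sum>v\<in>H. (D v)\<^sup>2)"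
        by (rule sum_bounded_below) (use z1 in \<open>auto simp: H_def intro!: power_mono\<close>)
      also have "\<dots> \<le> (\<Sum>v\<in>V. (D v)\<^sup>2)" using HV finV by (intro sum_mono2) auto
      also note sq
      finally have "real (card H) * x\<^sup>2 \<le> 192 * x\<^sup>2" by (simp add: power_divide)
      thus ?thesis using z1 by simp
    qed
    define a b where "a = (\<Sum>v\<in>V - H. D v)" and "b = (\<Sum>v\<in>H. D v)"
    have ab: "2 * e = a + b" using sumD split[of D] by (simp add: a_def b_def)
    have ab0: "a \<ge> 0" "b \<ge> 0" unfolding a_def b_def by (auto intro: sum_nonneg simp: D_def)
    have b: "b \<le> 192 * z ^ 2"
    proof -
      have "b \<le> real (card H) * x" unfolding b_def
        by (rule sum_bounded_above) (use deg_le_card[OF G(1)] in \<open>auto simp: D_def x_def\<close>)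
      also have "\<dots> \<le> 192 * x" using cH z1 by (intro mult_right_mono) auto
      finally show ?thesis by (simp add: xz)
    qed
    have a2: "a\<^sup>2 \<le> x * Pl + 2 * z ^ 5"
    proof -
      have "a\<^sup>2 \<le> real (card (V - H)) * (\<Sum>v\<in>V - H. (D v)\<^sup>2)"
        unfolding a_def by (rule sum_squared_le_card_mult)
      also have "\<dots> \<le> x * (\<Sum>v\<in>V - H. (D v)\<^sup>2)"
        using finV by (intro mult_right_mono sum_nonneg) (auto simp: x_def card_mono)
      also have "(\<Sum>v\<in>V - H. (D v)\<^sup>2) = Pl + a"
        unfolding Pl_def a_def by (simp add: power2_eq_square right_diff_distrib sum_subtractf)
      also have "x * (Pl + a) \<le> x * (Pl + 2 * z ^ 3)"
        using ab ab0 e3 z1 by (intro mult_left_mono) auto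
      also have "\<dots> = x * Pl + 2 * z ^ 5" by (simp add: xz algebra_simps flip: power_add)
      finally show ?thesis .
    qed
    \<comment> \<open>The at most 192 vertices of \<open>H\<close> carry only O(x) edges, so they
      matter only in the error: 37634 = 2 + 2 * 384 + 36864. An eighth of it, rounded up, is the
      4705.\<close>
    have e2: "4 * e\<^sup>2 \<le> x * Pl + 37634 * z ^ 5"
    proof -
      have "4 * e\<^sup>2 = (a + b)\<^sup>2" by (simp flip: ab add: power2_eq_square)
      also have "\<dots> = a\<^sup>2 + 2 * (a * b) + b\<^sup>2" by (simp add: power2_sum)
      also have "a * b \<le> (2 * z ^ 3) * (192 * z ^ 2)" using ab ab0 e3 b z1 by (intro mult_mono) auto
      also have "(2 * z ^ 3) * (192 * z ^ 2) = 384 * z ^ 5" by (simp flip: power_add)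
      also have "b\<^sup>2 \<le> (192 * z ^ 2)\<^sup>2" using b ab0 by (intro power_mono)
      also have "(192 * z ^ 2)\<^sup>2 = 36864 * z ^ 4" by (simp add: power_mult_distrib flip: power_mult)
      also have "z ^ 4 \<le> z ^ 5" using z1 by (intro power_increasing) auto
      finally show ?thesis using a2 by simp
    qed
    have M: "real (nmat 2 (E - E1)) \<le> x * Pl / 8 + 4705 * z ^ 5"
    proof -
      have "nmat 2 (E - E1) \<le> nmat 2 E" by (rule nmat_mono[OF sgraph_finite(2)[OF G(1)]]) auto
      also have "\<dots> \<le> card E choose 2" by (rule nmat_le_choose[OF sgraph_finite(2)[OF G(1)]])
      finally have "real (nmat 2 (E - E1)) \<le> real (card E choose 2)" by (rule of_nat_mono)
      also have "\<dots> \<le> e\<^sup>2 / 2" using e0 by (simp add: real_choose_two e_def power2_eq_square right_diff_distrib)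
      also have "\<dots> \<le> x * Pl / 8 + 4705 * z ^ 5"
      proof -
        have "z ^ 5 \<ge> 0" using z1 by simp
        thus ?thesis using e2 by linarith
      qed
      finally show ?thesis .
    qed
    have comb: "((1 - \<epsilon>) * x * Ph + x / 8 * Pl) / 6 + x * Pl / 8 \<le> (1 - \<epsilon>) * (x ^ 3 / 6)"
    proof -
      have "x / 8 * Pl / 6 + x * Pl / 8 = (7 / 8) * (x * Pl) / 6" by simp
      also have "\<dots> \<le> (1 - \<epsilon>) * (x * Pl) / 6" using assms(2) z1 Ppos by (intro divide_right_mono mult_right_mono) auto
      finally have "((1 - \<epsilon>) * x * Ph + x / 8 * Pl) / 6 + x * Pl / 8 \<le> (1 - \<epsilon>) * x / 6 * (Ph + Pl)"
        by (simp add: field_simps)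
      also have "\<dots> \<le> (1 - \<epsilon>) * x / 6 * (x * x)" using PP assms(2) z1 by (intro mult_left_mono) auto
      finally show ?thesis by (simp add: power3_eq_cube)
    qed
    have "real (\<Sum>v\<in>V. deg E1 v choose 3) + real (nmat 2 (E - E1)) \<le> (1 - \<epsilon>) * (x ^ 3 / 6) + 4705 * z ^ 5"
    proof -
      have "S + m \<le> T + W" if "6 * S \<le> U" "m \<le> Q + W" "U / 6 + Q \<le> T" for S m T U Q W :: real
        using that by linarith
      from this[OF star M comb] show ?thesis .
    qed
    also have "\<dots> < real ((card V - 1) choose 3)"
      using N[of "card V"] c by (simp add: x_def z_def fact_numeral)
    finally show ?thesis by simp
  qed
  thus ?thesis by (intro exI[of _ "max N 1"]) blast
qed

text \<open>The red edges have order n + s^(3/2). In the t-th power, s^(3t/2) = s * s^((3t-2)/2) is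
  at most s n^((2r-5)/2), and n^t is at most n^((2r-5)/2) as well. Compared with s n^(r-2) a factor
  sqrt n is to spare, which swallows the constant \<open>C\<close>.\<close>

lemma near_star_red_small:
  assumes "r \<ge> 4" "3 * t < 2 * (r - 1)" "t \<ge> 1"
  shows "\<exists>N. \<forall>n\<ge>N. \<forall>e2 s. 1 \<le> s \<longrightarrow> s \<le> n \<longrightarrow> 2 * real e2 \<le> real n + 4 * real s + 2 * sqrt (real s) ^ 3 \<longrightarrow>
     real (e2 choose t) \<le> 7 / 10 * (real s * real n ^ (r - 2) / fact (r - 2))"
proof -
  define C :: real where "C = (6 ^ t + 2 ^ t) * fact (r - 2) * 10 / 7"
  have "filterlim (\<lambda>n. sqrt (real n)) at_top sequentially" by real_asymp
  hence "eventually (\<lambda>n. C \<le> sqrt (real n)) sequentially" by (simp add: filterlim_at_top)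
  then obtain N where N: "\<And>n. n \<ge> N \<Longrightarrow> C \<le> sqrt (real n)" unfolding eventually_sequentially by blast
  have "real (e2 choose t) \<le> 7 / 10 * (real s * real n ^ (r - 2) / fact (r - 2))"
    if n: "n \<ge> N" and s: "1 \<le> s" "s \<le> n" and e: "2 * real e2 \<le> real n + 4 * real s + 2 * sqrt (real s) ^ 3" for n e2 s
  proof -
    define z q where "z = sqrt (real n)" and "q = sqrt (real s)"
    have zn: "real n = z ^ 2" and qs: "real s = q ^ 2" by (auto simp: z_def q_def)
    have q1: "q \<ge> 1" using s by (simp add: q_def)
    have qz: "q \<le> z" using s by (simp add: q_def z_def)
    have z1: "z \<ge> 1" using q1 qz by linarith
    have "real s \<le> real n" using s by simp
    hence e': "real e2 \<le> 3 * z ^ 2 + q ^ 3" using e unfolding zn q_def[symmetric] by linarith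
    have tr: "2 * t \<le> 2 * r - 5" "3 * t - 2 \<le> 2 * r - 5" "3 * t = 2 + (3 * t - 2)"
      using assms by arith+
    have "real (e2 choose t) \<le> real (e2 ^ t)" by (rule of_nat_mono[OF choose_le_power])
    also have "\<dots> = real e2 ^ t" by simp
    also have "\<dots> \<le> (6 * z ^ 2) ^ t + (2 * q ^ 3) ^ t"
    proof (cases "q ^ 3 \<le> 3 * z ^ 2")
      case True
      hence "real e2 ^ t \<le> (6 * z ^ 2) ^ t" using e' by (intro power_mono) auto
      moreover have "0 \<le> (2 * q ^ 3) ^ t" using q1 by simp
      ultimately show ?thesis by linarith
    next
      case False
      hence "real e2 ^ t \<le> (2 * q ^ 3) ^ t" using e' by (intro power_mono) auto
      moreover have "0 \<le> (6 * z ^ 2) ^ t" using z1 by simp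
      ultimately show ?thesis by linarith
    qed
    also have "(6 * z ^ 2) ^ t = 6 ^ t * z ^ (2 * t)" by (simp add: power_mult_distrib flip: power_mult)
    also have "z ^ (2 * t) \<le> z ^ (2 * r - 5)" using z1 tr by (intro power_increasing) auto
    also have "z ^ (2 * r - 5) \<le> real s * z ^ (2 * r - 5)" using s z1 mult_right_mono[of 1 "real s" "z ^ (2 * r - 5)"] by simp
    also have "(2 * q ^ 3) ^ t = 2 ^ t * q ^ (3 * t)" by (simp add: power_mult_distrib flip: power_mult)
    also have "q ^ (3 * t) = q ^ (2 + (3 * t - 2))" using tr(3) by simp
    also have "\<dots> = real s * q ^ (3 * t - 2)" by (simp only: power_add qs)
    also have "q ^ (3 * t - 2) \<le> z ^ (3 * t - 2)" using q1 qz by (intro power_mono) auto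
    also have "z ^ (3 * t - 2) \<le> z ^ (2 * r - 5)" using z1 tr by (intro power_increasing) auto
    finally have "real (e2 choose t) \<le> (6 ^ t + 2 ^ t) * (real s * z ^ (2 * r - 5))"
      using s by (simp add: algebra_simps mult_left_mono)
    also have "6 ^ t + 2 ^ t = C * (7 / 10) / fact (r - 2)" by (simp add: C_def)
    also have "C * (7 / 10) / fact (r - 2) * (real s * z ^ (2 * r - 5))
       \<le> z * (7 / 10) / fact (r - 2) * (real s * z ^ (2 * r - 5))"
      using N[OF n] z1 by (intro mult_right_mono divide_right_mono) (auto simp: z_def)
    also have "\<dots> = 7 / 10 * (real s * z ^ Suc (2 * r - 5) / fact (r - 2))" by simp
    also have "Suc (2 * r - 5) = 2 * (r - 2)" using assms by arith
    also have "z ^ (2 * (r - 2)) = real n ^ (r - 2)" by (simp add: zn power_mult)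
    finally show ?thesis .
  qed
  thus ?thesis by blast
qed

text \<open>No factor sqrt n is to spare here, but \<open>s\<close> is a small fraction of
  \<open>n\<close>: half the square of the number of red edges is at most (1/4 + 9/160^2) s n^2,
  against 7/20 s n^2 on the right. The 160 is \<open>40 * r\<close> for
  \<open>r = 4\<close>.\<close>

lemma near_star_red_small_4_2:
  assumes "1 \<le> s" "real s \<le> real n / 160" "2 * real e2 \<le> real n + 4 * real s + 2 * sqrt (real s) ^ 3"
  shows "real (e2 choose 2) \<le> 7 / 10 * (real s * real n ^ (4 - 2) / fact (4 - 2))"
proof -
  define q where "q = sqrt (real s)"
  have qs: "real s = q ^ 2" by (auto simp: q_def)
  have q1: "q \<ge> 1" using assms by (simp add: q_def)
  have "q ^ 2 \<le> q ^ 3" using q1 by (intro power_increasing) auto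
  moreover have "2 * real e2 \<le> real n + 4 * q ^ 2 + 2 * q ^ 3" using assms(3) by (simp add: q_def)
  ultimately have e: "real e2 \<le> real n / 2 + 3 * q ^ 3" by linarith
  have "real (e2 choose 2) \<le> (real e2)\<^sup>2 / 2" by (simp add: real_choose_two power2_eq_square right_diff_distrib)
  also have "(real e2)\<^sup>2 \<le> (real n / 2 + 3 * q ^ 3)\<^sup>2" using e by (intro power_mono) auto
  also have "\<dots> \<le> 2 * (real n / 2)\<^sup>2 + 2 * (3 * q ^ 3)\<^sup>2"
    using sum_squares_bound[of "real n / 2" "3 * q ^ 3"] by (simp add: power2_sum)
  also have "\<dots> = (real n)\<^sup>2 / 2 + 18 * real s ^ 3"
    unfolding qs by (simp add: power_mult_distrib power_divide flip: power_mult)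
  also have "real s ^ 3 \<le> real s * (real n / 160)\<^sup>2"
  proof -
    have "real s ^ 3 = real s * (real s)\<^sup>2" by (simp add: power2_eq_square power3_eq_cube)
    also have "\<dots> \<le> real s * (real n / 160)\<^sup>2" using assms by (intro mult_left_mono power_mono) auto
    finally show ?thesis .
  qed
  also have "(real n)\<^sup>2 \<le> real s * (real n)\<^sup>2" using assms mult_right_mono[of 1 "real s" "(real n)\<^sup>2"] by simp
  finally show ?thesis by (simp add: power_divide)
qed

lemma star_matching_bound:
  assumes r: "r \<ge> 4" and rt: "3 * t < 2 * (r - 1) \<and> t \<ge> 1 \<or> r = 4 \<and> t = 2"
  shows "\<exists>N. \<forall>(V :: 'a set) E E1. N \<le> card V \<longrightarrow> sgraph V E \<longrightarrow> c4_free E \<longrightarrow> E1 \<subseteq> E \<longrightarrow>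
     (\<Sum>v\<in>V. deg E1 v choose (r - 1)) + nmat t (E - E1)
       \<le> ((card V - 1) choose (r - 1)) + (((card V - 1) div 2) choose t)"
proof -
  define \<epsilon> where "\<epsilon> = 1 / (40 * real r)"
  have eps: "\<epsilon> > 0" "\<epsilon> \<le> 1 / 8" "\<epsilon> \<le> 1" using r by (auto simp: \<epsilon>_def field_simps)
  have "\<exists>N. \<forall>(V :: 'a set) E E1. N \<le> card V \<longrightarrow> sgraph V E \<longrightarrow> c4_free E \<longrightarrow> E1 \<subseteq> E \<longrightarrow>
     (\<forall>v\<in>V. real (deg E1 v) < (1 - \<epsilon>) * real (card V)) \<longrightarrow>
     real (\<Sum>v\<in>V. deg E1 v choose (r - 1)) + real (nmat t (E - E1)) < real ((card V - 1) choose (r - 1))"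
    using rt large_star_needed[OF r _ eps(1,3), of t] large_star_needed_4_2[OF eps(1,2)] by blast
  then obtain N1 where N1: "\<And>(V :: 'a set) E E1. N1 \<le> card V \<Longrightarrow> sgraph V E \<Longrightarrow> c4_free E \<Longrightarrow> E1 \<subseteq> E \<Longrightarrow>
     (\<forall>v\<in>V. real (deg E1 v) < (1 - \<epsilon>) * real (card V)) \<Longrightarrow>
     real (\<Sum>v\<in>V. deg E1 v choose (r - 1)) + real (nmat t (E - E1)) < real ((card V - 1) choose (r - 1))"
    by blast
  have "\<exists>N. \<forall>n\<ge>N. \<forall>e2 s. 1 \<le> s \<longrightarrow> real s \<le> real n / (40 * real r) \<longrightarrow>
     2 * real e2 \<le> real n + 4 * real s + 2 * sqrt (real s) ^ 3 \<longrightarrow>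
     real (e2 choose t) \<le> 7 / 10 * (real s * real n ^ (r - 2) / fact (r - 2))"
    using rt
  proof
    assume a: "3 * t < 2 * (r - 1) \<and> t \<ge> 1"
    have "s \<le> n" if "real s \<le> real n / (40 * real r)" for s n
    proof -
      have "real n / (40 * real r) \<le> real n / 1" using r by (intro divide_left_mono) auto
      hence "real s \<le> real n" using that by simp
      thus ?thesis by simp
    qed
    thus ?thesis using near_star_red_small[OF r, of t] a by meson
  next
    assume "r = 4 \<and> t = 2"
    thus ?thesis using near_star_red_small_4_2 by auto
  qed
  then obtain N2 where N2: "\<And>n e2 s. n \<ge> N2 \<Longrightarrow> 1 \<le> s \<Longrightarrow> real s \<le> real n / (40 * real r) \<Longrightarrow>
     2 * real e2 \<le> real n + 4 * real s + 2 * sqrt (real s) ^ 3 \<Longrightarrow>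
     real (e2 choose t) \<le> 7 / 10 * (real s * real n ^ (r - 2) / fact (r - 2))" by blast
  have "(\<Sum>v\<in>V. deg E1 v choose (r - 1)) + nmat t (E - E1)
       \<le> ((card V - 1) choose (r - 1)) + (((card V - 1) div 2) choose t)"
    if c: "N1 \<le> card V" "N2 \<le> card V" "40 * r\<^sup>2 \<le> card V" and G: "sgraph V E" "c4_free E" "E1 \<subseteq> E" for V :: "'a set" and E E1
  proof -
    define S where "S = (\<Sum>v\<in>V. deg E1 v choose (r - 1))"
    have fin: "finite V" "finite (E - E1)" using G sgraph_finite by blast+
    have g1: "sgraph V E1" using G sgraph_subset by blast
    have strict: ?thesis if "real S + real (nmat t (E - E1)) < real ((card V - 1) choose (r - 1))"
    proof -
      have "real (S + nmat t (E - E1)) < real ((card V - 1) choose (r - 1))" using that by simp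
      hence "S + nmat t (E - E1) < (card V - 1) choose (r - 1)" by (simp only: of_nat_less_iff)
      thus ?thesis by (simp add: S_def)
    qed
    show ?thesis
    proof (cases "\<forall>v\<in>V. real (deg E1 v) < (1 - \<epsilon>) * real (card V)")
      case True
      show ?thesis by (rule strict) (unfold S_def, rule N1[OF c(1) G True])
    next
      case False
      then obtain v where v: "v \<in> V" "(1 - \<epsilon>) * real (card V) \<le> real (deg E1 v)" by force
      define s where "s = card V - 1 - deg E1 v"
      have "card V > 0" using v fin card_gt_0_iff by blast
      hence n: "card V = deg E1 v + 1 + s" using deg_le[OF g1 v(1)] by (simp add: s_def)
      note str = near_star_structure[OF G v(1) n]
      \<comment> \<open>If \<open>s = 0\<close> the bound is attained: all other blue degrees are at
        most 2 < r - 1, so only \<open>v\<close> carries stars, and at most (n - 1) / 2 red edges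
        remain. If \<open>s \<ge> 1\<close> the inequality is strict.\<close>
      show ?thesis
      proof (cases "s = 0")
        case True
        have "S = (deg E1 v choose (r - 1)) + (\<Sum>u\<in>V - {v}. deg E1 u choose (r - 1))"
          unfolding S_def using fin(1) v(1) by (rule sum.remove)
        also have "(\<Sum>u\<in>V - {v}. deg E1 u choose (r - 1)) = 0"
        proof (intro sum.neutral ballI)
          fix u assume "u \<in> V - {v}"
          hence "deg E1 u \<le> 2" using str(1)[of u] True by simp
          thus "deg E1 u choose (r - 1) = 0" using r by simp
        qed
        finally have "S = (card V - 1) choose (r - 1)" using n True by simp
        moreover have "card (E - E1) \<le> (card V - 1) div 2"
        proof -
          have "real (2 * card (E - E1)) \<le> real (card V - 1)" using str(2) True n by simp
          hence "2 * card (E - E1) \<le> card V - 1" by (simp only: of_nat_le_iff)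
          thus ?thesis by simp
        qed
        hence "nmat t (E - E1) \<le> ((card V - 1) div 2) choose t"
          using nmat_le_choose[OF fin(2), of t] binomial_right_mono[of "card (E - E1)" "(card V - 1) div 2" t] by linarith
        ultimately show ?thesis by (simp add: S_def)
      next
        case False
        hence s1: "1 \<le> s" by simp
        have "real s \<le> \<epsilon> * real (card V)" using v(2) n by (simp add: algebra_simps)
        hence s2: "real s \<le> real (card V) / (40 * real r)" by (simp add: \<epsilon>_def)
        have "2 * real (card (E - E1)) \<le> real (card V) + 4 * real s + 2 * sqrt (real s) ^ 3" using str(2) n by simp
        from N2[OF c(2) s1 s2 this]
        have "real (card (E - E1) choose t) \<le> 7 / 10 * (real s * real (card V) ^ (r - 2) / fact (r - 2))" .
        moreover have "real (nmat t (E - E1)) \<le> real (card (E - E1) choose t)"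
          by (rule of_nat_mono[OF nmat_le_choose[OF fin(2)]])
        ultimately have "real (nmat t (E - E1)) \<le> 7 / 10 * (real s * real (card V) ^ (r - 2) / fact (r - 2))" by linarith
        from near_star_strict[OF G v(1) n r s1 _ c(3) this] s2
        show ?thesis by (intro strict) (simp add: S_def)
      qed
    qed
  qed
  thus ?thesis by (intro exI[of _ "max N1 (max N2 (40 * r\<^sup>2))"]) auto
qed

section \<open>Cherries and edges\<close>

text \<open>
  A red edge of a triangle \<open>a < b < c\<close> is charged along the cyclic orientation \<open>a, b, c, a\<close>: the edge
  from \<open>x\<close> to \<open>y\<close> pays for the pair of \<open>x\<close> and the third vertex, whose only common neighbour is \<open>y\<close>.
\<close>

definition cyc :: "nat \<Rightarrow> nat \<Rightarrow> nat \<Rightarrow> bool" where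
  "cyc x y z \<longleftrightarrow> x < y \<and> y < z \<or> y < z \<and> z < x \<or> z < x \<and> x < y"

definition charged :: "nat set set \<Rightarrow> nat set \<Rightarrow> nat set \<Rightarrow> bool" where
  "charged E e B \<longleftrightarrow> (\<exists>x y. e = {x, y} \<and> B = e \<and> nbr E x \<inter> nbr E y = {}) \<or>
     (\<exists>x y w. e = {x, y} \<and> w \<in> nbr E x \<inter> nbr E y \<and> cyc x y w \<and> B = {x, w})"

definition blue_pairs :: "nat set \<Rightarrow> nat set set \<Rightarrow> nat set set" where
  "blue_pairs V E1 = (\<Union>v\<in>V. {B. B \<subseteq> nbr E1 v \<and> card B = 2})"

lemma c4_free_unique:
  assumes "c4_free E" "u \<noteq> v" "x \<in> nbr E u" "x \<in> nbr E v" "y \<in> nbr E u" "y \<in> nbr E v"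
  shows "x = y"
  using assms unfolding c4_free_def by blast

lemma card_blue_pairs:
  assumes "sgraph V E1" "c4_free E1"
  shows "card (blue_pairs V E1) = (\<Sum>v\<in>V. deg E1 v choose 2)"
proof -
  have "card (blue_pairs V E1) = (\<Sum>v\<in>V. card {B. B \<subseteq> nbr E1 v \<and> card B = 2})"
    unfolding blue_pairs_def
  proof (rule card_UN_disjoint)
    show "\<forall>u\<in>V. \<forall>v\<in>V. u \<noteq> v \<longrightarrow> {B. B \<subseteq> nbr E1 u \<and> card B = 2} \<inter> {B. B \<subseteq> nbr E1 v \<and> card B = 2} = {}"
    proof (intro ballI impI equals0I)
      fix u v B assume uv: "u \<noteq> v" and B: "B \<in> {B. B \<subseteq> nbr E1 u \<and> card B = 2} \<inter> {B. B \<subseteq> nbr E1 v \<and> card B = 2}"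
      then obtain x y where "B = {x, y}" "x \<noteq> y" by (auto simp: card_2_iff)
      thus False using B uv c4_free_unique[OF assms(2) uv, of x y] by auto
    qed
  qed (use sgraph_finite[OF assms(1)] finite_nbr[OF assms(1)] in auto)
  thus ?thesis by (simp add: n_subsets finite_nbr[OF assms(1)])
qed

lemma charged_exists:
  assumes "sgraph V E" "e \<in> E"
  shows "\<exists>B. charged E e B"
proof -
  obtain x y where xy: "e = {x, y}" "x \<noteq> y" using sgraph_edge[OF assms] by blast
  show ?thesis
  proof (cases "nbr E x \<inter> nbr E y = {}")
    case True
    thus ?thesis using xy unfolding charged_def by blast
  next
    case False
    then obtain w where w: "w \<in> nbr E x \<inter> nbr E y" by blast
    have "w \<noteq> x" "w \<noteq> y" using w nbr_subset[OF assms(1)] by blast+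
    hence "cyc x y w \<or> cyc y x w" using xy(2) unfolding cyc_def by linarith
    moreover have "\<exists>B. charged E e B" if "e = {p, q}" "w \<in> nbr E p \<inter> nbr E q" "cyc p q w" for p q
    proof -
      have "charged E e {p, w}" unfolding charged_def
        by (rule disjI2, rule exI[of _ p], rule exI[of _ q], rule exI[of _ w]) (use that in simp)
      thus ?thesis ..
    qed
    moreover have "e = {y, x}" "w \<in> nbr E y \<inter> nbr E x" using xy w by auto
    ultimately show ?thesis using xy(1) w by metis
  qed
qed

lemma charged_triangle:
  assumes "sgraph V E" "w \<in> nbr E x \<inter> nbr E y" "{x, y} \<in> E"
  shows "x \<noteq> w" "{x, w} \<in> E" "y \<in> nbr E x \<inter> nbr E w"
proof -
  show "x \<noteq> w" using assms(2) nbr_subset[OF assms(1), of x] by blast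
  show "{x, w} \<in> E" "y \<in> nbr E x \<inter> nbr E w"
    using assms by (auto simp: nbr_def insert_commute)
qed

text \<open>A pair \<open>{x, w}\<close> from a triangle has the third vertex as its only common
  neighbour, which determines the triangle, and the cyclic orientation then tells its three edges
  apart. The fact \<open>no\<close> rules out that a pair is paid for in both ways, since an edge of
  a triangle does have a common neighbour.\<close>

lemma charged_inj:
  assumes G: "sgraph V E" "c4_free E" and e: "e \<in> E" "e' \<in> E" and c: "charged E e B" "charged E e' B"
  shows "e = e'"
proof -
  have no: False if a: "a = {p, q}" "a \<in> E" "nbr E p \<inter> nbr E q = {}" "b = {x, y}" "b \<in> E"
      "w \<in> nbr E x \<inter> nbr E y" "a = {x, w}" for a b p q x y w
  proof -
    have "y \<in> nbr E x \<inter> nbr E w" using charged_triangle[OF G(1) a(6)] a by auto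
    thus False using a(1,3,7) by (auto simp: doubleton_eq_iff)
  qed
  from c show ?thesis
    unfolding charged_def
  proof (elim disjE exE conjE)
    fix x y p q w assume "e = {x, y}" "B = e" "nbr E x \<inter> nbr E y = {}" "e' = {p, q}" "w \<in> nbr E p \<inter> nbr E q" "B = {p, w}"
    thus ?thesis using no[of e x y e' p q w] e by auto
  next
    fix x y p q w assume "e' = {x, y}" "B = e'" "nbr E x \<inter> nbr E y = {}" "e = {p, q}" "w \<in> nbr E p \<inter> nbr E q" "B = {p, w}"
    thus ?thesis using no[of e' x y e p q w] e by auto
  next
    fix x y w x' y' w'
    assume a: "e = {x, y}" "w \<in> nbr E x \<inter> nbr E y" "cyc x y w" "B = {x, w}"
      "e' = {x', y'}" "w' \<in> nbr E x' \<inter> nbr E y'" "cyc x' y' w'" "B = {x', w'}"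
    note t = charged_triangle[OF G(1) a(2)] charged_triangle[OF G(1) a(6)]
    have eq: "{x, w} = {x', w'}" using a by simp
    have "y' \<in> nbr E x \<inter> nbr E w" using t(6) eq e a by (auto simp: doubleton_eq_iff)
    hence "y = y'" using c4_free_unique[OF G(2), of x w y y'] t(1,3) e a by auto
    thus "e = e'" using eq a unfolding cyc_def by (auto simp: doubleton_eq_iff)
  qed auto
qed

text \<open>The centre of a blue cherry on \<open>B\<close> would be a common neighbour of
  \<open>B\<close>. An edge outside all triangles has none; in a triangle it could only be the
  vertex \<open>y\<close>, and then the red edge \<open>{x, y}\<close> would be blue.\<close>

lemma charged_not_blue:
  assumes G: "sgraph V E" "c4_free E" "E1 \<subseteq> E" and e: "e \<in> E - E1" and c: "charged E e B"
  shows "B \<notin> blue_pairs V E1"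
proof
  assume "B \<in> blue_pairs V E1"
  then obtain v where v: "B \<subseteq> nbr E1 v" unfolding blue_pairs_def by blast
  from c show False unfolding charged_def
  proof (elim disjE exE conjE)
    fix x y assume a: "e = {x, y}" "B = e" "nbr E x \<inter> nbr E y = {}"
    hence "v \<in> nbr E1 x" "v \<in> nbr E1 y" using v nbr_sym[of v E1] by auto
    thus False using a(3) nbr_mono[OF G(3)] by blast
  next
    fix x y w assume a: "e = {x, y}" "w \<in> nbr E x \<inter> nbr E y" "B = {x, w}"
    have t: "x \<noteq> w" "y \<in> nbr E x \<inter> nbr E w" using charged_triangle[OF G(1) a(2)] a e by auto
    have v': "v \<in> nbr E1 x" "v \<in> nbr E1 w" using v a nbr_sym[of v E1] by auto
    hence "v \<in> nbr E x" "v \<in> nbr E w" using nbr_mono[OF G(3)] by blast+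
    hence "y = v" using c4_free_unique[OF G(2) t(1), of y v] t(2) by blast
    thus False using v'(1) a(1) e by (simp add: nbr_def)
  qed
qed

lemma charged_pair:
  assumes "sgraph V E" "e \<in> E" "charged E e B"
  shows "B \<subseteq> V \<and> card B = 2"
proof -
  have "B \<in> E"
    using assms(3) unfolding charged_def
  proof (elim disjE exE conjE)
    fix x y w assume a: "e = {x, y}" "w \<in> nbr E x \<inter> nbr E y" "B = {x, w}"
    thus ?thesis by (simp add: nbr_def)
  qed (use assms in simp)
  thus ?thesis using assms(1) unfolding sgraph_def by blast
qed

text \<open>A pair \<open>{u, v}\<close> without common neighbour can only be charged as a red edge
  outside all triangles. A further neighbour \<open>w\<close> of \<open>u\<close> would leave
  \<open>{v, w}\<close> uncharged: it is no edge, and its only common neighbour \<open>u\<close> is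
  joined to \<open>v\<close> in red. So \<open>{u, v}\<close> would be isolated, and with any third
  vertex \<open>w\<close> the pair \<open>{u, w}\<close> would be uncharged.\<close>

lemma all_pairs_common_nbr:
  assumes G: "sgraph V E" "c4_free E" "E1 \<subseteq> E" and n: "card V \<ge> 3"
    and all: "\<And>B. B \<subseteq> V \<Longrightarrow> card B = 2 \<Longrightarrow> B \<notin> blue_pairs V E1 \<Longrightarrow> \<exists>e\<in>E - E1. charged E e B"
    and uv: "u \<in> V" "v \<in> V" "u \<noteq> v"
  shows "nbr E u \<inter> nbr E v \<noteq> {}"
proof
  assume no: "nbr E u \<inter> nbr E v = {}"
  have used: "p \<in> V \<Longrightarrow> q \<in> V \<Longrightarrow> p \<noteq> q \<Longrightarrow>
      (\<exists>v. p \<in> nbr E1 v \<and> q \<in> nbr E1 v) \<or> {p, q} \<in> E - E1 \<and> nbr E p \<inter> nbr E q = {} \<or>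
      {p, q} \<in> E \<and> (\<exists>e y. e \<in> E - E1 \<and> (e = {p, y} \<or> e = {q, y}) \<and> y \<in> nbr E p \<inter> nbr E q)" for p q
  proof -
    assume pq: "p \<in> V" "q \<in> V" "p \<noteq> q"
    show ?thesis
    proof (cases "{p, q} \<in> blue_pairs V E1")
      case True
      thus ?thesis unfolding blue_pairs_def by blast
    next
      case False
      then obtain e where e: "e \<in> E - E1" "charged E e {p, q}" using all[of "{p, q}"] pq by auto
      from e(2) show ?thesis unfolding charged_def
      proof (elim disjE exE conjE)
        fix x y assume a: "e = {x, y}" "{p, q} = e" "nbr E x \<inter> nbr E y = {}"
        hence "nbr E p \<inter> nbr E q = {}" by (auto simp: doubleton_eq_iff)
        thus ?thesis using a e by auto
      next
        fix x y w assume a: "e = {x, y}" "w \<in> nbr E x \<inter> nbr E y" "{p, q} = {x, w}"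
        have t: "{x, w} \<in> E" "y \<in> nbr E x \<inter> nbr E w" using charged_triangle[OF G(1) a(2)] a e by auto
        have t': "{w, x} \<in> E" using t(1) by (simp add: insert_commute)
        show ?thesis using a t t' e(1) by (auto simp: doubleton_eq_iff)
      qed
    qed
  qed
  have red: "{u, v} \<in> E - E1"
    using used[OF uv] no nbr_mono[OF G(3)] nbr_sym[of _ E1] by blast
  have no_other: False if p: "{p, q} \<in> E - E1" "nbr E p \<inter> nbr E q = {}" "p \<in> V" "q \<in> V" "w \<in> nbr E p" "w \<noteq> q" for p q w
  proof -
    have wV: "w \<in> V" using p(5) nbr_subset[OF G(1)] by blast
    have pn: "p \<in> nbr E q" "p \<in> nbr E w" using p by (auto simp: nbr_def insert_commute)
    have uniq: "x = p" if "x \<in> nbr E q" "x \<in> nbr E w" for x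
      using c4_free_unique[OF G(2) _ that(1) that(2) pn] p(6) by blast
    have "{q, w} \<notin> E"
    proof
      assume "{q, w} \<in> E"
      hence "w \<in> nbr E p \<inter> nbr E q" using p(5) by (simp add: nbr_def)
      thus False using p(2) by blast
    qed
    then obtain x where x: "q \<in> nbr E1 x" "w \<in> nbr E1 x" using used[OF p(4) wV] p(6) by blast
    have "x \<in> nbr E q" "x \<in> nbr E w" using x nbr_mono[OF G(3)] nbr_sym[of _ E1] by blast+
    hence "x = p" by (rule uniq)
    thus False using x(1) p(1) by (simp add: nbr_def)
  qed
  have u1: "nbr E u \<subseteq> {v}" using no_other[OF red no uv(1,2)] by blast
  have v1: "nbr E v \<subseteq> {u}"
  proof -
    have "{v, u} \<in> E - E1" "nbr E v \<inter> nbr E u = {}" using red no by (auto simp: insert_commute)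
    thus ?thesis using no_other[of v u] uv by blast
  qed
  have "\<not> V \<subseteq> {u, v}"
  proof
    assume "V \<subseteq> {u, v}"
    hence "card V \<le> card {u, v}" by (intro card_mono) auto
    thus False using n uv(3) by simp
  qed
  then obtain w where w: "w \<in> V" "w \<noteq> u" "w \<noteq> v" by blast
  have "{u, w} \<notin> E" using u1 w by (auto simp: nbr_def)
  then obtain x where x: "u \<in> nbr E1 x" "w \<in> nbr E1 x" using used[OF uv(1) w(1)] w(2) by blast
  have "x \<in> nbr E u" "w \<in> nbr E x" using x nbr_mono[OF G(3)] nbr_sym[of _ E1] by blast+
  hence "w \<in> nbr E v" using u1 by blast
  thus False using v1 w by blast
qed

text \<open>The graph induced on a neighbourhood is 1-regular, so all degrees are even. Every vertex
  other than \<open>v\<close> is reached from \<open>v\<close> by exactly one path with two edges,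
  so \<open>card V - 1\<close> is the sum of the degrees minus one over the neighbours of
  \<open>v\<close>: an even number of odd terms.\<close>

lemma friendship_graph_odd:
  assumes G: "sgraph V E" "c4_free E" and ne: "v \<in> V"
    and all: "\<And>u v. u \<in> V \<Longrightarrow> v \<in> V \<Longrightarrow> u \<noteq> v \<Longrightarrow> nbr E u \<inter> nbr E v \<noteq> {}"
  shows "odd (card V)"
proof -
  have fin: "finite V" using G sgraph_finite by blast
  have one: "card (nbr E u \<inter> nbr E v) = 1" if "u \<in> V" "v \<in> V" "u \<noteq> v" for u v
  proof -
    have "card (nbr E u \<inter> nbr E v) \<noteq> 0" using all[OF that] finite_nbr[OF G(1)] by simp
    thus ?thesis using c4_free_common[OF G(2,1) that(3)] by linarith
  qed
  have even: "even (deg E v)" if v: "v \<in> V" for v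
  proof -
    define N where "N = nbr E v"
    define EN where "EN = {e \<in> E. e \<subseteq> N}"
    have NV: "N \<subseteq> V - {v}" unfolding N_def by (rule nbr_subset[OF G(1)])
    have sN: "sgraph N EN" using G(1) finite_nbr[OF G(1)] unfolding sgraph_def EN_def N_def by auto
    have "deg EN u = 1" if u: "u \<in> N" for u
    proof -
      have "nbr EN u = nbr E v \<inter> nbr E u" using u unfolding EN_def nbr_def N_def by auto
      thus ?thesis using one[of v u] u v NV by auto
    qed
    hence "card N = 2 * card EN" using handshake[OF sN] by simp
    thus ?thesis by (simp add: N_def)
  qed
  define N where "N = nbr E v"
  have NV: "N \<subseteq> V - {v}" unfolding N_def by (rule nbr_subset[OF G(1)])
  have finN: "finite N" unfolding N_def by (rule finite_nbr[OF G(1)])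
  have vn: "v \<in> nbr E u" if "u \<in> N" for u using that nbr_sym[of u E v] by (simp add: N_def)
  have "V - {v} = (\<Union>u\<in>N. nbr E u - {v})"
  proof
    show "V - {v} \<subseteq> (\<Union>u\<in>N. nbr E u - {v})"
    proof
      fix w assume w: "w \<in> V - {v}"
      then obtain u where "u \<in> nbr E v" "u \<in> nbr E w" using all[OF ne, of w] by blast
      thus "w \<in> (\<Union>u\<in>N. nbr E u - {v})" using w nbr_sym[of u E w] unfolding N_def by blast
    qed
    show "(\<Union>u\<in>N. nbr E u - {v}) \<subseteq> V - {v}" using nbr_subset[OF G(1)] by blast
  qed
  hence "card (V - {v}) = card (\<Union>u\<in>N. nbr E u - {v})" by simp
  also have "\<dots> = (\<Sum>u\<in>N. card (nbr E u - {v}))"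
  proof (rule card_UN_disjoint[OF finN])
    show "\<forall>u\<in>N. \<forall>u'\<in>N. u \<noteq> u' \<longrightarrow> (nbr E u - {v}) \<inter> (nbr E u' - {v}) = {}"
      using c4_free_unique[OF G(2)] vn by blast
  qed (use finite_nbr[OF G(1)] in auto)
  finally have c: "card V - 1 = (\<Sum>u\<in>N. card (nbr E u - {v}))" using ne by simp
  have "(\<Sum>u\<in>N. deg E u) = (\<Sum>u\<in>N. card (nbr E u - {v}) + 1)"
  proof (intro sum.cong refl)
    fix u assume "u \<in> N"
    from card_Suc_Diff1[OF finite_nbr[OF G(1)] vn[OF this]]
    show "deg E u = card (nbr E u - {v}) + 1" by simp
  qed
  also have "\<dots> = (card V - 1) + card N" by (simp only: sum.distrib c) simp
  finally have s: "(\<Sum>u\<in>N. deg E u) = (card V - 1) + card N" .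
  have "even (\<Sum>u\<in>N. deg E u)" using even NV by (intro dvd_sum) auto
  moreover have "even (card N)" using even[OF ne] by (simp add: N_def)
  ultimately have "even (card V - 1)" using s by simp
  moreover have "card V > 0" using ne fin card_gt_0_iff by blast
  ultimately show ?thesis by simp
qed

text \<open>Blue cherries and red edges occupy distinct pairs of vertices. The extra 1 is the pair
  that must stay free when \<open>card V\<close> is even, which makes the bound exact for
  \<open>Fn\<close>.\<close>

lemma cherry_edge_bound:
  fixes V :: "nat set"
  assumes G: "sgraph V E" "c4_free E" "E1 \<subseteq> E" and n: "card V \<ge> 3"
  shows "(\<Sum>v\<in>V. deg E1 v choose 2) + card (E - E1) + (if even (card V) then 1 else 0) \<le> card V choose 2"
proof -
  have fin: "finite V" "finite E" using G sgraph_finite by blast+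
  have g1: "sgraph V E1" "c4_free E1" using sgraph_subset[OF G(1,3)] c4_free_subset[OF G(2,3)] by auto
  define \<phi> where "\<phi> e = (SOME B. charged E e B)" for e
  have phi: "charged E e (\<phi> e)" if "e \<in> E" for e
    unfolding \<phi>_def using charged_exists[OF G(1) that] by (rule someI_ex)
  define P where "P = {B. B \<subseteq> V \<and> card B = 2}"
  have finP: "finite P" unfolding P_def using fin by simp
  have cP: "card P = card V choose 2" unfolding P_def by (rule n_subsets[OF fin(1)])
  define U where "U = blue_pairs V E1 \<union> \<phi> ` (E - E1)"
  have bP: "blue_pairs V E1 \<subseteq> P" unfolding blue_pairs_def P_def using nbr_subset[OF g1(1)] by blast
  have phiP: "\<phi> ` (E - E1) \<subseteq> P"
  proof
    fix B assume "B \<in> \<phi> ` (E - E1)"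
    then obtain e where "e \<in> E" "B = \<phi> e" by blast
    thus "B \<in> P" using charged_pair[OF G(1) _ phi] unfolding P_def by blast
  qed
  have UP: "U \<subseteq> P" using bP phiP by (simp add: U_def)
  have inj: "inj_on \<phi> (E - E1)"
  proof (rule inj_onI)
    fix e f assume ef: "e \<in> E - E1" "f \<in> E - E1" "\<phi> e = \<phi> f"
    have "charged E e (\<phi> e)" "charged E f (\<phi> f)" using ef phi by blast+
    hence "charged E e (\<phi> e)" "charged E f (\<phi> e)" using ef(3) by auto
    thus "e = f" using charged_inj[OF G(1,2)] ef by blast
  qed
  have dis: "blue_pairs V E1 \<inter> \<phi> ` (E - E1) = {}"
    using charged_not_blue[OF G] phi by blast
  have "card U = card (blue_pairs V E1) + card (\<phi> ` (E - E1))"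
    unfolding U_def using dis finP bP fin by (intro card_Un_disjoint) (auto intro: finite_subset)
  also have "\<dots> = (\<Sum>v\<in>V. deg E1 v choose 2) + card (E - E1)"
    using card_blue_pairs[OF g1] card_image[OF inj] by simp
  finally have cU: "card U = (\<Sum>v\<in>V. deg E1 v choose 2) + card (E - E1)" .
  show ?thesis
  proof (cases "U = P")
    case True
    have "odd (card V)"
    proof -
      have all: "\<exists>e\<in>E - E1. charged E e B" if B: "B \<subseteq> V" "card B = 2" "B \<notin> blue_pairs V E1" for B
      proof -
        have "B \<in> U" using True B by (simp add: P_def)
        then obtain e where "e \<in> E - E1" "B = \<phi> e" using B(3) by (auto simp: U_def)
        thus ?thesis using phi by auto
      qed
      have "V \<noteq> {}" using n by auto
      then obtain v where v: "v \<in> V" by blast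
      show ?thesis
        by (rule friendship_graph_odd[OF G(1,2) v], rule all_pairs_common_nbr[OF G n all])
    qed
    thus ?thesis using cU cP True by simp
  next
    case False
    hence "card U < card P" using UP finP by (intro psubset_card_mono) auto
    thus ?thesis using cU cP by auto
  qed
qed

section \<open>The graphs Fn\<close>

lemma Fn_red_image: "Fn_red n = (\<lambda>i. {2 * i - 1, 2 * i}) ` {1..(n - 1) div 2}"
  unfolding Fn_red_def by auto

lemma sgraph_Fn: "sgraph {..<n} (Fn n)"
  unfolding graph_on_iff_sgraph[symmetric] graph_on_def
proof
  fix e assume "e \<in> Fn n"
  then consider i where "e = {0, i}" "1 \<le> i" "i < n" | i where "e = {2 * i - 1, 2 * i}" "1 \<le> i" "i \<le> (n - 1) div 2"
    unfolding Fn_def Fn_blue_def Fn_red_def by blast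
  thus "e \<in> {e. \<exists>u v. e = {u, v} \<and> u \<noteq> v \<and> u < n \<and> v < n}"
  proof cases
    case 1
    thus ?thesis by (intro CollectI exI[of _ 0] exI[of _ i]) auto
  next
    case 2
    hence "2 * i \<le> n - 1" by linarith
    thus ?thesis using 2 by (intro CollectI exI[of _ "2 * i - 1"] exI[of _ "2 * i"]) auto
  qed
qed

lemma nbr_Fn:
  assumes "i \<ge> 1"
  shows "nbr (Fn n) i \<subseteq> {0, if odd i then i + 1 else i - 1}"
proof
  fix x assume "x \<in> nbr (Fn n) i"
  then consider j where "{i, x} = {0, j}" | j where "{i, x} = {2 * j - 1, 2 * j}" "1 \<le> j"
    unfolding nbr_def Fn_def Fn_blue_def Fn_red_def by auto
  thus "x \<in> {0, if odd i then i + 1 else i - 1}"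
  proof cases
    case 1
    thus ?thesis using assms by (auto simp: doubleton_eq_iff)
  next
    case 2
    hence "i = 2 * j - 1 \<and> x = 2 * j \<or> i = 2 * j \<and> x = 2 * j - 1" by (auto simp: doubleton_eq_iff)
    thus ?thesis using 2(2) by auto
  qed
qed

lemma c4_free_Fn: "c4_free (Fn n)"
proof -
  define p where "p i = (if odd i then i + 1 else i - 1)" for i :: nat
  have nb: "nbr (Fn n) i \<subseteq> {0, p i}" if "i \<ge> 1" for i
    using nbr_Fn[OF that] by (simp add: p_def)
  have no0: "0 \<notin> nbr (Fn n) 0" using nbr_subset[OF sgraph_Fn, of n 0] by blast
  have pinj: "i = j" if "p i = p j" "i \<ge> 1" "j \<ge> 1" for i j
    using that unfolding p_def by (auto split: if_splits) presburger+
  show ?thesis unfolding c4_free_def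
  proof (intro allI impI)
    fix u v x y assume uv: "u \<noteq> v" and xy: "x \<in> nbr (Fn n) u \<inter> nbr (Fn n) v" "y \<in> nbr (Fn n) u \<inter> nbr (Fn n) v"
    consider "u = 0" | "v = 0" | "u \<ge> 1" "v \<ge> 1" by linarith
    thus "x = y"
    proof cases
      case 1
      hence "x = p v" "y = p v" using xy uv no0 nb[of v] by auto
      thus ?thesis by simp
    next
      case 2
      hence "x = p u" "y = p u" using xy uv no0 nb[of u] by auto
      thus ?thesis by simp
    next
      case 3
      have "p u \<noteq> p v" using pinj 3 uv by blast
      hence "x = 0" "y = 0" using xy nb[OF 3(1)] nb[OF 3(2)] by auto
      thus ?thesis by simp
    qed
  qed
qed

lemma nbr_Fn_blue_0: "nbr (Fn_blue n) 0 = {1..<n}"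
  unfolding nbr_def Fn_blue_def by (auto simp: doubleton_eq_iff)

lemma Fn_minus_blue: "Fn n - Fn_blue n = Fn_red n"
proof -
  have "Fn_blue n \<inter> Fn_red n = {}"
  proof (intro equals0I)
    fix e assume "e \<in> Fn_blue n \<inter> Fn_red n"
    hence "e \<in> Fn_blue n" "e \<in> Fn_red n" by auto
    have "0 \<in> e" using \<open>e \<in> Fn_blue n\<close> unfolding Fn_blue_def by auto
    moreover have "0 \<notin> e" using \<open>e \<in> Fn_red n\<close> unfolding Fn_red_def by auto
    ultimately show False by blast
  qed
  thus ?thesis unfolding Fn_def by blast
qed

lemma copies_star_Fn_blue_ge:
  assumes "r \<ge> 3" "n \<ge> 1"
  shows "(n - 1) choose (r - 1) \<le> copies (star r) (Fn_blue n)"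
proof -
  have sg: "sgraph {..<n} (Fn_blue n)" by (rule sgraph_subset[OF sgraph_Fn]) (simp add: Fn_def)
  have "deg (Fn_blue n) 0 choose (r - 1) \<le> (\<Sum>v<n. deg (Fn_blue n) v choose (r - 1))"
    by (rule member_le_sum) (use assms in auto)
  thus ?thesis using copies_star[OF sg assms(1)] by (simp add: nbr_Fn_blue_0)
qed

lemma copies_matching_Fn_red: "copies (matching t) (Fn_red n) = ((n - 1) div 2) choose t"
proof -
  have sg: "sgraph {..<n} (Fn_red n)" by (rule sgraph_subset[OF sgraph_Fn]) (simp add: Fn_def)
  define h where "h i = {2 * i - 1, 2 * i}" for i :: nat
  have dis: "h i \<inter> h j = {}" if "i \<ge> 1" "j \<ge> 1" "i \<noteq> j" for i j
    using that unfolding h_def by auto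
  have R: "Fn_red n = h ` {1..(n - 1) div 2}" unfolding Fn_red_image h_def by simp
  have "inj_on h {1..(n - 1) div 2}"
  proof (rule inj_onI)
    fix i j assume ij: "i \<in> {1..(n - 1) div 2}" "j \<in> {1..(n - 1) div 2}" "h i = h j"
    have "h i \<noteq> {}" by (simp add: h_def)
    thus "i = j" using dis[of i j] ij by auto
  qed
  hence c: "card (Fn_red n) = (n - 1) div 2" unfolding R by (simp add: card_image)
  have pw: "pairwise disjnt (Fn_red n)"
  proof (rule pairwiseI)
    have ex: "\<exists>i\<ge>1. A = h i" if "A \<in> Fn_red n" for A using that unfolding R by auto
    fix A B assume "A \<in> Fn_red n" "B \<in> Fn_red n" and AB: "A \<noteq> B"
    then obtain i j where ij: "i \<ge> 1" "j \<ge> 1" "A = h i" "B = h j" using ex by blast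
    have "i \<noteq> j" using AB ij by blast
    thus "disjnt A B" using dis ij by (simp add: disjnt_def)
  qed
  have "matchings t (Fn_red n) = {F. F \<subseteq> Fn_red n \<and> card F = t}"
    unfolding matchings_def using pairwise_subset[OF pw] by blast
  thus ?thesis using copies_matching[OF sg] c by (simp add: n_subsets sgraph_finite(2)[OF sg])
qed

lemma choose_two_Suc: "Suc m choose 2 = (m choose 2) + m"
  by (simp add: numeral_2_eq_2)

text \<open>The centre gives \<open>(n - 1) choose 2\<close> cherries and each matched leaf one
  more. For even \<open>n\<close> one leaf stays unmatched, the same deficit of 1 as in
  \<open>cherry_edge_bound\<close>.\<close>

lemma copies_star_3_Fn_ge:
  assumes "n \<ge> 3"
  shows "n choose 2 \<le> copies (star 3) (Fn n) + (if even n then 1 else 0)"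
proof -
  define k where "k = (n - 1) div 2"
  note fin = finite_nbr[OF sgraph_Fn]
  have d0: "n - 1 \<le> deg (Fn n) 0"
  proof -
    have "card {1..<n} \<le> deg (Fn n) 0"
      by (rule card_mono[OF fin]) (use nbr_mono[of "Fn_blue n" "Fn n" 0] in \<open>auto simp: nbr_Fn_blue_0 Fn_def\<close>)
    thus ?thesis by simp
  qed
  have di: "1 \<le> deg (Fn n) i choose 2" if i: "i \<in> {1..2 * k}" for i
  proof -
    define q where "q = (if odd i then i + 1 else i - 1)"
    have iN: "i < n" using i unfolding k_def by auto
    have q0: "q \<noteq> 0" using i unfolding q_def by auto
    have "{i, q} \<in> Fn_red n"
    proof (cases "odd i")
      case True
      then obtain j where j: "i = 2 * j + 1" by (elim oddE)
      have "{i, q} = {2 * (j + 1) - 1, 2 * (j + 1)}" using j by (simp add: q_def)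
      moreover have "j + 1 \<le> k" using i j by auto
      ultimately show ?thesis unfolding Fn_red_image k_def[symmetric]
        by (intro image_eqI[of _ _ "j + 1"]) auto
    next
      case False
      then obtain j where j: "i = 2 * j" by blast
      have "{i, q} = {2 * j - 1, 2 * j}" using j by (auto simp: q_def)
      thus ?thesis using i j unfolding Fn_red_image k_def[symmetric]
        by (intro image_eqI[of _ _ j]) auto
    qed
    moreover have "{0, i} \<in> Fn_blue n" using i iN unfolding Fn_blue_def by auto
    ultimately have "{0, q} \<subseteq> nbr (Fn n) i" by (auto simp: nbr_def Fn_def insert_commute)
    hence "card {0, q} \<le> deg (Fn n) i" by (rule card_mono[OF fin])
    hence "2 \<le> deg (Fn n) i" using q0 by simp
    hence "2 choose 2 \<le> deg (Fn n) i choose 2" by (rule binomial_right_mono)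
    thus ?thesis by simp
  qed
  have "((n - 1) choose 2) + 2 * k \<le> (deg (Fn n) 0 choose 2) + (\<Sum>i\<in>{1..2 * k}. deg (Fn n) i choose 2)"
  proof (rule add_mono)
    show "(n - 1) choose 2 \<le> deg (Fn n) 0 choose 2" by (rule binomial_right_mono[OF d0])
    have "(\<Sum>i\<in>{1..2 * k}. 1) \<le> (\<Sum>i\<in>{1..2 * k}. deg (Fn n) i choose 2)" by (rule sum_mono[OF di])
    thus "2 * k \<le> (\<Sum>i\<in>{1..2 * k}. deg (Fn n) i choose 2)" by simp
  qed
  also have "\<dots> = (\<Sum>i\<in>insert 0 {1..2 * k}. deg (Fn n) i choose 2)" by simp
  also have "\<dots> \<le> (\<Sum>i<n. deg (Fn n) i choose 2)"
    by (rule sum_mono2) (use assms in \<open>auto simp: k_def\<close>)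
  also have "\<dots> = copies (star 3) (Fn n)" using copies_star[OF sgraph_Fn, of 3 n] by simp
  finally have "((n - 1) choose 2) + 2 * k \<le> copies (star 3) (Fn n)" .
  moreover have "n choose 2 = ((n - 1) choose 2) + (n - 1)" using choose_two_Suc[of "n - 1"] assms by simp
  moreover have "n - 1 = 2 * k + (if even n then 1 else 0)" using assms unfolding k_def by auto
  ultimately show ?thesis by linarith
qed

section \<open>Extremal numbers\<close>

text \<open>The \<open>Max\<close> in \<open>ex\<close> and \<open>ex_col\<close> has its intended
  meaning only on finite nonempty sets.\<close>

lemma finite_sgraphs: "finite {E. sgraph {..<n :: nat} E}"
  by (rule finite_subset[of _ "Pow (Pow {..<n})"]) (auto simp: sgraph_def)

lemma sgraph_empty: "sgraph {..<n :: nat} {}" "c4_free {}"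
  by (auto simp: sgraph_def c4_free_def nbr_def)

lemma ex_col_set:
  "{copies H1 E1 + copies H2 (E - E1) | E E1. graph_on n E \<and> free_of C4 E \<and> E1 \<subseteq> E}
   = {copies H1 E1 + copies H2 (E - E1) | E E1. sgraph {..<n} E \<and> c4_free E \<and> E1 \<subseteq> E}"
  unfolding graph_on_iff_sgraph using free_of_C4_iff by blast

lemma finite_ex_col_set:
  "finite {copies H1 E1 + copies H2 (E - E1) | E E1. sgraph {..<n} E \<and> c4_free E \<and> E1 \<subseteq> E}"
proof -
  have "{copies H1 E1 + copies H2 (E - E1) | E E1. sgraph {..<n} E \<and> c4_free E \<and> E1 \<subseteq> E}
    \<subseteq> (\<lambda>(E, E1). copies H1 E1 + copies H2 (E - E1)) ` ({E. sgraph {..<n} E} \<times> {E. sgraph {..<n} E})"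
    using sgraph_subset by fastforce
  thus ?thesis using finite_sgraphs by (meson finite_SigmaI finite_imageI finite_subset)
qed

lemma ex_col_le:
  assumes "\<And>E E1. sgraph {..<n} E \<Longrightarrow> c4_free E \<Longrightarrow> E1 \<subseteq> E \<Longrightarrow> copies H1 E1 + copies H2 (E - E1) \<le> m"
  shows "ex_col n H1 H2 C4 \<le> m"
  unfolding ex_col_def ex_col_set
proof (rule Max.boundedI[OF finite_ex_col_set])
  show "{copies H1 E1 + copies H2 (E - E1) | E E1. sgraph {..<n} E \<and> c4_free E \<and> E1 \<subseteq> E} \<noteq> {}"
    using sgraph_empty by blast
qed (use assms in blast)

lemma ex_col_ge:
  assumes "sgraph {..<n} E" "c4_free E" "E1 \<subseteq> E"
  shows "copies H1 E1 + copies H2 (E - E1) \<le> ex_col n H1 H2 C4"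
  unfolding ex_col_def ex_col_set by (rule Max_ge[OF finite_ex_col_set]) (use assms in blast)

lemma ex_set:
  "{copies H E | E. graph_on n E \<and> free_of C4 E} = (\<lambda>E. copies H E) ` {E. sgraph {..<n} E \<and> c4_free E}"
  unfolding graph_on_iff_sgraph using free_of_C4_iff by blast

lemma finite_ex_set: "finite ((\<lambda>E. copies H E) ` {E. sgraph {..<n} E \<and> c4_free E})"
  by (intro finite_imageI finite_subset[OF _ finite_sgraphs[of n]]) auto

lemma ex_ge:
  assumes "sgraph {..<n} E" "c4_free E"
  shows "copies H E \<le> ex n H C4"
  unfolding ex_def ex_set by (rule Max_ge[OF finite_ex_set]) (use assms in blast)

lemma ex_attained:
  obtains E where "sgraph {..<n} E" "c4_free E" "copies H E = ex n H C4"
proof -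
  have "ex n H C4 \<in> (\<lambda>E. copies H E) ` {E. sgraph {..<n} E \<and> c4_free E}"
    unfolding ex_def ex_set by (rule Max_in[OF finite_ex_set]) (use sgraph_empty in blast)
  thus ?thesis using that by force
qed

lemma ex_le_ex_col:
  assumes "r \<ge> 2"
  shows "ex n H C4 \<le> ex_col n (star r) H C4"
proof -
  obtain E where E: "sgraph {..<n} E" "c4_free E" "copies H E = ex n H C4" by (rule ex_attained)
  have "copies (star r) {} + copies H (E - {}) \<le> ex_col n (star r) H C4"
    by (rule ex_col_ge) (use E in auto)
  thus ?thesis using E(3) by simp
qed

lemma ex_col_star_3_matching_1:
  assumes "n \<ge> 3"
  shows "ex_col n (star 3) (matching 1) C4 = copies (star 3) (Fn n)"
proof (rule antisym)
  show "ex_col n (star 3) (matching 1) C4 \<le> copies (star 3) (Fn n)"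
  proof (rule ex_col_le)
    fix E E1 assume G: "sgraph {..<n} E" "c4_free E" "E1 \<subseteq> E"
    have sg: "sgraph {..<n} E1" "sgraph {..<n} (E - E1)"
      using sgraph_subset[OF G(1,3)] sgraph_subset[OF G(1), of "E - E1"] by auto
    have "copies (star 3) E1 + copies (matching 1) (E - E1) = (\<Sum>v<n. deg E1 v choose 2) + card (E - E1)"
      using copies_star[OF sg(1), of 3] copies_matching[OF sg(2), of 1] nmat_1[of "E - E1"] by simp
    thus "copies (star 3) E1 + copies (matching 1) (E - E1) \<le> copies (star 3) (Fn n)"
      using cherry_edge_bound[OF G] copies_star_3_Fn_ge[OF assms] assms by (simp split: if_splits)
  qed
  \<comment> \<open>All of \<open>Fn n\<close> is coloured blue.\<close>
  have "copies (star 3) (Fn n) + copies (matching 1) (Fn n - Fn n) \<le> ex_col n (star 3) (matching 1) C4"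
    by (rule ex_col_ge) (use sgraph_Fn c4_free_Fn in auto)
  thus "copies (star 3) (Fn n) \<le> ex_col n (star 3) (matching 1) C4" by simp
qed

lemma ex_col_eq_Fn_star_col:
  assumes r: "r \<ge> 4" and rt: "3 * t < 2 * (r - 1) \<and> t \<ge> 1 \<or> r = 4 \<and> t = 2"
  shows "\<exists>N. \<forall>n\<ge>N. ex_col n (star r) (matching t) C4 = Fn_star_col (star r) (matching t) n"
proof -
  obtain N where N: "\<And>(V :: nat set) E E1. N \<le> card V \<Longrightarrow> sgraph V E \<Longrightarrow> c4_free E \<Longrightarrow> E1 \<subseteq> E \<Longrightarrow>
     (\<Sum>v\<in>V. deg E1 v choose (r - 1)) + nmat t (E - E1)
       \<le> ((card V - 1) choose (r - 1)) + (((card V - 1) div 2) choose t)"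
    using star_matching_bound[OF assms, where ?'a = nat] by blast
  have "ex_col n (star r) (matching t) C4 = Fn_star_col (star r) (matching t) n" if n: "n \<ge> max N 1" for n
  proof (rule antisym)
    show "ex_col n (star r) (matching t) C4 \<le> Fn_star_col (star r) (matching t) n"
    proof (rule ex_col_le)
      fix E E1 assume G: "sgraph {..<n} E" "c4_free E" "E1 \<subseteq> E"
      have sg: "sgraph {..<n} E1" "sgraph {..<n} (E - E1)"
        using sgraph_subset[OF G(1,3)] sgraph_subset[OF G(1), of "E - E1"] by auto
      have "copies (star r) E1 + copies (matching t) (E - E1) = (\<Sum>v<n. deg E1 v choose (r - 1)) + nmat t (E - E1)"
        using copies_star[OF sg(1), of r] copies_matching[OF sg(2), of t] r by simp
      also have "\<dots> \<le> ((n - 1) choose (r - 1)) + (((n - 1) div 2) choose t)"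
        using N[OF _ G] n by simp
      also have "\<dots> \<le> Fn_star_col (star r) (matching t) n"
        unfolding Fn_star_col_def copies_matching_Fn_red
        using copies_star_Fn_blue_ge[of r n] r n by simp
      finally show "copies (star r) E1 + copies (matching t) (E - E1) \<le> Fn_star_col (star r) (matching t) n" .
    qed
    show "Fn_star_col (star r) (matching t) n \<le> ex_col n (star r) (matching t) C4"
      unfolding Fn_star_col_def Fn_minus_blue[symmetric]
      by (rule ex_col_ge[OF sgraph_Fn c4_free_Fn]) (simp add: Fn_def)
  qed
  thus ?thesis by blast
qed

lemma ex_col_eq_ex_matching:
  assumes r: "r \<ge> 2" and t: "t \<ge> 1" and rt: "3 * t \<ge> 2 * (r - 1)" "(r, t) \<noteq> (4, 2)"
  shows "\<exists>N. \<forall>n\<ge>N. ex_col n (star r) (matching t) C4 = ex n (matching t) C4"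
proof -
  have "\<exists>N. \<forall>n\<ge>N. ex_col n (star r) (matching t) C4 \<le> ex n (matching t) C4"
  proof (cases "t = 1")
    case True
    \<comment> \<open>For \<open>t = 1\<close> the condition reads 2 (r - 1) \<le> 3. With single
      edges counted in both colours, every colouring then scores at most the total number of
      edges.\<close>
    hence r2: "r = 2" using r rt by auto
    have "ex_col n (star r) (matching t) C4 \<le> ex n (matching t) C4" for n
    proof (rule ex_col_le)
      fix E E1 assume G: "sgraph {..<n} E" "c4_free E" "E1 \<subseteq> E"
      have fin: "finite E" "finite E1" using G sgraph_finite finite_subset by blast+
      have sg: "sgraph {..<n} (E - E1)" using sgraph_subset[OF G(1), of "E - E1"] by auto
      have "copies (star r) E1 + copies (matching t) (E - E1) \<le> card E1 + card (E - E1)"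
        using copies_star_2_le[OF fin(2)] copies_matching[OF sg, of t] nmat_1[of "E - E1"] True r2 by simp
      also have "\<dots> = card E" using fin G(3) by (simp add: card_Diff_subset card_mono)
      also have "\<dots> = copies (matching t) E" using copies_matching[OF G(1), of t] nmat_1[of E] True by simp
      also have "\<dots> \<le> ex n (matching t) C4" by (rule ex_ge[OF G(1,2)])
      finally show "copies (star r) E1 + copies (matching t) (E - E1) \<le> ex n (matching t) C4" .
    qed
    thus ?thesis by blast
  next
    case False
    hence t2: "t \<ge> 2" using t by simp
    obtain N where N: "\<And>(V :: nat set) E E1. N \<le> card V \<Longrightarrow> sgraph V E \<Longrightarrow> c4_free E \<Longrightarrow> E1 \<subseteq> E \<Longrightarrow>
       (\<exists>E'. sgraph V E' \<and> c4_free E' \<and> (\<Sum>v\<in>V. deg E1 v choose (r - 1)) + nmat t (E - E1) \<le> nmat t E')"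
      using coloured_count_le_matching_count[OF rt(1) t2 rt(2) r, where ?'a = nat] by blast
    have "ex_col n (star r) (matching t) C4 \<le> ex n (matching t) C4" if n: "n \<ge> N" for n
    proof (rule ex_col_le)
      fix E E1 assume G: "sgraph {..<n} E" "c4_free E" "E1 \<subseteq> E"
      have sg: "sgraph {..<n} E1" "sgraph {..<n} (E - E1)"
        using sgraph_subset[OF G(1,3)] sgraph_subset[OF G(1), of "E - E1"] by auto
      obtain E' where E': "sgraph {..<n} E'" "c4_free E'"
        "(\<Sum>v<n. deg E1 v choose (r - 1)) + nmat t (E - E1) \<le> nmat t E'"
        using N[OF _ G] n by auto
      have "copies (star r) E1 + copies (matching t) (E - E1) \<le> nmat t E'"
        using copies_star_le[OF sg(1) r] copies_matching[OF sg(2), of t] E'(3) by simp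
      also have "\<dots> = copies (matching t) E'" using copies_matching[OF E'(1)] by simp
      also have "\<dots> \<le> ex n (matching t) C4" by (rule ex_ge[OF E'(1,2)])
      finally show "copies (star r) E1 + copies (matching t) (E - E1) \<le> ex n (matching t) C4" .
    qed
    thus ?thesis by blast
  qed
  then obtain N where "\<And>n. n \<ge> N \<Longrightarrow> ex_col n (star r) (matching t) C4 \<le> ex n (matching t) C4" by blast
  thus ?thesis by (intro exI[of _ N] allI impI antisym ex_le_ex_col[OF r])
qed

theorem mainTheorem10:
  fixes r t :: nat
  assumes "r \<ge> 2" and "t \<ge> 1"
  shows "(r = 3 \<and> t = 1 \<longrightarrow>
            (\<forall>n\<ge>3. ex_col n (star 3) (matching 1) C4 = copies (star 3) (Fn n)))
       \<and> (r \<ge> 4 \<and> 3 * t < 2 * (r - 1) \<longrightarrow>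
            (\<exists>N. \<forall>n\<ge>N. ex_col n (star r) (matching t) C4 = Fn_star_col (star r) (matching t) n))
       \<and> (r = 4 \<and> t = 2 \<longrightarrow>
            (\<exists>N. \<forall>n\<ge>N. ex_col n (star 4) (matching 2) C4 = Fn_star_col (star 4) (matching 2) n))
       \<and> (3 * t \<ge> 2 * (r - 1) \<and> (r, t) \<notin> {(3, 1), (4, 2)} \<longrightarrow>
            (\<exists>N. \<forall>n\<ge>N. ex_col n (star r) (matching t) C4 = ex n (matching t) C4))"
proof (intro conjI impI)
  show "\<forall>n\<ge>3. ex_col n (star 3) (matching 1) C4 = copies (star 3) (Fn n)"
    using ex_col_star_3_matching_1 by blast
next
  assume "r \<ge> 4 \<and> 3 * t < 2 * (r - 1)"
  thus "\<exists>N. \<forall>n\<ge>N. ex_col n (star r) (matching t) C4 = Fn_star_col (star r) (matching t) n"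
    using ex_col_eq_Fn_star_col assms(2) by blast
next
  show "\<exists>N. \<forall>n\<ge>N. ex_col n (star 4) (matching 2) C4 = Fn_star_col (star 4) (matching 2) n"
    by (rule ex_col_eq_Fn_star_col) auto
next
  assume "3 * t \<ge> 2 * (r - 1) \<and> (r, t) \<notin> {(3, 1), (4, 2)}"
  thus "\<exists>N. \<forall>n\<ge>N. ex_col n (star r) (matching t) C4 = ex n (matching t) C4"
    using ex_col_eq_ex_matching[OF assms] by blast
qed

end
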